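(* Consider M-CLP/M-CLP$^*$ with data $A,b,c$ and boundary parameters $\beta,\gamma,\lambda,\mu,T$. (i) An optimal solution of M-CLP/M-CLP$^*$ can be decomposed into optimal solutions of Internal-SCLP/SCLP$^*(x^0,q^N)$ and feasible solutions of Boundary-LP$(\tilde U,\tilde x)$ and Boundary-LP$^*(\tilde P,\tilde q)$ satisfying $$x^0=x^\bullet+\tilde x,\quad q^N=q^\bullet+\tilde q,\quad \tilde U=\int_0^Tu(t)\,dt,\quad \tilde P=\int_0^Tp(t)\,dt,$$ $$\tilde x_k=-\min_{1\le n\le N}\Bigl(0,\sum_{m=1}^n\dot x_k^m\tau_m\Bigr),\qquad \tilde q_j=-\min_{1\le n\le N}\Bigl(0,\sum_{m=n}^N\dot q_j^m\tau_m\Bigr),$$ $$(x^0)^{T}\mathbf p^0=(\mathbf x^N)^{T}\mathbf p^N=(q^N)^{T}\mathbf u^N=(\mathbf q^0)^{T}\mathbf u^0=0. \qquad ( * )$$ (ii) Conversely, a combination of optimal solutions of Internal-SCLP/SCLP$^*(x^0,q^N)$ and of feasible solutions of Boundary-LP$(\tilde U,\tilde x)$ and Boundary-LP$^*(\tilde P,\tilde q)$ that satisfy $( * )$ (the whole displayed system) can be composed into an optimal solution of M-CLP/M-CLP$^*$. (iii) The solutions of Boundary-LP$(\tilde U,\tilde x)$ and Boundary-LP$^*(\tilde P,\tilde q)$ considered in (i) and (ii) are optimal.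
   Context: Vector inequalities are componentwise; $A\in\mathbb R^{K\times J}$, $b,\beta,\lambda\in\mathbb R^K$, $c,\gamma,\mu\in\mathbb R^J$, $\lambda\le0$, $\mu\ge0$, $T$ is the time horizon. M-CLP: maximize $\mu^{T}U(0)+\int_{0-}^T(\gamma+(T-t)c)^{T}dU(t)$ subject to $AU(t)+x(t)=\beta+bt$ for $0\le t<T$, $AU(T)+x(T)=\beta+bT+\lambda$, where $U:[0,T]\to\mathbb R^J$ is nonnegative, nondecreasing and right-continuous ($U(0-)=0$), and $x(t)\ge0$. M-CLP$^*$: minimize $\lambda^{T}P(0)+\int_{0-}^T(\beta+(T-t)b)^{T}dP(t)$ subject to $A^{T}P(t)-q(t)=\gamma+ct$ for $0\le t<T$, $A^{T}P(T)-q(T)=\gamma+cT+\mu$, where $P:[0,T]\to\mathbb R^K$ is nonnegative, nondecreasing and right-continuous ($P(0-)=0$), and $q(t)\ge0$. Integrals are Lebesgue–Stieltjes and include jumps at $0$. Solutions considered (the form of optimal solutions of M-CLP/M-CLP$^*$): impulse controls $\mathbf u^0=U(0)$, $\mathbf u^N=U(T)-U(T-)$, $\mathbf p^N=P(0)$, $\mathbf p^0=P(T)-P(T-)$; and a partition $0=t_0<\dots<t_N=T$, $\tau_n=t_n-t_{n-1}$, with constant rates $u(t)=dU/dt=u^n$, $dx/dt=\dot x^n$ on $(t_{n-1},t_n)$ and $p(t)=dP/dt=p^n$, $dq/dt=\dot q^n$ on $(T-t_n,T-t_{n-1})$; states are continuous piecewise linear on $[0,T)$, with $x^0=x(0)$,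 $q^N=q(0)$, and values $\mathbf x^N=x(T)$, $\mathbf q^0=q(T)$ at $T$. An optimal solution of the pair M-CLP/M-CLP$^*$ is a pair of feasible solutions satisfying complementary slackness $\int_{0-}^Tx(T-t)^{T}dP(t)=\int_{0-}^Tq(T-t)^{T}dU(t)=0$ (strong duality holds). Internal-SCLP$(x^0,q^N)$ (parameters $x^0,q^N\ge0$): maximize $\int_0^T(-q^N+(T-t)c)^{T}u(t)\,dt$ subject to $\int_0^tA\,u(s)\,ds\le x^0+bt$, $u(t)\ge0$, $0\le t\le T$; its state is the slack $x(t)=x^0+bt-\int_0^tAu(s)\,ds$. Internal-SCLP$^*(x^0,q^N)$: minimize $\int_0^T(x^0+(T-t)b)^{T}p(t)\,dt$ subject to $\int_0^tA^{T}p(s)\,ds\ge-q^N+ct$, $p(t)\ge0$, $0\le t\le T$; its state is the surplus $q(t)=q^N-ct+\int_0^tA^{T}p(s)\,ds$. The solutions considered have piecewise constant controls: there is a partition $0=t_0<\dots<t_N=T$ with interval lengths $\tau_n=t_n-t_{n-1}$ such that $u(t)=u^n$ and $dx/dt=\dot x^n$ are constant on $(t_{n-1},t_n)$, and $p(t)=p^n$ and $dq/dt=\dot q^n$ are constant on $(T-t_n,T-t_{n-1})$, for $n=1,\dots,N$. Boundary-LP$(\tilde U,\tilde x)$: maximize $(\gamma+cT+\mu)^{T}\mathbf u^0+\gamma^{T}\mathbf u^N$ subject to $A\mathbf u^0+x^\bullet=\beta-\tilde x$, $A\mathbf u^0+A\mathbf u^N+\mathbf x^N=\beta+bT-A\tilde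 U+\lambda$, $\mathbf u^0,\mathbf u^N,x^\bullet,\mathbf x^N\ge0$. Boundary-LP$^*(\tilde P,\tilde q)$: minimize $(\beta+bT+\lambda)^{T}\mathbf p^N+\beta^{T}\mathbf p^0$ subject to $A^{T}\mathbf p^N-q^\bullet=\gamma+\tilde q$, $A^{T}\mathbf p^N+A^{T}\mathbf p^0-\mathbf q^0=\gamma+cT-A^{T}\tilde P+\mu$, $\mathbf p^N,\mathbf p^0,q^\bullet,\mathbf q^0\ge0$. Decomposing/composing means identifying the quantities with the same names: $u,x,p,q$ on the open interval with the Internal-SCLP solutions, and $\mathbf u^0,\mathbf u^N,\mathbf x^N,\mathbf p^N,\mathbf p^0,\mathbf q^0$, together with $x^\bullet=x^0-\tilde x$, $q^\bullet=q^N-\tilde q$, with the Boundary-LP solutions. *)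

theory Defs
  imports "HOL-Analysis.Analysis"
begin

text \<open>
  Vectors are elements of \<open>real ^ 'k\<close> and \<open>real ^ 'j\<close>, ordered componentwise, and
  \<open>A :: real ^ 'j ^ 'k\<close> has its rows indexed by \<open>'k\<close>.  All time functions are total on
  \<^typ>\<open>real\<close>; only their values on \<open>{0..T}\<close> matter.
\<close>

section \<open>M-CLP and its symmetric dual\<close>

definition mclp_feasible ::
  "real ^ 'j ^ 'k \<Rightarrow> real ^ 'k \<Rightarrow> real ^ 'k \<Rightarrow> real ^ 'k \<Rightarrow> real \<Rightarrow>
   (real \<Rightarrow> real ^ 'j) \<Rightarrow> (real \<Rightarrow> real ^ 'k) \<Rightarrow> bool" where
  "mclp_feasible A b \<beta> lam T U x \<longleftrightarrow>
     (\<forall>s\<in>{0..T}. 0 \<le> U s \<and> 0 \<le> x s) \<and>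
     mono_on {0..T} U \<and>
     (\<forall>s\<in>{0..<T}. continuous (at_right s) U) \<and>
     (\<forall>s\<in>{0..<T}. A *v U s + x s = \<beta> + s *\<^sub>R b) \<and>
     A *v U T + x T = \<beta> + T *\<^sub>R b + lam"

definition mclp_dual_feasible ::
  "real ^ 'j ^ 'k \<Rightarrow> real ^ 'j \<Rightarrow> real ^ 'j \<Rightarrow> real ^ 'j \<Rightarrow> real \<Rightarrow>
   (real \<Rightarrow> real ^ 'k) \<Rightarrow> (real \<Rightarrow> real ^ 'j) \<Rightarrow> bool" where
  "mclp_dual_feasible A c \<gamma> \<mu> T P q \<longleftrightarrow>
     (\<forall>s\<in>{0..T}. 0 \<le> P s \<and> 0 \<le> q s) \<and>
     mono_on {0..T} P \<and>
     (\<forall>s\<in>{0..<T}. continuous (at_right s) P) \<and>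
     (\<forall>s\<in>{0..<T}. transpose A *v P s - q s = \<gamma> + s *\<^sub>R c) \<and>
     transpose A *v P T - q T = \<gamma> + T *\<^sub>R c + \<mu>"

text \<open>
  The Lebesgue--Stieltjes integral of \<open>f\<close> over \<open>[0,T]\<close> with respect to \<open>F\<close>, with the
  convention \<open>F(0-) = 0\<close>: extending \<open>F\<close> by 0 to the left and by \<open>F T\<close> to the right makes the
  jump \<open>F 0\<close> at 0 an atom of the measure.
\<close>

definition stieltjes_integral :: "real \<Rightarrow> (real \<Rightarrow> real) \<Rightarrow> (real \<Rightarrow> real) \<Rightarrow> real" where
  "stieltjes_integral T f F =
     (LINT s : {0..T} | interval_measure (\<lambda>r. if r < 0 then 0 else F (min r T)). f s)"

definition stieltjes_inner ::
  "real \<Rightarrow> (real \<Rightarrow> real ^ 'n) \<Rightarrow> (real \<Rightarrow> real ^ 'n) \<Rightarrow> real" where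
  "stieltjes_inner T f F = (\<Sum>i\<in>UNIV. stieltjes_integral T (\<lambda>s. f s $ i) (\<lambda>s. F s $ i))"

text \<open>
  An optimal solution of the pair is a pair of feasible solutions satisfying complementary
  slackness; the dual runs in reversed time.
\<close>

definition mclp_optimal_pair ::
  "real ^ 'j ^ 'k \<Rightarrow> real ^ 'k \<Rightarrow> real ^ 'j \<Rightarrow> real ^ 'k \<Rightarrow> real ^ 'j \<Rightarrow> real ^ 'k \<Rightarrow> real ^ 'j \<Rightarrow>
   real \<Rightarrow> (real \<Rightarrow> real ^ 'j) \<Rightarrow> (real \<Rightarrow> real ^ 'k) \<Rightarrow>
   (real \<Rightarrow> real ^ 'k) \<Rightarrow> (real \<Rightarrow> real ^ 'j) \<Rightarrow> bool" where
  "mclp_optimal_pair A b c \<beta> \<gamma> lam \<mu> T U x P q \<longleftrightarrow>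
     mclp_feasible A b \<beta> lam T U x \<and>
     mclp_dual_feasible A c \<gamma> \<mu> T P q \<and>
     stieltjes_inner T (\<lambda>s. x (T - s)) P = 0 \<and>
     stieltjes_inner T (\<lambda>s. q (T - s)) U = 0"

section \<open>Piecewise constant rates\<close>

definition time_partition :: "real \<Rightarrow> nat \<Rightarrow> (nat \<Rightarrow> real) \<Rightarrow> bool" where
  "time_partition T N t \<longleftrightarrow> 1 \<le> N \<and> t 0 = 0 \<and> t N = T \<and> (\<forall>n\<in>{1..N}. t (n - 1) < t n)"

text \<open>
  The shape of the M-CLP solutions considered: impulses at most at 0 and at \<open>T\<close>, constant rates
  in between.  The rates are \<open>un n\<close>, \<open>xd n\<close> (primal control and state) and \<open>pn n\<close>, \<open>qd n\<close>
  (dual control and state) for \<open>n = 1..N\<close>.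
\<close>

definition mclp_form ::
  "real \<Rightarrow> nat \<Rightarrow> (nat \<Rightarrow> real) \<Rightarrow> (real \<Rightarrow> real ^ 'j) \<Rightarrow> (real \<Rightarrow> real ^ 'k) \<Rightarrow>
   (real \<Rightarrow> real ^ 'k) \<Rightarrow> (real \<Rightarrow> real ^ 'j) \<Rightarrow>
   (nat \<Rightarrow> real ^ 'j) \<Rightarrow> (nat \<Rightarrow> real ^ 'k) \<Rightarrow> (nat \<Rightarrow> real ^ 'k) \<Rightarrow> (nat \<Rightarrow> real ^ 'j) \<Rightarrow> bool" where
  "mclp_form T N t U x P q un xd pn qd \<longleftrightarrow>
     continuous_on {0..<T} U \<and> continuous_on {0..<T} x \<and>
     continuous_on {0..<T} P \<and> continuous_on {0..<T} q \<and>
     (\<forall>n\<in>{1..N}. \<forall>s\<in>{t (n - 1)<..<t n}.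
        (U has_vector_derivative un n) (at s) \<and> (x has_vector_derivative xd n) (at s)) \<and>
     (\<forall>n\<in>{1..N}. \<forall>s\<in>{T - t n<..<T - t (n - 1)}.
        (P has_vector_derivative pn n) (at s) \<and> (q has_vector_derivative qd n) (at s))"

section \<open>Internal-SCLP and its dual\<close>

text \<open>
  Feasible controls range over all nonnegative integrable functions; for a nonnegative
  function, gauge integrability is the same as Lebesgue integrability.
\<close>

definition sclp_state ::
  "real ^ 'j ^ 'k \<Rightarrow> real ^ 'k \<Rightarrow> real ^ 'k \<Rightarrow> (real \<Rightarrow> real ^ 'j) \<Rightarrow> real \<Rightarrow> real ^ 'k" where
  "sclp_state A b x0 u s = x0 + s *\<^sub>R b - integral {0..s} (\<lambda>r. A *v u r)"

definition sclp_feasible ::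
  "real ^ 'j ^ 'k \<Rightarrow> real ^ 'k \<Rightarrow> real ^ 'k \<Rightarrow> real \<Rightarrow> (real \<Rightarrow> real ^ 'j) \<Rightarrow> bool" where
  "sclp_feasible A b x0 T u \<longleftrightarrow>
     u integrable_on {0..T} \<and>
     (\<forall>s\<in>{0..T}. 0 \<le> u s \<and> integral {0..s} (\<lambda>r. A *v u r) \<le> x0 + s *\<^sub>R b)"

definition sclp_objective ::
  "real ^ 'j \<Rightarrow> real ^ 'j \<Rightarrow> real \<Rightarrow> (real \<Rightarrow> real ^ 'j) \<Rightarrow> real" where
  "sclp_objective c qN T u = integral {0..T} (\<lambda>s. (- qN + (T - s) *\<^sub>R c) \<bullet> u s)"

definition sclp_optimal ::
  "real ^ 'j ^ 'k \<Rightarrow> real ^ 'k \<Rightarrow> real ^ 'j \<Rightarrow> real ^ 'k \<Rightarrow> real ^ 'j \<Rightarrow> real \<Rightarrow>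
   (real \<Rightarrow> real ^ 'j) \<Rightarrow> bool" where
  "sclp_optimal A b c x0 qN T u \<longleftrightarrow>
     sclp_feasible A b x0 T u \<and>
     (\<forall>v. sclp_feasible A b x0 T v \<longrightarrow> sclp_objective c qN T v \<le> sclp_objective c qN T u)"

definition sclp_dual_state ::
  "real ^ 'j ^ 'k \<Rightarrow> real ^ 'j \<Rightarrow> real ^ 'j \<Rightarrow> (real \<Rightarrow> real ^ 'k) \<Rightarrow> real \<Rightarrow> real ^ 'j" where
  "sclp_dual_state A c qN p s = qN - s *\<^sub>R c + integral {0..s} (\<lambda>r. transpose A *v p r)"

definition sclp_dual_feasible ::
  "real ^ 'j ^ 'k \<Rightarrow> real ^ 'j \<Rightarrow> real ^ 'j \<Rightarrow> real \<Rightarrow> (real \<Rightarrow> real ^ 'k) \<Rightarrow> bool" where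
  "sclp_dual_feasible A c qN T p \<longleftrightarrow>
     p integrable_on {0..T} \<and>
     (\<forall>s\<in>{0..T}. 0 \<le> p s \<and> - qN + s *\<^sub>R c \<le> integral {0..s} (\<lambda>r. transpose A *v p r))"

definition sclp_dual_objective ::
  "real ^ 'k \<Rightarrow> real ^ 'k \<Rightarrow> real \<Rightarrow> (real \<Rightarrow> real ^ 'k) \<Rightarrow> real" where
  "sclp_dual_objective b x0 T p = integral {0..T} (\<lambda>s. (x0 + (T - s) *\<^sub>R b) \<bullet> p s)"

definition sclp_dual_optimal ::
  "real ^ 'j ^ 'k \<Rightarrow> real ^ 'k \<Rightarrow> real ^ 'j \<Rightarrow> real ^ 'k \<Rightarrow> real ^ 'j \<Rightarrow> real \<Rightarrow>
   (real \<Rightarrow> real ^ 'k) \<Rightarrow> bool" where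
  "sclp_dual_optimal A b c x0 qN T p \<longleftrightarrow>
     sclp_dual_feasible A c qN T p \<and>
     (\<forall>r. sclp_dual_feasible A c qN T r \<longrightarrow>
        sclp_dual_objective b x0 T p \<le> sclp_dual_objective b x0 T r)"

definition sclp_form ::
  "real ^ 'j ^ 'k \<Rightarrow> real ^ 'k \<Rightarrow> real ^ 'j \<Rightarrow> real ^ 'k \<Rightarrow> real ^ 'j \<Rightarrow>
   real \<Rightarrow> nat \<Rightarrow> (nat \<Rightarrow> real) \<Rightarrow> (real \<Rightarrow> real ^ 'j) \<Rightarrow> (real \<Rightarrow> real ^ 'k) \<Rightarrow>
   (nat \<Rightarrow> real ^ 'j) \<Rightarrow> (nat \<Rightarrow> real ^ 'k) \<Rightarrow> (nat \<Rightarrow> real ^ 'k) \<Rightarrow> (nat \<Rightarrow> real ^ 'j) \<Rightarrow> bool" where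
  "sclp_form A b c x0 qN T N t u p un xd pn qd \<longleftrightarrow>
     (\<forall>n\<in>{1..N}. \<forall>s\<in>{t (n - 1)<..<t n}.
        u s = un n \<and> (sclp_state A b x0 u has_vector_derivative xd n) (at s)) \<and>
     (\<forall>n\<in>{1..N}. \<forall>s\<in>{T - t n<..<T - t (n - 1)}.
        p s = pn n \<and> (sclp_dual_state A c qN p has_vector_derivative qd n) (at s))"

section \<open>Boundary-LP and its dual\<close>

text \<open>
  Argument conventions: \<open>u0\<close>, \<open>uN\<close> and \<open>pN\<close>, \<open>p0\<close> are the impulses, \<open>xs\<close>, \<open>qs\<close> the slacks
  written with a bullet superscript, \<open>xN\<close>, \<open>q0\<close> the terminal slacks, and \<open>Ut\<close>, \<open>xt\<close>, \<open>Pt\<close>, \<open>qt\<close>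
  the parameters written with a tilde.
\<close>

definition boundary_feasible ::
  "real ^ 'j ^ 'k \<Rightarrow> real ^ 'k \<Rightarrow> real ^ 'k \<Rightarrow> real ^ 'k \<Rightarrow> real \<Rightarrow> real ^ 'j \<Rightarrow> real ^ 'k \<Rightarrow>
   real ^ 'j \<Rightarrow> real ^ 'j \<Rightarrow> real ^ 'k \<Rightarrow> real ^ 'k \<Rightarrow> bool" where
  "boundary_feasible A b \<beta> lam T Ut xt u0 uN xs xN \<longleftrightarrow>
     A *v u0 + xs = \<beta> - xt \<and>
     A *v u0 + A *v uN + xN = \<beta> + T *\<^sub>R b - A *v Ut + lam \<and>
     0 \<le> u0 \<and> 0 \<le> uN \<and> 0 \<le> xs \<and> 0 \<le> xN"

definition boundary_objective ::
  "real ^ 'j \<Rightarrow> real ^ 'j \<Rightarrow> real ^ 'j \<Rightarrow> real \<Rightarrow> real ^ 'j \<Rightarrow> real ^ 'j \<Rightarrow> real" where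
  "boundary_objective c \<gamma> \<mu> T u0 uN = (\<gamma> + T *\<^sub>R c + \<mu>) \<bullet> u0 + \<gamma> \<bullet> uN"

definition boundary_optimal ::
  "real ^ 'j ^ 'k \<Rightarrow> real ^ 'k \<Rightarrow> real ^ 'j \<Rightarrow> real ^ 'k \<Rightarrow> real ^ 'j \<Rightarrow> real ^ 'k \<Rightarrow> real ^ 'j \<Rightarrow>
   real \<Rightarrow> real ^ 'j \<Rightarrow> real ^ 'k \<Rightarrow>
   real ^ 'j \<Rightarrow> real ^ 'j \<Rightarrow> real ^ 'k \<Rightarrow> real ^ 'k \<Rightarrow> bool" where
  "boundary_optimal A b c \<beta> \<gamma> lam \<mu> T Ut xt u0 uN xs xN \<longleftrightarrow>
     boundary_feasible A b \<beta> lam T Ut xt u0 uN xs xN \<and>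
     (\<forall>v0 vN ys yN. boundary_feasible A b \<beta> lam T Ut xt v0 vN ys yN \<longrightarrow>
        boundary_objective c \<gamma> \<mu> T v0 vN \<le> boundary_objective c \<gamma> \<mu> T u0 uN)"

definition boundary_dual_feasible ::
  "real ^ 'j ^ 'k \<Rightarrow> real ^ 'j \<Rightarrow> real ^ 'j \<Rightarrow> real ^ 'j \<Rightarrow> real \<Rightarrow> real ^ 'k \<Rightarrow> real ^ 'j \<Rightarrow>
   real ^ 'k \<Rightarrow> real ^ 'k \<Rightarrow> real ^ 'j \<Rightarrow> real ^ 'j \<Rightarrow> bool" where
  "boundary_dual_feasible A c \<gamma> \<mu> T Pt qt pN p0 qs q0 \<longleftrightarrow>
     transpose A *v pN - qs = \<gamma> + qt \<and>
     transpose A *v pN + transpose A *v p0 - q0 = \<gamma> + T *\<^sub>R c - transpose A *v Pt + \<mu> \<and>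
     0 \<le> pN \<and> 0 \<le> p0 \<and> 0 \<le> qs \<and> 0 \<le> q0"

definition boundary_dual_objective ::
  "real ^ 'k \<Rightarrow> real ^ 'k \<Rightarrow> real ^ 'k \<Rightarrow> real \<Rightarrow> real ^ 'k \<Rightarrow> real ^ 'k \<Rightarrow> real" where
  "boundary_dual_objective b \<beta> lam T pN p0 = (\<beta> + T *\<^sub>R b + lam) \<bullet> pN + \<beta> \<bullet> p0"

definition boundary_dual_optimal ::
  "real ^ 'j ^ 'k \<Rightarrow> real ^ 'k \<Rightarrow> real ^ 'j \<Rightarrow> real ^ 'k \<Rightarrow> real ^ 'j \<Rightarrow> real ^ 'k \<Rightarrow> real ^ 'j \<Rightarrow>
   real \<Rightarrow> real ^ 'k \<Rightarrow> real ^ 'j \<Rightarrow>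
   real ^ 'k \<Rightarrow> real ^ 'k \<Rightarrow> real ^ 'j \<Rightarrow> real ^ 'j \<Rightarrow> bool" where
  "boundary_dual_optimal A b c \<beta> \<gamma> lam \<mu> T Pt qt pN p0 qs q0 \<longleftrightarrow>
     boundary_dual_feasible A c \<gamma> \<mu> T Pt qt pN p0 qs q0 \<and>
     (\<forall>rN r0 ys y0. boundary_dual_feasible A c \<gamma> \<mu> T Pt qt rN r0 ys y0 \<longrightarrow>
        boundary_dual_objective b \<beta> lam T pN p0 \<le> boundary_dual_objective b \<beta> lam T rN r0)"

section \<open>Coupling and composition\<close>

text \<open>The system linking the internal and the boundary solutions.\<close>

definition coupling ::
  "real \<Rightarrow> nat \<Rightarrow> (nat \<Rightarrow> real) \<Rightarrow> real ^ 'k \<Rightarrow> real ^ 'j \<Rightarrow>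
   (real \<Rightarrow> real ^ 'j) \<Rightarrow> (real \<Rightarrow> real ^ 'k) \<Rightarrow> (nat \<Rightarrow> real ^ 'k) \<Rightarrow> (nat \<Rightarrow> real ^ 'j) \<Rightarrow>
   real ^ 'j \<Rightarrow> real ^ 'k \<Rightarrow> real ^ 'j \<Rightarrow> real ^ 'j \<Rightarrow> real ^ 'k \<Rightarrow> real ^ 'k \<Rightarrow>
   real ^ 'k \<Rightarrow> real ^ 'j \<Rightarrow> real ^ 'k \<Rightarrow> real ^ 'k \<Rightarrow> real ^ 'j \<Rightarrow> real ^ 'j \<Rightarrow> bool" where
  "coupling T N t x0 qN u p xd qd Ut xt u0 uN xs xN Pt qt pN p0 qs q0 \<longleftrightarrow>
     x0 = xs + xt \<and> qN = qs + qt \<and>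
     Ut = integral {0..T} u \<and> Pt = integral {0..T} p \<and>
     (\<forall>k. xt $ k = - Min (insert 0
        ((\<lambda>n. \<Sum>m = 1..n. (xd m $ k) * (t m - t (m - 1))) ` {1..N}))) \<and>
     (\<forall>j. qt $ j = - Min (insert 0
        ((\<lambda>n. \<Sum>m = n..N. (qd m $ j) * (t m - t (m - 1))) ` {1..N}))) \<and>
     x0 \<bullet> p0 = 0 \<and> xN \<bullet> pN = 0 \<and> qN \<bullet> uN = 0 \<and> q0 \<bullet> u0 = 0"

text \<open>
  The data of internal solutions and boundary solutions, on a common partition, that the
  decomposition produces and the composition consumes.
\<close>

definition coupled_solutions ::
  "real ^ 'j ^ 'k \<Rightarrow> real ^ 'k \<Rightarrow> real ^ 'j \<Rightarrow> real ^ 'k \<Rightarrow> real ^ 'j \<Rightarrow> real ^ 'k \<Rightarrow> real ^ 'j \<Rightarrow>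
   real \<Rightarrow> nat \<Rightarrow> (nat \<Rightarrow> real) \<Rightarrow> real ^ 'k \<Rightarrow> real ^ 'j \<Rightarrow>
   (real \<Rightarrow> real ^ 'j) \<Rightarrow> (real \<Rightarrow> real ^ 'k) \<Rightarrow>
   (nat \<Rightarrow> real ^ 'j) \<Rightarrow> (nat \<Rightarrow> real ^ 'k) \<Rightarrow> (nat \<Rightarrow> real ^ 'k) \<Rightarrow> (nat \<Rightarrow> real ^ 'j) \<Rightarrow>
   real ^ 'j \<Rightarrow> real ^ 'k \<Rightarrow> real ^ 'j \<Rightarrow> real ^ 'j \<Rightarrow> real ^ 'k \<Rightarrow> real ^ 'k \<Rightarrow>
   real ^ 'k \<Rightarrow> real ^ 'j \<Rightarrow> real ^ 'k \<Rightarrow> real ^ 'k \<Rightarrow> real ^ 'j \<Rightarrow> real ^ 'j \<Rightarrow> bool" where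
  "coupled_solutions A b c \<beta> \<gamma> lam \<mu> T N t x0 qN u p un xd pn qd
       Ut xt u0 uN xs xN Pt qt pN p0 qs q0 \<longleftrightarrow>
     0 \<le> x0 \<and> 0 \<le> qN \<and>
     sclp_optimal A b c x0 qN T u \<and>
     sclp_dual_optimal A b c x0 qN T p \<and>
     sclp_form A b c x0 qN T N t u p un xd pn qd \<and>
     boundary_feasible A b \<beta> lam T Ut xt u0 uN xs xN \<and>
     boundary_dual_feasible A c \<gamma> \<mu> T Pt qt pN p0 qs q0 \<and>
     coupling T N t x0 qN u p xd qd Ut xt u0 uN xs xN Pt qt pN p0 qs q0"

text \<open>
  Identification of the quantities with the same names.  The two limits express
  \<open>uN = U(T) - U(T-)\<close> and \<open>p0 = P(T) - P(T-)\<close>.  The internal controls are the derivatives of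
  \<open>U\<close> and \<open>P\<close> except possibly at the breakpoints.
\<close>

definition composed_of ::
  "real ^ 'j ^ 'k \<Rightarrow> real ^ 'k \<Rightarrow> real ^ 'j \<Rightarrow> real \<Rightarrow> nat \<Rightarrow> (nat \<Rightarrow> real) \<Rightarrow>
   (real \<Rightarrow> real ^ 'j) \<Rightarrow> (real \<Rightarrow> real ^ 'k) \<Rightarrow> (real \<Rightarrow> real ^ 'k) \<Rightarrow> (real \<Rightarrow> real ^ 'j) \<Rightarrow>
   real ^ 'k \<Rightarrow> real ^ 'j \<Rightarrow> (real \<Rightarrow> real ^ 'j) \<Rightarrow> (real \<Rightarrow> real ^ 'k) \<Rightarrow>
   real ^ 'j \<Rightarrow> real ^ 'j \<Rightarrow> real ^ 'k \<Rightarrow> real ^ 'k \<Rightarrow> real ^ 'k \<Rightarrow> real ^ 'j \<Rightarrow> bool" where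
  "composed_of A b c T N t U x P q x0 qN u p u0 uN xN pN p0 q0 \<longleftrightarrow>
     x 0 = x0 \<and> q 0 = qN \<and>
     U 0 = u0 \<and> (U \<longlongrightarrow> U T - uN) (at_left T) \<and> x T = xN \<and>
     P 0 = pN \<and> (P \<longlongrightarrow> P T - p0) (at_left T) \<and> q T = q0 \<and>
     (\<forall>n\<in>{1..N}. \<forall>s\<in>{t (n - 1)<..<t n}. (U has_vector_derivative u s) (at s)) \<and>
     (\<forall>n\<in>{1..N}. \<forall>s\<in>{T - t n<..<T - t (n - 1)}. (P has_vector_derivative p s) (at s)) \<and>
     (\<forall>s\<in>{0<..<T}. x s = sclp_state A b x0 u s \<and> q s = sclp_dual_state A c qN p s)"

end

theory Submission
  imports Defs
begin

text \<open>
  The states of M-CLP and of the internal problem coincide on \<open>[0,T)\<close>; the two descriptions differ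
  only in how they treat the impulses at the ends.  So feasibility transfers by bookkeeping, and what
  has to be shown is that optimality transfers.  M-CLP optimality is complementary slackness of
  Stieltjes integrals.  Such an integral of a nonnegative function that is continuous on the open
  cells vanishes iff the function vanishes at the atoms 0 and \<open>T\<close> of the integrator and on the
  cells where the integrator has positive slope (\<open>stieltjes_inner_eq_0\<close>, \<open>stieltjes_inner_eq_0D\<close>).  The atoms give the four products of boundary
  quantities, the cells give \<open>\<integral> q(T - t) \<bullet> u(t) dt = \<integral> x(T - s) \<bullet> p(s) ds = 0\<close>, the complementary
  slackness of the internal problems.

  By \<open>sclp_duality_gap\<close> the sum of these two integrals is the difference of the internal objectives.
  Hence weak duality holds, and complementary slackness implies optimality; this settles the
  decomposition.  The composition needs the converse, that optimal internal controls \<open>u\<close> and \<open>p\<close> have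
  equal objective values (\<open>sclp_strong_duality\<close>).

  Strong duality is proved by discretization.  On a uniform
  partition with step \<open>\<delta>\<close>, take step controls together with an impulse at time 0.  The value of this
  finite linear program does not exceed the value of \<open>u\<close>, so it has multipliers of no larger value
  (\<open>sclp_discrete_multipliers\<close>).  Their cumulative sums satisfy the dual constraint at the midpoints
  of the cells, and the piecewise linear path through these points is dual feasible between them.
  A mass spread around a node has the same cost as a mass at the node because the cost is affine.
  Only the two end pieces, of length \<open>\<delta>/2\<close>, are spread around the wrong point.  Hoffman's error bound
  (\<open>hoffman\<close>) allows them to carry a mass of order \<open>\<delta>\<close>, whatever the size of the multipliers.  So the
  dual value exceeds the primal value by at most a constant times \<open>\<delta>\<close> (\<open>sclp_duality_gap_le\<close>).

  The boundary problems are not linear programming duals of each other, but \<open>pN\<close> and \<open>p0 + Pt\<close> are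
  multipliers for Boundary-LP, and \<open>u0\<close> and \<open>uN + Ut\<close> are multipliers for Boundary-LP*
  (\<open>boundary_optimal_of_complementary\<close>).  The additional product \<open>xs \<bullet> Pt\<close> vanishes since the choice
  of \<open>xt\<close> makes \<open>xs\<close> a lower bound of the internal state, which is orthogonal to \<open>p\<close>.

  The dual problems are the primal problems for \<open>- transpose A\<close> and negated, exchanged data, in
  reversed time, so one-sided facts are proved for the primal only.
\<close>

section \<open>Farkas duality and error bounds for linear inequalities\<close>

text \<open>
  Bartl's induction on the number of functionals.  If the new functional is needed, there is a point
  \<open>w\<close> at which the other functionals are nonpositive and \<open>g\<close> is positive; projecting along \<open>w\<close> onto
  the kernel of the new functional reduces to the smaller family.  The operation \<open>comb x s y\<close> stands
  for \<open>x - s y\<close>, so that sequences of vectors can serve as points.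
\<close>

lemma farkas:
  fixes f :: "'i \<Rightarrow> 'v \<Rightarrow> real" and g :: "'v \<Rightarrow> real" and comb :: "'v \<Rightarrow> real \<Rightarrow> 'v \<Rightarrow> 'v"
  assumes "finite I"
    and f: "\<And>i x s y. i \<in> I \<Longrightarrow> f i (comb x s y) = f i x - s * f i y"
    and g: "\<And>x s y. g (comb x s y) = g x - s * g y"
    and imp: "\<And>x. (\<And>i. i \<in> I \<Longrightarrow> f i x \<le> 0) \<Longrightarrow> g x \<le> 0"
  shows "\<exists>l. (\<forall>i\<in>I. 0 \<le> l i) \<and> (\<forall>x. g x = (\<Sum>i\<in>I. l i * f i x))"
  using assms
proof (induction I arbitrary: f g rule: finite_induct)
  case empty
  have "g x = 0" for x
  proof -
    have "g x \<le> 0" "g (comb x 2 x) \<le> 0"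
      by (rule empty.prems(3); simp)+
    then show ?thesis
      using empty.prems(2)[of x 2 x] by simp
  qed
  then show ?case by simp
next
  case (insert a I)
  show ?case
  proof (cases "\<forall>x. (\<forall>i\<in>I. f i x \<le> 0) \<longrightarrow> g x \<le> 0")
    case True
    have "\<exists>l. (\<forall>i\<in>I. 0 \<le> l i) \<and> (\<forall>x. g x = (\<Sum>i\<in>I. l i * f i x))"
      by (rule insert.IH) (use True insert.prems in auto)
    then obtain l where l: "\<forall>i\<in>I. 0 \<le> l i" "\<And>x. g x = (\<Sum>i\<in>I. l i * f i x)" by blast
    have "(\<Sum>i\<in>insert a I. (l(a := 0)) i * f i x) = g x" for x
      using insert.hyps unfolding l(2) by (auto intro!: sum.cong)
    with l(1) show ?thesis
      by (intro exI[of _ "l(a := 0)"]) auto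
  next
    case False
    then obtain w where w: "\<And>i. i \<in> I \<Longrightarrow> f i w \<le> 0" "g w > 0" by force
    have aw: "f a w > 0"
      using insert.prems(3)[of w] w by force
    define r where "r x = f a x / f a w" for x
    have r: "r (comb x s y) = r x - s * r y" for x s y
      using insert.prems(1)[of a x s y] by (simp add: r_def diff_divide_distrib)
    \<comment> \<open>The point \<open>x\<close> moved to \<open>comb x (r x) w\<close> lies in the kernel of \<open>f a\<close>.\<close>
    define f' where "f' i x = f i x - r x * f i w" for i x
    define g' where "g' x = g x - r x * g w" for x
    have "\<exists>l. (\<forall>i\<in>I. 0 \<le> l i) \<and> (\<forall>x. g' x = (\<Sum>i\<in>I. l i * f' i x))"
    proof (rule insert.IH)
      show "f' i (comb x s y) = f' i x - s * f' i y" if "i \<in> I" for i x s y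
        using insert.prems(1)[of i x s y] that by (simp add: f'_def r algebra_simps)
      show "g' (comb x s y) = g' x - s * g' y" for x s y
        using insert.prems(2)[of x s y] by (simp add: g'_def r algebra_simps)
      show "g' x \<le> 0" if "\<And>i. i \<in> I \<Longrightarrow> f' i x \<le> 0" for x
      proof -
        have "f i (comb x (r x) w) \<le> 0" if "i \<in> insert a I" for i
          using that \<open>\<And>i. i \<in> I \<Longrightarrow> f' i x \<le> 0\<close>[of i] insert.prems(1)[of i x "r x" w] aw
          by (auto simp: f'_def r_def)
        then have "g (comb x (r x) w) \<le> 0"
          by (rule insert.prems(3))
        then show ?thesis
          using insert.prems(2)[of x "r x" w] by (simp add: g'_def)
      qed
    qed
    then obtain l where l: "\<forall>i\<in>I. 0 \<le> l i" "\<And>x. g' x = (\<Sum>i\<in>I. l i * f' i x)" by blast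
    \<comment> \<open>The multiplier of the new functional is fixed by evaluating at \<open>w\<close>.\<close>
    define la where "la = (g w - (\<Sum>i\<in>I. l i * f i w)) / f a w"
    have "(\<Sum>i\<in>I. l i * f i w) \<le> 0"
      using l(1) w(1) by (intro sum_nonpos mult_nonneg_nonpos) auto
    then have la: "0 \<le> la"
      using w(2) aw by (simp add: la_def)
    have "(\<Sum>i\<in>insert a I. (l(a := la)) i * f i x) = g x" for x
    proof -
      have "(\<Sum>i\<in>insert a I. (l(a := la)) i * f i x) = la * f a x + (\<Sum>i\<in>I. (l(a := la)) i * f i x)"
        using insert.hyps by simp
      also have "(\<Sum>i\<in>I. (l(a := la)) i * f i x) = (\<Sum>i\<in>I. l i * f i x)"
        using insert.hyps by (intro sum.cong) auto
      also have "\<dots> = g' x + r x * (\<Sum>i\<in>I. l i * f i w)"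
        by (simp add: l(2) f'_def algebra_simps sum.distrib sum_subtractf sum_distrib_left)
      finally show ?thesis
        using aw by (simp add: g'_def la_def r_def field_simps)
    qed
    with l(1) la show ?thesis
      by (intro exI[of _ "l(a := la)"]) auto
  qed
qed

text \<open>
  Farkas' lemma for the homogenized problem.  In a pair \<open>(x, r)\<close> with \<open>r > 0\<close> the point \<open>x / r\<close> is
  feasible; for \<open>r = 0\<close> the point \<open>x\<close> is a recession direction, along which \<open>g\<close> cannot increase since
  it is bounded on the nonempty feasible set.
\<close>

lemma lp_duality:
  fixes f :: "'i \<Rightarrow> 'v \<Rightarrow> real" and g :: "'v \<Rightarrow> real" and comb :: "'v \<Rightarrow> real \<Rightarrow> 'v \<Rightarrow> 'v"
  assumes "finite I"
    and f: "\<And>i x s y. i \<in> I \<Longrightarrow> f i (comb x s y) = f i x - s * f i y"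
    and g: "\<And>x s y. g (comb x s y) = g x - s * g y"
    and feas: "\<And>i. i \<in> I \<Longrightarrow> f i z \<le> h i"
    and bound: "\<And>x. (\<And>i. i \<in> I \<Longrightarrow> f i x \<le> h i) \<Longrightarrow> g x \<le> V"
  shows "\<exists>l. (\<forall>i\<in>I. 0 \<le> l i) \<and> (\<forall>x. g x = (\<Sum>i\<in>I. l i * f i x)) \<and> (\<Sum>i\<in>I. l i * h i) \<le> V"
proof -
  \<comment> \<open>The index \<open>None\<close> carries the constraint \<open>r \<ge> 0\<close>.\<close>
  define F :: "'i option \<Rightarrow> 'v \<times> real \<Rightarrow> real"
    where "F = (\<lambda>i (x, r). case i of None \<Rightarrow> - r | Some i \<Rightarrow> f i x - r * h i)"
  define G where "G = (\<lambda>(x, r). g x - r * V)"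
  define C where "C = (\<lambda>(x, r) s (y, r'). (comb x s y, r - s * r'))"
  define J where "J = insert None (Some ` I)"
  have "\<exists>l. (\<forall>i\<in>J. 0 \<le> l i) \<and> (\<forall>x. G x = (\<Sum>i\<in>J. l i * F i x))"
  proof (rule farkas[where comb = C])
    show "finite J" using assms(1) by (simp add: J_def)
    show "F i (C x s y) = F i x - s * F i y" if "i \<in> J" for i x s y
      using that f by (cases x; cases y) (auto simp: F_def C_def J_def algebra_simps)
    show "G (C x s y) = G x - s * G y" for x s y
      using g by (cases x; cases y) (auto simp: G_def C_def algebra_simps)
    show "G xr \<le> 0" if *: "\<And>i. i \<in> J \<Longrightarrow> F i xr \<le> 0" for xr
    proof (cases xr)
      case (Pair x r)
      have r: "r \<ge> 0" and fx: "\<And>i. i \<in> I \<Longrightarrow> f i x \<le> r * h i"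
        using *[of None] *[of "Some _"] by (auto simp: Pair F_def J_def)
      show ?thesis
      proof (cases "r = 0")
        case False
        let ?x = "comb x (1 - 1 / r) x"
        have "f i ?x \<le> h i" if "i \<in> I" for i
        proof -
          have "f i ?x = f i x / r"
            unfolding f[OF that] using False by (simp add: field_simps)
          also have "\<dots> \<le> r * h i / r"
            using fx[OF that] r by (intro divide_right_mono) auto
          finally show ?thesis using False by simp
        qed
        then have "g ?x \<le> V" by (rule bound)
        then show ?thesis
          using g[of x "1 - 1/r" x] r False mult_left_mono[of "g ?x" V r]
          by (simp add: Pair G_def field_simps)
      next
        case True
        have "g z + s * g x \<le> V" if "s \<ge> 0" for s
        proof -
          have "f i (comb z (- s) x) \<le> h i" if "i \<in> I" for i
            using fx[OF that] f[OF that, of z "-s" x] feas[OF that] True \<open>s \<ge> 0\<close>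
              mult_nonneg_nonpos[of s "f i x"] by simp
          then have "g (comb z (- s) x) \<le> V" by (rule bound)
          then show ?thesis using g[of z "-s" x] by simp
        qed
        \<comment> \<open>If \<open>g x\<close> were positive, this step length would push \<open>g\<close> above \<open>V\<close>.\<close>
        from this[of "(\<bar>V - g z\<bar> + 1) / g x"] have "g x \<le> 0"
          by (cases "g x \<le> 0") simp_all
        then show ?thesis by (simp add: Pair True G_def)
      qed
    qed
  qed
  then obtain l where l: "\<forall>i\<in>J. 0 \<le> l i" "\<And>x. G x = (\<Sum>i\<in>J. l i * F i x)" by blast
  have *: "g x - r * V = (\<Sum>i\<in>I. l (Some i) * (f i x - r * h i)) - l None * r" for x r
    using l(2)[of "(x, r)"] assms(1)
    by (simp add: G_def J_def F_def sum.reindex image_iff)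
  have gx: "g x = (\<Sum>i\<in>I. l (Some i) * f i x)" for x
    using *[of x 0] by simp
  have "V = (\<Sum>i\<in>I. l (Some i) * h i) + l None"
    using *[of z 1] gx[of z] by (simp add: algebra_simps sum_subtractf)
  with gx l(1) show ?thesis
    by (intro exI[of _ "\<lambda>i. l (Some i)"]) (auto simp: J_def)
qed

definition conic_coefficient_bound :: "('i \<Rightarrow> 'a::real_normed_vector) \<Rightarrow> 'i set \<Rightarrow> real \<Rightarrow> bool" where
  "conic_coefficient_bound a I C \<longleftrightarrow> (\<forall>l. (\<forall>i\<in>I. 0 \<le> l i) \<longrightarrow>
    (\<exists>l'. (\<forall>i\<in>I. 0 \<le> l' i \<and> l' i \<le> C * norm (\<Sum>i\<in>I. l i *\<^sub>R a i)) \<and>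
      (\<Sum>i\<in>I. l' i *\<^sub>R a i) = (\<Sum>i\<in>I. l i *\<^sub>R a i)))"

text \<open>
  The reduction step of Caratheodory's theorem: a linear dependency allows one generator to be
  dropped, and for independent generators the coefficients are bounded because an injective linear map
  is bounded below.
\<close>

lemma conic_combination_bounded:
  fixes a :: "'i::finite \<Rightarrow> 'a::euclidean_space"
  shows "\<exists>C\<ge>0. conic_coefficient_bound a I C"
proof (induction I rule: finite_psubset_induct[OF finite])
  case (1 I)
  show ?case
  proof (cases "\<forall>e. (\<Sum>i\<in>I. e i *\<^sub>R a i) = 0 \<longrightarrow> (\<forall>i\<in>I. e i = 0)")
    case True
    define S :: "(real ^ 'i) set" where "S = {e. \<forall>i. i \<notin> I \<longrightarrow> e $ i = 0}"
    define L where "L = (\<lambda>e :: real ^ 'i. \<Sum>i\<in>I. (e $ i) *\<^sub>R a i)"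
    have S: "subspace S" by (auto simp: S_def subspace_def)
    have "linear L"
      by (rule linearI) (auto simp: L_def algebra_simps sum.distrib scaleR_sum_right)
    then have "bounded_linear L" by (simp add: linear_conv_bounded_linear)
    moreover have "\<forall>e\<in>S. L e = 0 \<longrightarrow> e = 0"
      using True by (fastforce simp: S_def L_def vec_eq_iff)
    ultimately obtain e where e: "e > 0" "\<And>x. x \<in> S \<Longrightarrow> e * norm x \<le> norm (L x)"
      using injective_imp_isometric[of S L] S closed_subspace[OF S] by (auto simp: mult.commute)
    show ?thesis
      unfolding conic_coefficient_bound_def
    proof (intro exI[of _ "1 / e"] conjI allI impI)
      fix l :: "'i \<Rightarrow> real" assume l: "\<forall>i\<in>I. 0 \<le> l i"
      define x :: "real ^ 'i" where "x = (\<chi> i. if i \<in> I then l i else 0)"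
      have Lx: "L x = (\<Sum>i\<in>I. l i *\<^sub>R a i)" by (auto simp: L_def x_def intro!: sum.cong)
      have "x \<in> S" by (simp add: S_def x_def)
      have "l i \<le> 1 / e * norm (\<Sum>i\<in>I. l i *\<^sub>R a i)" if "i \<in> I" for i
      proof -
        have "l i \<le> norm x" using component_le_norm_cart[of x i] that by (simp add: x_def)
        then have "e * l i \<le> norm (L x)"
          using e(2)[OF \<open>x \<in> S\<close>] e(1) mult_left_mono[of "l i" "norm x" e] by linarith
        then show ?thesis using e(1) by (simp add: Lx field_simps)
      qed
      with l show "\<exists>l'. (\<forall>i\<in>I. 0 \<le> l' i \<and> l' i \<le> 1 / e * norm (\<Sum>i\<in>I. l i *\<^sub>R a i)) \<and>
          (\<Sum>i\<in>I. l' i *\<^sub>R a i) = (\<Sum>i\<in>I. l i *\<^sub>R a i)" by blast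
    qed (use e in simp)
  next
    case False
    then obtain e0 i0 where e0: "(\<Sum>i\<in>I. e0 i *\<^sub>R a i) = 0" "i0 \<in> I" "e0 i0 \<noteq> 0" by blast
    \<comment> \<open>Normalized so that some coefficient is positive.\<close>
    define e where "e i = e0 i / e0 i0" for i
    have e: "(\<Sum>i\<in>I. e i *\<^sub>R a i) = 0" "e i0 = 1"
    proof -
      have "(\<Sum>i\<in>I. e i *\<^sub>R a i) = (1 / e0 i0) *\<^sub>R (\<Sum>i\<in>I. e0 i *\<^sub>R a i)"
        by (simp add: e_def scaleR_sum_right)
      then show "(\<Sum>i\<in>I. e i *\<^sub>R a i) = 0" using e0 by simp
    qed (use e0 in \<open>simp add: e_def\<close>)
    have "\<forall>i\<in>I. \<exists>C. C \<ge> 0 \<and> conic_coefficient_bound a (I - {i}) C"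
      using 1 by blast
    then obtain C where C: "\<And>i. i \<in> I \<Longrightarrow> 0 \<le> C i" "\<And>i. i \<in> I \<Longrightarrow> conic_coefficient_bound a (I - {i}) (C i)"
      unfolding bchoice_iff by blast
    show ?thesis
      unfolding conic_coefficient_bound_def
    proof (intro exI[of _ "sum C I"] conjI allI impI)
      show "0 \<le> sum C I" by (simp add: C(1) sum_nonneg)
      fix l :: "'i \<Rightarrow> real" assume l: "\<forall>i\<in>I. 0 \<le> l i"
      define v where "v = (\<Sum>i\<in>I. l i *\<^sub>R a i)"
      \<comment> \<open>Move along the dependency until the first coefficient vanishes.\<close>
      define R where "R = (\<lambda>i. l i / e i) ` {i\<in>I. e i > 0}"
      have "finite R" "R \<noteq> {}" using e(2) e0(2) by (auto simp: R_def)
      then have "Min R \<in> R" and Rmin: "\<And>r. r \<in> R \<Longrightarrow> Min R \<le> r" by auto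
      then obtain i1 where i1: "i1 \<in> I" "e i1 > 0" "Min R = l i1 / e i1" by (auto simp: R_def)
      define m where "m k = l k - Min R * e k" for k
      have "Min R \<ge> 0" using i1 l by simp
      have m0: "0 \<le> m k" if "k \<in> I" for k
      proof (cases "e k > 0")
        case True
        then have "Min R \<le> l k / e k" using that by (intro Rmin) (auto simp: R_def)
        then show ?thesis using True by (simp add: m_def field_simps)
      next
        case False
        then have "Min R * e k \<le> 0" using \<open>Min R \<ge> 0\<close> by (simp add: mult_nonneg_nonpos)
        then show ?thesis using l that by (auto simp: m_def intro: order_trans)
      qed
      have mi1: "m i1 = 0" using i1 by (simp add: m_def)
      have msum: "(\<Sum>k\<in>I. m k *\<^sub>R a k) = v"
      proof -
        have "(\<Sum>k\<in>I. m k *\<^sub>R a k) = v - Min R *\<^sub>R (\<Sum>k\<in>I. e k *\<^sub>R a k)"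
          unfolding m_def v_def scaleR_sum_right sum_subtractf[symmetric]
          by (intro sum.cong) (simp_all add: scaleR_diff_left)
        then show ?thesis by (simp add: e)
      qed
      then have msum': "(\<Sum>k\<in>I - {i1}. m k *\<^sub>R a k) = v"
        using i1(1) mi1 by (simp add: sum_diff1)
      obtain l' where l': "\<forall>k\<in>I - {i1}. 0 \<le> l' k \<and> l' k \<le> C i1 * norm v"
        "(\<Sum>k\<in>I - {i1}. l' k *\<^sub>R a k) = v"
        using C(2)[OF i1(1), unfolded conic_coefficient_bound_def, rule_format, of m] m0 by (auto simp: msum')
      have CC: "C i1 \<le> sum C I" using i1 C(1) by (intro member_le_sum) auto
      show "\<exists>l'. (\<forall>i\<in>I. 0 \<le> l' i \<and> l' i \<le> sum C I * norm (\<Sum>i\<in>I. l i *\<^sub>R a i)) \<and>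
          (\<Sum>i\<in>I. l' i *\<^sub>R a i) = (\<Sum>i\<in>I. l i *\<^sub>R a i)"
        unfolding v_def[symmetric]
      proof (intro exI[of _ "l'(i1 := 0)"] conjI ballI)
        fix i assume "i \<in> I"
        show "0 \<le> (l'(i1 := 0)) i" using l'(1) \<open>i \<in> I\<close> by simp
        have "C i1 * norm v \<le> sum C I * norm v" using CC by (intro mult_right_mono) auto
        moreover have "0 \<le> sum C I * norm v" using C(1) by (simp add: sum_nonneg)
        ultimately show "(l'(i1 := 0)) i \<le> sum C I * norm v"
          using l'(1) \<open>i \<in> I\<close> by (cases "i = i1") (force)+
      next
        have "(\<Sum>k\<in>I. (l'(i1 := 0)) k *\<^sub>R a k) = (\<Sum>k\<in>I - {i1}. (l'(i1 := 0)) k *\<^sub>R a k)"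
          by (intro sum.mono_neutral_right) auto
        also have "\<dots> = (\<Sum>k\<in>I - {i1}. l' k *\<^sub>R a k)" by (intro sum.cong) auto
        finally show "(\<Sum>k\<in>I. (l'(i1 := 0)) k *\<^sub>R a k) = v" using l'(2) by simp
      qed
    qed
  qed
qed

text \<open>
  Hoffman's error bound; its point is that \<open>C\<close> does not depend on the right-hand side \<open>h\<close>.  Let \<open>y\<close>
  be the point of the polyhedron closest to \<open>x\<close>.  By Farkas' lemma \<open>x - y\<close> is a conic combination of
  the normals of the active constraints, with coefficients bounded by a multiple of \<open>norm (x - y)\<close>.
  The inner product of this combination with \<open>x - y\<close> is the square of the norm on one side, and on the
  other side at most this multiple times the violation.
\<close>

lemma hoffman:
  fixes a :: "'i::finite \<Rightarrow> 'a::euclidean_space"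
  shows "\<exists>C\<ge>0. \<forall>h x. (\<exists>y. \<forall>i. a i \<bullet> y \<le> h i) \<longrightarrow>
    (\<exists>y. (\<forall>i. a i \<bullet> y \<le> h i) \<and> norm (x - y) \<le> C * (\<Sum>i\<in>UNIV. max 0 (a i \<bullet> x - h i)))"
proof -
  have "\<forall>J. \<exists>C. C \<ge> 0 \<and> conic_coefficient_bound a J C"
    using conic_combination_bounded[of a] by blast
  then obtain C where C: "\<And>J. 0 \<le> C J" "\<And>J. conic_coefficient_bound a J (C J)"
    unfolding choice_iff by blast
  define D where "D = sum C UNIV"
  have D: "C I \<le> D" "0 \<le> D" for I
    using C(1) by (auto simp: D_def intro!: member_le_sum sum_nonneg)
  show ?thesis
  proof (intro exI[of _ D] conjI allI impI)
    fix h :: "'i \<Rightarrow> real" and x :: "'a" assume ex: "\<exists>y. \<forall>i. a i \<bullet> y \<le> h i"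
    define S where "S = {y. \<forall>i. a i \<bullet> y \<le> h i}"
    have S: "S = (\<Inter>i. {y. a i \<bullet> y \<le> h i})" by (auto simp: S_def)
    have "closed S" "convex S" "S \<noteq> {}"
      using ex by (auto simp: S closed_halfspace_le convex_halfspace_le intro!: convex_INT)
    define y where "y = closest_point S x"
    have yS: "y \<in> S" unfolding y_def by (rule closest_point_in_set) fact+
    have dot: "(x - y) \<bullet> (w - y) \<le> 0" if "w \<in> S" for w
      unfolding y_def by (rule closest_point_dot) fact+
    define I where "I = {i. a i \<bullet> y = h i}"
    define v where "v = (\<Sum>i\<in>UNIV. max 0 (a i \<bullet> x - h i))"
    have "\<exists>l. (\<forall>i\<in>I. 0 \<le> l i) \<and> (\<forall>z. (x - y) \<bullet> z = (\<Sum>i\<in>I. l i * (a i \<bullet> z)))"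
    proof (rule farkas[where comb = "\<lambda>x s y. x - s *\<^sub>R y"])
      fix z assume z: "\<And>i. i \<in> I \<Longrightarrow> a i \<bullet> z \<le> 0"
      \<comment> \<open>A direction feasible for the active constraints can be followed a little.\<close>
      have "\<forall>i. \<exists>e>0. \<forall>s. 0 < s \<and> s < e \<longrightarrow> a i \<bullet> (y + s *\<^sub>R z) \<le> h i"
      proof
        fix i
        show "\<exists>e>0. \<forall>s. 0 < s \<and> s < e \<longrightarrow> a i \<bullet> (y + s *\<^sub>R z) \<le> h i"
        proof (cases "a i \<bullet> z \<le> 0")
          case True
          then have "a i \<bullet> (y + s *\<^sub>R z) \<le> h i" if "s > 0" for s
            using yS that mult_nonneg_nonpos[of s "a i \<bullet> z"] by (auto simp: S_def inner_add_right intro: order_trans[rotated])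
          then show ?thesis by (intro exI[of _ 1]) auto
        next
          case False
          then have "i \<notin> I" using z by blast
          moreover have "a i \<bullet> y \<le> h i" using yS by (simp add: S_def)
          ultimately have "a i \<bullet> y < h i" by (simp add: I_def)
          with False show ?thesis
            by (intro exI[of _ "(h i - a i \<bullet> y) / (a i \<bullet> z)"]) (auto simp: inner_add_right field_simps)
        qed
      qed
      then obtain e where e: "\<And>i. e i > 0" "\<And>i s. 0 < s \<Longrightarrow> s < e i \<Longrightarrow> a i \<bullet> (y + s *\<^sub>R z) \<le> h i"
        by metis
      define s where "s = Min (range e) / 2"
      have "Min (range e) > 0" using e(1) by simp
      then have s: "s > 0" "s < e i" for i
      proof -
        have "Min (range e) \<le> e i" by simp
        with \<open>Min (range e) > 0\<close> show "s < e i" unfolding s_def by linarith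
      qed (simp add: s_def)
      then have "y + s *\<^sub>R z \<in> S" using e(2) by (simp add: S_def)
      from dot[OF this] s show "(x - y) \<bullet> z \<le> 0"
        by (simp add: mult_le_0_iff)
    qed (auto simp: inner_diff_right)
    then obtain l where l: "\<forall>i\<in>I. 0 \<le> l i" "\<And>z. (x - y) \<bullet> z = (\<Sum>i\<in>I. l i * (a i \<bullet> z))" by blast
    have xy: "x - y = (\<Sum>i\<in>I. l i *\<^sub>R a i)"
      by (rule euclidean_eqI) (simp add: l(2) inner_sum_left)
    obtain l' where l': "\<forall>i\<in>I. 0 \<le> l' i \<and> l' i \<le> C I * norm (x - y)" "(\<Sum>i\<in>I. l' i *\<^sub>R a i) = x - y"
      using C(2)[of I, unfolded conic_coefficient_bound_def, rule_format, of l] l(1) by (auto simp: xy)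
    have "norm (x - y) * norm (x - y) = (\<Sum>i\<in>I. l' i *\<^sub>R a i) \<bullet> (x - y)"
      by (simp add: l'(2) power2_norm_eq_inner[symmetric] power2_eq_square)
    also have "\<dots> = (\<Sum>i\<in>I. l' i * (a i \<bullet> x - h i))"
      unfolding inner_sum_left by (intro sum.cong) (auto simp: inner_diff_right I_def right_diff_distrib)
    also have "\<dots> \<le> (\<Sum>i\<in>I. (D * norm (x - y)) * max 0 (a i \<bullet> x - h i))"
    proof (rule sum_mono)
      fix i assume i: "i \<in> I"
      have "l' i \<le> D * norm (x - y)"
        using l'(1) i mult_right_mono[OF D(1)[of I], of "norm (x - y)"] by force
      have "l' i * (a i \<bullet> x - h i) \<le> l' i * max 0 (a i \<bullet> x - h i)"
        using l'(1) i by (intro mult_left_mono) auto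
      also have "\<dots> \<le> (D * norm (x - y)) * max 0 (a i \<bullet> x - h i)"
        by (intro mult_right_mono) (fact, simp)
      finally show "l' i * (a i \<bullet> x - h i) \<le> (D * norm (x - y)) * max 0 (a i \<bullet> x - h i)" .
    qed
    also have "\<dots> \<le> (\<Sum>i\<in>UNIV. (D * norm (x - y)) * max 0 (a i \<bullet> x - h i))"
      using D(2) by (intro sum_mono2) auto
    also have "\<dots> = norm (x - y) * (D * v)"
      by (simp add: v_def sum_distrib_left[symmetric])
    finally have "norm (x - y) \<le> D * v"
    proof (cases "x = y")
      case True
      have "0 \<le> v" by (simp add: v_def sum_nonneg)
      with True D(2) show ?thesis by simp
    qed (simp add: mult_le_cancel_left)
    with yS show "\<exists>y. (\<forall>i. a i \<bullet> y \<le> h i) \<and>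
        norm (x - y) \<le> D * (\<Sum>i\<in>UNIV. max 0 (a i \<bullet> x - h i))"
      by (auto simp: S_def v_def)
  qed (fact D(2))
qed

section \<open>Time partitions and step functions\<close>

abbreviation steps :: "nat \<Rightarrow> (nat \<Rightarrow> real) \<Rightarrow> (real \<Rightarrow> 'a) \<Rightarrow> (nat \<Rightarrow> 'a) \<Rightarrow> bool" where
  "steps N t u un \<equiv> \<forall>n\<in>{1..N}. \<forall>s\<in>{t (n - 1)<..<t n}. u s = un n"

abbreviation slopes ::
  "nat \<Rightarrow> (nat \<Rightarrow> real) \<Rightarrow> (real \<Rightarrow> 'a::real_normed_vector) \<Rightarrow> (nat \<Rightarrow> 'a) \<Rightarrow> bool" where
  "slopes N t y yd \<equiv>
    \<forall>n\<in>{1..N}. \<forall>s\<in>{t (n - 1)<..<t n}. (y has_vector_derivative yd n) (at s)"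

lemma time_partition_less:
  assumes "time_partition T N t" "m < n" "n \<le> N"
  shows "t m < t n"
  using assms(2,3)
proof (induction n)
  case (Suc n)
  have "t n < t (Suc n)"
    using assms(1) Suc.prems unfolding time_partition_def by (metis Suc_diff_1 Suc_eq_plus1 atLeastAtMost_iff diff_Suc_1 le_add2 zero_less_Suc)
  with Suc show ?case by (cases "m = n") auto
qed simp

lemma time_partition_le:
  assumes "time_partition T N t" "m \<le> n" "n \<le> N"
  shows "t m \<le> t n"
  using time_partition_less[OF assms(1), of m n] assms(2,3) by (cases "m = n") simp_all

lemma time_partition_range:
  assumes "time_partition T N t" "n \<le> N"
  shows "0 \<le> t n" "t n \<le> T"
  using time_partition_le[OF assms(1), of 0 n] time_partition_le[OF assms(1), of n N] assms
  by (auto simp: time_partition_def)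

lemma time_partition_cell:
  assumes "time_partition T N t" "n \<in> {1..N}"
  shows "t (n - 1) < t n" "0 \<le> t (n - 1)" "t n \<le> T" "t (n - 1) \<le> T"
proof -
  show "t (n - 1) < t n" using assms by (auto simp: time_partition_def)
  show "0 \<le> t (n - 1)" "t n \<le> T" "t (n - 1) \<le> T"
    using assms(2) by (auto intro!: time_partition_range[OF assms(1)])
qed

lemma closed_cell_exists:
  assumes "time_partition T N t" "0 \<le> s" "s \<le> T"
  shows "\<exists>n\<in>{1..N}. t (n - 1) \<le> s \<and> s \<le> t n"
proof -
  have "\<exists>n\<le>N. s \<le> t n" using assms by (auto simp: time_partition_def)
  define n where "n = (LEAST n. s \<le> t n \<and> 1 \<le> n)"
  have N: "s \<le> t N \<and> 1 \<le> N" using assms by (auto simp: time_partition_def)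
  have n: "s \<le> t n" "1 \<le> n" using LeastI[of "\<lambda>n. s \<le> t n \<and> 1 \<le> n", OF N] by (auto simp: n_def)
  have "n \<le> N" unfolding n_def by (rule Least_le) (fact N)
  have "t (n - 1) \<le> s"
  proof (cases "n = 1")
    case True
    then show ?thesis using assms by (simp add: time_partition_def)
  next
    case False
    with n have "n - 1 < n" "1 \<le> n - 1" by auto
    then have "\<not> s \<le> t (n - 1)"
      using not_less_Least[of "n - 1" "\<lambda>n. s \<le> t n \<and> 1 \<le> n"] by (auto simp: n_def)
    then show ?thesis by simp
  qed
  with n \<open>n \<le> N\<close> show ?thesis by auto
qed

lemma open_cell_exists:
  assumes "time_partition T N t" "s \<in> {0..T} - t ` {0..N}"
  shows "\<exists>n\<in>{1..N}. s \<in> {t (n - 1)<..<t n}"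
proof -
  obtain n where n: "n \<in> {1..N}" "t (n - 1) \<le> s" "s \<le> t n"
    using closed_cell_exists[OF assms(1), of s] assms(2) by auto
  moreover have "n - 1 \<in> {0..N}" "n \<in> {0..N}" using n(1) by auto
  then have "s \<noteq> t (n - 1)" "s \<noteq> t n" using assms(2) by blast+
  ultimately show ?thesis by force
qed

lemma cell_unique:
  assumes "time_partition T N t" "n \<in> {1..N}" "m \<in> {1..N}"
    "s \<in> {t (n - 1)<..<t n}" "s \<in> {t (m - 1)<..<t m}"
  shows "n = m"
proof (rule ccontr)
  assume "n \<noteq> m"
  then consider "n \<le> m - 1" | "m \<le> n - 1" by linarith
  then show False
  proof cases
    case 1
    then have "t n \<le> t (m - 1)" using assms(3) by (intro time_partition_le[OF assms(1)]) auto
    then show False using assms(4,5) by auto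
  next
    case 2
    then have "t m \<le> t (n - 1)" using assms(2) by (intro time_partition_le[OF assms(1)]) auto
    then show False using assms(4,5) by auto
  qed
qed

lemma time_partition_reverse:
  assumes "time_partition T N t"
  shows "time_partition T N (\<lambda>n. T - t (N - n))"
proof -
  have "T - t (N - (n - 1)) < T - t (N - n)" if "n \<in> {1..N}" for n
    using time_partition_less[OF assms, of "N - n" "N - (n - 1)"] that by auto
  then show ?thesis using assms by (auto simp: time_partition_def)
qed

text \<open>
  The dual runs in reversed time: its cells are those of the reversed partition, numbered backwards.
\<close>

lemma reverse_cells:
  fixes t :: "nat \<Rightarrow> real"
  shows "(\<forall>n\<in>{1..N}. \<forall>s\<in>{T - t n<..<T - t (n - 1)}. Q n s) \<longleftrightarrow>
   (\<forall>n\<in>{1..N}. \<forall>s\<in>{T - t (N - (n - 1))<..<T - t (N - n)}. Q (N + 1 - n) s)"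
  (is "?L \<longleftrightarrow> ?R")
proof
  assume L: ?L
  show ?R
  proof
    fix n assume n: "n \<in> {1..N}"
    then have "1 \<le> n" "n \<le> N" by auto
    then have "N + 1 - n \<in> {1..N}" and "N - (n - 1) = N + 1 - n" and "N - n = N + 1 - n - 1"
      by auto
    with L show "\<forall>s\<in>{T - t (N - (n - 1))<..<T - t (N - n)}. Q (N + 1 - n) s" by metis
  qed
next
  assume R: ?R
  show ?L
  proof
    fix n assume n: "n \<in> {1..N}"
    then have "1 \<le> n" "n \<le> N" by auto
    then have "N + 1 - n \<in> {1..N}" and "n = N - (N + 1 - n - 1)" and "n - 1 = N - (N + 1 - n)"
       and "N + 1 - (N + 1 - n) = n" by auto
    with R show "\<forall>s\<in>{T - t n<..<T - t (n - 1)}. Q n s" by metis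
  qed
qed

text \<open>
  The value 0 outside the open cells keeps the function nonnegative everywhere if the rates are.
\<close>

lemma step_function_exists:
  assumes "time_partition T N t"
  shows "\<exists>u :: real \<Rightarrow> 'a::zero. (\<forall>n\<in>{1..N}. \<forall>s\<in>{t (n - 1)<..<t n}. u s = un n) \<and>
    (\<forall>s. u s = 0 \<or> (\<exists>n\<in>{1..N}. u s = un n))"
proof -
  define u where "u s = (if \<exists>n\<in>{1..N}. s \<in> {t (n - 1)<..<t n}
    then un (SOME n. n \<in> {1..N} \<and> s \<in> {t (n - 1)<..<t n}) else 0)" for s
  have sel: "(SOME m. m \<in> {1..N} \<and> s \<in> {t (m - 1)<..<t m}) = n"
    if "n \<in> {1..N}" "s \<in> {t (n - 1)<..<t n}" for n s
    using that cell_unique[OF assms] by (intro some_equality) blast+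
  have cell: "u s = un n" if "n \<in> {1..N}" "s \<in> {t (n - 1)<..<t n}" for n s
    using sel[OF that] that unfolding u_def by auto
  moreover have "u s = 0 \<or> (\<exists>n\<in>{1..N}. u s = un n)" for s
  proof (cases "\<exists>n\<in>{1..N}. s \<in> {t (n - 1)<..<t n}")
    case True
    then show ?thesis using cell by blast
  next
    case False
    then have "u s = 0" unfolding u_def by (rule if_not_P)
    then show ?thesis ..
  qed
  ultimately show ?thesis by (intro exI[of _ u] conjI ballI allI)
qed

lemma has_integral_over_cells:
  fixes g :: "real \<Rightarrow> 'a::banach"
  assumes t: "time_partition T N t"
    and I: "\<And>n. n \<in> {1..N} \<Longrightarrow> (g has_integral I n) {t (n - 1)..t n}"
    and "n \<le> N"
  shows "(g has_integral (\<Sum>m = 1..n. I m)) {0..t n}"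
  using \<open>n \<le> N\<close>
proof (induction n)
  case 0
  then show ?case using t by (simp add: time_partition_def has_integral_refl)
next
  case (Suc n)
  have "(g has_integral I (Suc n)) {t n..t (Suc n)}" using I[of "Suc n"] Suc.prems by simp
  moreover have "0 \<le> t n" "t n \<le> t (Suc n)"
    using time_partition_range[OF t, of n] time_partition_le[OF t, of n "Suc n"] Suc.prems by auto
  ultimately show ?case
    using has_integral_combine[of 0 "t n" "t (Suc n)" g] Suc by auto
qed

lemma constant_interior_has_integral:
  fixes u :: "real \<Rightarrow> 'a::banach"
  assumes "a \<le> b" "\<And>s. s \<in> {a<..<b} \<Longrightarrow> u s = w"
  shows "(u has_integral (b - a) *\<^sub>R w) {a..b}"
proof (rule has_integral_spike_finite[of "{a, b}"])
  show "((\<lambda>_. w) has_integral (b - a) *\<^sub>R w) {a..b}"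
    using has_integral_const_real[of w a b] assms(1) by simp
qed (use assms in auto)

lemma step_has_integral:
  fixes u :: "real \<Rightarrow> 'a::banach"
  assumes t: "time_partition T N t"
    and u: "steps N t u un"
    and n: "n \<in> {1..N}" and s: "t (n - 1) \<le> s" "s \<le> t n"
  shows "(u has_integral
    (\<Sum>m = 1..n - 1. (t m - t (m - 1)) *\<^sub>R un m) + (s - t (n - 1)) *\<^sub>R un n) {0..s}"
proof -
  have "(u has_integral (\<Sum>m = 1..n - 1. (t m - t (m - 1)) *\<^sub>R un m)) {0..t (n - 1)}"
  proof (rule has_integral_over_cells[OF t])
    fix m assume "m \<in> {1..N}"
    then show "(u has_integral (t m - t (m - 1)) *\<^sub>R un m) {t (m - 1)..t m}"
      using time_partition_cell[OF t, of m] u by (intro constant_interior_has_integral) auto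
  qed (use n in auto)
  moreover have "(u has_integral (s - t (n - 1)) *\<^sub>R un n) {t (n - 1)..s}"
    using u n s by (intro constant_interior_has_integral) auto
  ultimately show ?thesis
    using has_integral_combine[of 0 "t (n - 1)" s u] time_partition_cell[OF t n] s by simp
qed

lemma step_has_integral_node:
  fixes u :: "real \<Rightarrow> 'a::banach"
  assumes t: "time_partition T N t"
    and u: "steps N t u un"
    and n: "n \<le> N"
  shows "(u has_integral (\<Sum>m = 1..n. (t m - t (m - 1)) *\<^sub>R un m)) {0..t n}"
proof (rule has_integral_over_cells[OF t _ n])
  fix m assume "m \<in> {1..N}"
  then show "(u has_integral (t m - t (m - 1)) *\<^sub>R un m) {t (m - 1)..t m}"
    using time_partition_cell[OF t, of m] u by (intro constant_interior_has_integral) auto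
qed

lemma step_integrable:
  fixes u :: "real \<Rightarrow> 'a::banach"
  assumes t: "time_partition T N t"
    and u: "steps N t u un"
  shows "u integrable_on {0..T}"
  using step_has_integral_node[OF assms order_refl] t by (auto simp: time_partition_def)

lemma piecewise_linear_has_integral:
  fixes y :: "real \<Rightarrow> 'a::banach"
  assumes t: "time_partition T N t"
    and y: "continuous_on {a..s} y"
      "\<forall>n\<in>{1..N}. \<forall>s\<in>{t (n - 1)<..<t n}. (y has_vector_derivative v s) (at s)"
    and s: "0 \<le> a" "a \<le> s" "s \<le> T"
  shows "(v has_integral (y s - y a)) {a..s}"
proof (rule fundamental_theorem_of_calculus_interior_strong[of "t ` {0..N}"])
  fix r assume "r \<in> {a<..<s} - t ` {0..N}"
  then show "(y has_vector_derivative v r) (at r)"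
    using open_cell_exists[OF t, of r] y(2) s by auto
qed (use assms in auto)

text \<open>
  On each cell a linear function is at least the smaller of its two end values, and the values at the
  nodes are the initial value plus the partial sums.
\<close>

lemma piecewise_linear_ge_Min:
  fixes y :: "real \<Rightarrow> real ^ 'n"
  assumes t: "time_partition T N t"
    and y: "continuous_on {0..s} y"
      "slopes N t y yd"
    and s: "0 \<le> s" "s \<le> T"
  shows "y 0 $ k + Min (insert 0 ((\<lambda>n. \<Sum>m = 1..n. (yd m $ k) * (t m - t (m - 1))) ` {1..N})) \<le> y s $ k"
proof -
  obtain v where v: "steps N t v yd"
    using step_function_exists[OF t, where un = yd] by (elim exE conjE)
  have y': "\<forall>n\<in>{1..N}. \<forall>s\<in>{t (n - 1)<..<t n}. (y has_vector_derivative v s) (at s)"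
    using y(2) v by simp
  obtain n where n: "n \<in> {1..N}" "t (n - 1) \<le> s" "s \<le> t n"
    using closed_cell_exists[OF t s] by blast
  define S :: "nat \<Rightarrow> real" where "S n = (\<Sum>m = 1..n. (yd m $ k) * (t m - t (m - 1)))" for n
  define M where "M = Min (insert 0 (S ` {1..N}))"
  have M: "M \<le> S m" if "m \<le> N" for m
  proof (cases "m = 0")
    case True
    then show ?thesis by (simp add: M_def S_def)
  next
    case False
    then have "S m \<in> insert 0 (S ` {1..N})" using that by auto
    then show ?thesis unfolding M_def by (intro Min_le) auto
  qed
  have "y s - y 0 = (\<Sum>m = 1..n - 1. (t m - t (m - 1)) *\<^sub>R yd m) + (s - t (n - 1)) *\<^sub>R yd n"
    using has_integral_unique[OF piecewise_linear_has_integral[OF t y(1) y' order_refl s] step_has_integral[OF t v n]] .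
  from arg_cong[OF this, of "\<lambda>v. v $ k"]
  have *: "y s $ k = y 0 $ k + S (n - 1) + (s - t (n - 1)) * yd n $ k"
    by (simp add: S_def mult.commute algebra_simps)
  have Sn: "S n = S (n - 1) + (t n - t (n - 1)) * yd n $ k"
  proof -
    obtain m where "n = Suc m" using n(1) by (cases n) auto
    then have "S n = S m + yd n $ k * (t n - t (n - 1))"
      unfolding S_def by (subst (1) \<open>n = Suc m\<close>, subst sum.cl_ivl_Suc) simp
    then show ?thesis using \<open>n = Suc m\<close> by (simp only: diff_Suc_1 mult.commute)
  qed
  have "M \<le> S (n - 1) + (s - t (n - 1)) * yd n $ k"
  proof (cases "yd n $ k \<ge> 0")
    case True
    then have "0 \<le> (s - t (n - 1)) * yd n $ k" using n by simp
    moreover have "n - 1 \<le> N" using n(1) by auto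
    ultimately show ?thesis using M[of "n - 1"] by linarith
  next
    case False
    then have "(t n - t (n - 1)) * yd n $ k \<le> (s - t (n - 1)) * yd n $ k"
      using n by (intro mult_right_mono_neg) auto
    moreover have "n \<le> N" using n(1) by auto
    ultimately show ?thesis using M[of n] Sn by linarith
  qed
  then show ?thesis using * unfolding M_def S_def by simp
qed

section \<open>The duality gap of the internal problem\<close>

text \<open>
  Feasible controls are only Lebesgue measurable, so Fubini's theorem is applied to the completed
  measure.
\<close>

lemma sigma_finite_lebesgue: "sigma_finite_measure (lebesgue :: 'a::euclidean_space measure)"
proof
  obtain B :: "'a set set" where B: "countable B" "B \<subseteq> sets lborel" "\<Union>B = space lborel"
    "\<forall>a\<in>B. emeasure lborel a \<noteq> \<infinity>"
    using lborel.sigma_finite_countable by blast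
  then show "\<exists>B :: 'a set set. countable B \<and> B \<subseteq> sets lebesgue \<and> \<Union>B = space lebesgue \<and>
      (\<forall>a\<in>B. emeasure lebesgue a \<noteq> \<infinity>)"
    by (intro exI[of _ B]) (auto simp: main_part_null_part_Un)
qed

text \<open>
  Both sides integrate \<open>f t * g s\<close> over the triangle of nonnegative \<open>t\<close>, \<open>s\<close> with \<open>t + s \<le> T\<close>.
\<close>

lemma fubini_triangle:
  fixes f g :: "real \<Rightarrow> real"
  assumes f: "f absolutely_integrable_on {0..T}" and g: "g absolutely_integrable_on {0..T}"
  shows "(\<lambda>t. f t * integral {0..T - t} g) integrable_on {0..T}"
    and "integral {0..T} (\<lambda>t. f t * integral {0..T - t} g) =
      integral {0..T} (\<lambda>s. g s * integral {0..T - s} f)"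
proof -
  interpret L: pair_sigma_finite "lebesgue :: real measure" "lebesgue :: real measure"
    by (intro pair_sigma_finite.intro sigma_finite_lebesgue)
  define F where "F t = indicat_real {0..T} t * f t" for t
  define G where "G t = indicat_real {0..T} t * g t" for t
  have F: "integrable lebesgue F" and G: "integrable lebesgue G"
    using f g by (simp_all add: set_integrable_def F_def[abs_def] G_def[abs_def])
  note [measurable] = borel_measurable_integrable[OF F] borel_measurable_integrable[OF G]
  have id [measurable]: "(\<lambda>x :: real. x) \<in> borel_measurable lebesgue"
    by (rule measurable_completion) simp
  define h where "h t s = indicat_real {..T} (t + s) * (F t * G s)" for t s
  have prod: "integrable (lebesgue \<Otimes>\<^sub>M lebesgue) (\<lambda>(t, s). F t * G s)"
    using F G by (intro L.Fubini_integrable) (auto simp: abs_mult)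
  have plus [measurable]: "(\<lambda>x :: real \<times> real. fst x + snd x) \<in> borel_measurable (lebesgue \<Otimes>\<^sub>M lebesgue)"
    by (intro borel_measurable_add measurable_compose[OF measurable_fst id] measurable_compose[OF measurable_snd id])
  have "integrable (lebesgue \<Otimes>\<^sub>M lebesgue) (case_prod h)"
    by (rule Bochner_Integration.integrable_bound[OF prod])
      (auto simp: h_def case_prod_beta' indicator_def)
  then have fub: "(LINT s|lebesgue. LINT t|lebesgue. h t s) = (LINT t|lebesgue. LINT s|lebesgue. h t s)"
    and int: "integrable lebesgue (\<lambda>t. LINT s|lebesgue. h t s)"
      "integrable lebesgue (\<lambda>s. LINT t|lebesgue. h t s)"
    by (rule L.Fubini_integral L.integrable_fst L.integrable_snd)+
  have inner: "(LINT s|lebesgue. indicat_real {..T} (t + s) * (indicat_real {0..T} s * k s)) = integral {0..T - t} k"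
    if k: "k absolutely_integrable_on {0..T}" and t: "t \<in> {0..T}" for k :: "real \<Rightarrow> real" and t
  proof -
    have "k absolutely_integrable_on {0..T - t}"
      using k t by (elim absolutely_integrable_on_subinterval) auto
    from set_lebesgue_integral_eq_integral(2)[OF this]
    have "(LINT s|lebesgue. indicat_real {0..T - t} s * k s) = integral {0..T - t} k"
      by (simp add: set_lebesgue_integral_def)
    moreover have "indicat_real {..T} (t + s) * (indicat_real {0..T} s * k s) = indicat_real {0..T - t} s * k s" for s
      using t by (auto simp: indicator_def)
    ultimately show ?thesis by (simp only:)
  qed
  have ht: "(LINT s|lebesgue. h t s) = indicator {0..T} t *\<^sub>R (f t * integral {0..T - t} g)" for t
  proof -
    have "(LINT s|lebesgue. h t s) = F t * (LINT s|lebesgue. indicat_real {..T} (t + s) * (indicat_real {0..T} s * g s))"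
      unfolding h_def G_def by (subst integral_mult_right_zero[symmetric]) (simp add: mult.left_commute)
    then show ?thesis using inner[OF g, of t] by (cases "t \<in> {0..T}") (simp_all add: F_def)
  qed
  have hs: "(LINT t|lebesgue. h t s) = indicator {0..T} s *\<^sub>R (g s * integral {0..T - s} f)" for s
  proof -
    have "(LINT t|lebesgue. h t s) = G s * (LINT t|lebesgue. indicat_real {..T} (s + t) * (indicat_real {0..T} t * f t))"
      unfolding h_def F_def
      by (subst integral_mult_right_zero[symmetric]) (simp add: mult.left_commute mult.commute add.commute)
    then show ?thesis using inner[OF f, of s] by (cases "s \<in> {0..T}") (simp_all add: G_def)
  qed
  have 1: "set_integrable lebesgue {0..T} (\<lambda>t. f t * integral {0..T - t} g)"
    and 2: "set_integrable lebesgue {0..T} (\<lambda>s. g s * integral {0..T - s} f)"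
    using int unfolding ht hs set_integrable_def by auto
  show "(\<lambda>t. f t * integral {0..T - t} g) integrable_on {0..T}"
    by (rule set_lebesgue_integral_eq_integral(1)[OF 1])
  show "integral {0..T} (\<lambda>t. f t * integral {0..T - t} g) =
      integral {0..T} (\<lambda>s. g s * integral {0..T - s} f)"
    using fub unfolding ht hs
    by (simp add: set_lebesgue_integral_eq_integral(2)[OF 1, symmetric]
      set_lebesgue_integral_eq_integral(2)[OF 2, symmetric] set_lebesgue_integral_def)
qed

lemma nonneg_absolutely_integrable_vec:
  fixes u :: "real \<Rightarrow> real ^ 'n"
  assumes "u integrable_on {0..T}" "\<forall>s\<in>{0..T}. 0 \<le> u s"
  shows "u absolutely_integrable_on {0..T}"
  using assms by (intro nonnegative_absolutely_integrable)
    (auto simp: Basis_vec_def inner_axis less_eq_vec_def)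

lemma absolutely_integrable_vec_nth:
  fixes u :: "real \<Rightarrow> real ^ 'n"
  assumes "u absolutely_integrable_on S"
  shows "(\<lambda>s. u s $ i) absolutely_integrable_on S"
  using absolutely_integrable_linear[OF assms bounded_linear_vec_nth[of i]] by (simp add: o_def)

lemma integral_nonneg_vec:
  fixes u :: "real \<Rightarrow> real ^ 'n"
  assumes "u integrable_on S" "\<And>s. s \<in> S \<Longrightarrow> 0 \<le> u s"
  shows "0 \<le> integral S u"
  unfolding less_eq_vec_def
proof
  fix i
  have "0 \<le> integral S (\<lambda>s. u s $ i)"
    using integrable_linear[OF assms(1) bounded_linear_vec_nth[of i]] assms(2)
    by (intro integral_nonneg) (auto simp: o_def less_eq_vec_def)
  then show "(0 :: real ^ 'n) $ i \<le> integral S u $ i" using assms(1) by simp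
qed

lemma integral_matrix_vector_mult:
  fixes u :: "real \<Rightarrow> real ^ 'j"
  assumes "u integrable_on S"
  shows "integral S (\<lambda>s. A *v u s) = A *v integral S u"
  using integral_linear[OF assms matrix_vector_mul_bounded_linear[of A]] by (simp add: o_def)

lemma continuous_inner_integrable:
  fixes u g :: "real \<Rightarrow> 'a::euclidean_space"
  assumes "u absolutely_integrable_on {0..T}" "continuous_on {0..T} g"
  shows "(\<lambda>s. g s \<bullet> u s) integrable_on {0..T}"
proof -
  have "(\<lambda>s. g s \<bullet> u s) absolutely_integrable_on {0..T}"
    using assms
    by (intro absolutely_integrable_bounded_measurable_product[of "(\<bullet>)"])
      (auto simp: bilinear_conv_bounded_bilinear bounded_bilinear_inner
        intro!: continuous_imp_measurable_on_sets_lebesgue compact_imp_bounded compact_continuous_image)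
  then show ?thesis by (rule set_lebesgue_integral_eq_integral(1))
qed

text \<open>
  The identity behind weak duality, as the primal at time \<open>t\<close> meets the dual at time \<open>T - t\<close>.
\<close>

lemma integral_pairing_commute:
  fixes A :: "real ^ 'j ^ 'k" and T :: real
  assumes u: "u absolutely_integrable_on {0..T}" and p: "p absolutely_integrable_on {0..T}"
  shows "integral {0..T} (\<lambda>t. (transpose A *v integral {0..T - t} p) \<bullet> u t) =
    integral {0..T} (\<lambda>s. (A *v integral {0..T - s} u) \<bullet> p s)"
proof -
  have uj: "(\<lambda>s. u s $ j) absolutely_integrable_on {0..T}" for j
    using absolutely_integrable_vec_nth[OF u] .
  have pk: "(\<lambda>s. p s $ k) absolutely_integrable_on {0..T}" for k
    using absolutely_integrable_vec_nth[OF p] .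
  have p': "p integrable_on {0..T - t}" if "t \<in> {0..T}" for t
    using set_lebesgue_integral_eq_integral(1)[OF p] that by (elim integrable_on_subinterval) auto
  have u': "u integrable_on {0..T - t}" if "t \<in> {0..T}" for t
    using set_lebesgue_integral_eq_integral(1)[OF u] that by (elim integrable_on_subinterval) auto
  note fub = fubini_triangle[OF uj pk] and fub' = fubini_triangle[OF pk uj]
  have "integral {0..T} (\<lambda>t. (transpose A *v integral {0..T - t} p) \<bullet> u t) =
    integral {0..T} (\<lambda>t. \<Sum>j\<in>UNIV. \<Sum>k\<in>UNIV. A $ k $ j * (u t $ j * integral {0..T - t} (\<lambda>s. p s $ k)))"
    by (intro integral_cong) (simp add: p' inner_vec_def matrix_vector_mult_def transpose_def
      sum_distrib_right sum_distrib_left mult.assoc mult.commute mult.left_commute)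
  also have "\<dots> = (\<Sum>j\<in>UNIV. \<Sum>k\<in>UNIV. A $ k $ j * integral {0..T} (\<lambda>t. u t $ j * integral {0..T - t} (\<lambda>s. p s $ k)))"
    by (subst integral_sum integral_mult_right, (intro finite integrable_sum integrable_on_mult_right fub)+)+ simp
  also have "\<dots> = (\<Sum>j\<in>UNIV. \<Sum>k\<in>UNIV. A $ k $ j * integral {0..T} (\<lambda>s. p s $ k * integral {0..T - s} (\<lambda>t. u t $ j)))"
    by (simp only: fub(2))
  also have "\<dots> = (\<Sum>k\<in>UNIV. \<Sum>j\<in>UNIV. A $ k $ j * integral {0..T} (\<lambda>s. p s $ k * integral {0..T - s} (\<lambda>t. u t $ j)))"
    by (rule sum.swap)
  also have "\<dots> = integral {0..T} (\<lambda>s. \<Sum>k\<in>UNIV. \<Sum>j\<in>UNIV. A $ k $ j * (p s $ k * integral {0..T - s} (\<lambda>t. u t $ j)))"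
    by (subst integral_sum integral_mult_right, (intro finite integrable_sum integrable_on_mult_right fub')+)+ simp
  also have "\<dots> = integral {0..T} (\<lambda>s. (A *v integral {0..T - s} u) \<bullet> p s)"
    by (intro integral_cong) (simp add: u' inner_vec_def matrix_vector_mult_def
      sum_distrib_right sum_distrib_left mult.assoc mult.commute mult.left_commute)
  finally show ?thesis .
qed

lemma matrix_vector_mult_minus: "(- A) *v x = - (A *v x)" for A :: "real ^ 'j ^ 'k"
  by (simp add: matrix_vector_mult_def vec_eq_iff sum_negf)

lemma continuous_on_sclp_state:
  assumes "u integrable_on {0..T}"
  shows "continuous_on {0..T} (sclp_state A b x0 u)"
proof -
  have "(\<lambda>r. A *v u r) integrable_on {0..T}"
    using integrable_linear[OF assms matrix_vector_mul_bounded_linear[of A]] by (simp add: o_def)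
  then show ?thesis
    unfolding sclp_state_def
    by (intro continuous_intros indefinite_integral_continuous_1)
qed

lemma sclp_dual_state_eq: "sclp_dual_state A c qN p = sclp_state (- transpose A) (- c) qN p"
  by (rule ext) (simp add: sclp_dual_state_def sclp_state_def matrix_vector_mult_minus)

text \<open>
  Expressing the objective coefficients by the states leaves the two slackness integrals and the two
  sides of \<open>integral_pairing_commute\<close>, which cancel.
\<close>

lemma sclp_duality_gap:
  fixes A :: "real ^ 'j ^ 'k" and b x0 :: "real ^ 'k" and c qN :: "real ^ 'j"
  assumes u: "u integrable_on {0..T}" "\<forall>s\<in>{0..T}. 0 \<le> u s"
    and p: "p integrable_on {0..T}" "\<forall>s\<in>{0..T}. 0 \<le> p s"
  defines "x \<equiv> sclp_state A b x0 u" and "q \<equiv> sclp_dual_state A c qN p"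
  shows "(\<lambda>t. q (T - t) \<bullet> u t) integrable_on {0..T}"
    and "(\<lambda>s. x (T - s) \<bullet> p s) integrable_on {0..T}"
    and "sclp_dual_objective b x0 T p - sclp_objective c qN T u =
      integral {0..T} (\<lambda>t. q (T - t) \<bullet> u t) + integral {0..T} (\<lambda>s. x (T - s) \<bullet> p s)"
proof -
  have ua: "u absolutely_integrable_on {0..T}" and pa: "p absolutely_integrable_on {0..T}"
    using u p by (auto intro: nonneg_absolutely_integrable_vec)
  have cx: "continuous_on {0..T} (\<lambda>s. x (T - s))"
    unfolding x_def by (rule continuous_on_compose2[OF continuous_on_sclp_state[OF u(1)]])
      (auto intro!: continuous_intros)
  have cq: "continuous_on {0..T} (\<lambda>s. q (T - s))"
    unfolding q_def sclp_dual_state_eq by (rule continuous_on_compose2[OF continuous_on_sclp_state[OF p(1)]])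
      (auto intro!: continuous_intros)
  show 1: "(\<lambda>t. q (T - t) \<bullet> u t) integrable_on {0..T}"
    by (rule continuous_inner_integrable[OF ua cq])
  show 2: "(\<lambda>s. x (T - s) \<bullet> p s) integrable_on {0..T}"
    by (rule continuous_inner_integrable[OF pa cx])
  have 3: "(\<lambda>t. (- qN + (T - t) *\<^sub>R c) \<bullet> u t) integrable_on {0..T}"
    by (rule continuous_inner_integrable[OF ua]) (intro continuous_intros)
  have 4: "(\<lambda>t. (x0 + (T - t) *\<^sub>R b) \<bullet> p t) integrable_on {0..T}"
    by (rule continuous_inner_integrable[OF pa]) (intro continuous_intros)
  have sub: "u integrable_on {0..T - t}" "p integrable_on {0..T - t}" if "t \<in> {0..T}" for t
    using u(1) p(1) that by (auto elim!: integrable_on_subinterval)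
  have "integral {0..T} (\<lambda>t. (- qN + (T - t) *\<^sub>R c) \<bullet> u t) + integral {0..T} (\<lambda>t. q (T - t) \<bullet> u t) =
     integral {0..T} (\<lambda>t. (- qN + (T - t) *\<^sub>R c) \<bullet> u t + q (T - t) \<bullet> u t)"
    by (rule integral_add[symmetric, OF 3 1])
  also have "\<dots> = integral {0..T} (\<lambda>t. (transpose A *v integral {0..T - t} p) \<bullet> u t)"
    by (intro integral_cong)
      (simp add: q_def sclp_dual_state_def integral_matrix_vector_mult sub inner_add_left[symmetric]
        del: transpose_matrix_vector)
  also have "\<dots> = integral {0..T} (\<lambda>s. (A *v integral {0..T - s} u) \<bullet> p s)"
    by (rule integral_pairing_commute[OF ua pa])
  also have "\<dots> = integral {0..T} (\<lambda>s. (x0 + (T - s) *\<^sub>R b) \<bullet> p s - x (T - s) \<bullet> p s)"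
    by (intro integral_cong)
      (simp add: x_def sclp_state_def integral_matrix_vector_mult sub inner_diff_left[symmetric])
  also have "\<dots> = integral {0..T} (\<lambda>s. (x0 + (T - s) *\<^sub>R b) \<bullet> p s) - integral {0..T} (\<lambda>s. x (T - s) \<bullet> p s)"
    by (rule integral_diff[OF 4 2])
  finally show "sclp_dual_objective b x0 T p - sclp_objective c qN T u =
      integral {0..T} (\<lambda>t. q (T - t) \<bullet> u t) + integral {0..T} (\<lambda>s. x (T - s) \<bullet> p s)"
    by (simp add: sclp_dual_objective_def sclp_objective_def)
qed

section \<open>Vanishing Stieltjes integrals\<close>

text \<open>
  The integrator in \<open>stieltjes_integral\<close>, whose jump at 0 is \<open>F 0\<close>.
\<close>

definition stieltjes_extension :: "real \<Rightarrow> (real \<Rightarrow> real) \<Rightarrow> real \<Rightarrow> real" where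
  "stieltjes_extension T F r = (if r < 0 then 0 else F (min r T))"

definition stieltjes_measure :: "real \<Rightarrow> (real \<Rightarrow> real) \<Rightarrow> real measure" where
  "stieltjes_measure T F = interval_measure (stieltjes_extension T F)"

definition stieltjes_integrator :: "real \<Rightarrow> (real \<Rightarrow> real) \<Rightarrow> bool" where
  "stieltjes_integrator T F \<longleftrightarrow> 0 < T \<and> mono_on {0..T} F \<and> (\<forall>s\<in>{0..T}. 0 \<le> F s) \<and>
     (\<forall>s\<in>{0..<T}. continuous (at_right s) F)"

lemma stieltjes_integral_alt:
  "stieltjes_integral T f F = (LINT s|stieltjes_measure T F. indicat_real {0..T} s * f s)"
  by (simp add: stieltjes_integral_def stieltjes_measure_def stieltjes_extension_def[abs_def]
    set_lebesgue_integral_def)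

lemma sets_stieltjes_measure [simp, measurable_cong]: "sets (stieltjes_measure T F) = sets borel"
  by (simp add: stieltjes_measure_def)

lemma space_stieltjes_measure [simp]: "space (stieltjes_measure T F) = UNIV"
  by (simp add: stieltjes_measure_def)

lemma mono_stieltjes_extension:
  assumes "stieltjes_integrator T F" "x \<le> y"
  shows "stieltjes_extension T F x \<le> stieltjes_extension T F y"
  using assms by (auto simp: stieltjes_extension_def stieltjes_integrator_def mono_on_def)

lemma continuous_stieltjes_extension:
  assumes "stieltjes_integrator T F"
  shows "continuous (at_right a) (stieltjes_extension T F)"
proof -
  consider "a < 0" | "0 \<le> a" "a < T" | "T \<le> a" by linarith
  then show ?thesis
  proof cases
    case 1
    have "eventually (\<lambda>r. stieltjes_extension T F r = 0) (at_right a)"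
      using 1 by (auto simp: eventually_at_right[OF 1] stieltjes_extension_def intro!: exI[of _ 0])
    then show ?thesis
      using 1 by (simp add: continuous_within stieltjes_extension_def tendsto_eventually)
  next
    case 2
    then have "(F \<longlongrightarrow> F a) (at_right a)"
      using assms by (simp add: stieltjes_integrator_def continuous_within)
    moreover have "eventually (\<lambda>r. F r = stieltjes_extension T F r) (at_right a)"
      using 2 by (auto simp: eventually_at_right[OF 2(2)] stieltjes_extension_def intro!: exI[of _ T])
    ultimately have "(stieltjes_extension T F \<longlongrightarrow> F a) (at_right a)"
      by (rule Lim_transform_eventually)
    then show ?thesis using 2 by (simp add: continuous_within stieltjes_extension_def)
  next
    case 3
    have "0 \<le> T" using assms by (simp add: stieltjes_integrator_def)
    then have "eventually (\<lambda>r. stieltjes_extension T F r = F T) (at_right a)"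
      using 3 by (auto simp: eventually_at_filter stieltjes_extension_def min_def intro!: always_eventually)
    then have "(stieltjes_extension T F \<longlongrightarrow> F T) (at_right a)"
      by (rule tendsto_eventually)
    moreover have "stieltjes_extension T F a = F T"
      using 3 \<open>0 \<le> T\<close> by (simp add: stieltjes_extension_def min_absorb2)
    ultimately show ?thesis by (simp add: continuous_within)
  qed
qed

lemma emeasure_stieltjes_Ioc:
  assumes "stieltjes_integrator T F" "a \<le> b"
  shows "emeasure (stieltjes_measure T F) {a<..b} =
    ennreal (stieltjes_extension T F b - stieltjes_extension T F a)"
  unfolding stieltjes_measure_def
  using assms(2) mono_stieltjes_extension[OF assms(1)] continuous_stieltjes_extension[OF assms(1)]
  by (rule emeasure_interval_measure_Ioc)

text \<open>
  The singleton is a decreasing intersection of half-open intervals, whose measures are increments.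
\<close>

lemma emeasure_stieltjes_singleton:
  assumes F: "stieltjes_integrator T F" and l: "(stieltjes_extension T F \<longlongrightarrow> l) (at_left a)"
  shows "emeasure (stieltjes_measure T F) {a} = ennreal (stieltjes_extension T F a - l)"
proof -
  let ?M = "stieltjes_measure T F" and ?G = "stieltjes_extension T F"
  define B where "B n = {a - 1 / real (Suc n)<..a}" for n
  have "(\<lambda>n. emeasure ?M (B n)) \<longlonglongrightarrow> emeasure ?M (\<Inter>n. B n)"
  proof (rule Lim_emeasure_decseq)
    show "range B \<subseteq> sets ?M" by (auto simp: B_def)
    have "B (Suc n) \<subseteq> B n" for n
    proof -
      have "1 / real (Suc (Suc n)) \<le> 1 / real (Suc n)" by (simp add: field_simps)
      then show ?thesis unfolding B_def subset_iff greaterThanAtMost_iff by (intro allI impI conjI) linarith+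
    qed
    then show "decseq B" by (rule decseq_SucI)
    show "emeasure ?M (B n) \<noteq> \<infinity>" for n
      by (simp add: B_def emeasure_stieltjes_Ioc[OF F])
  qed
  moreover have "(\<Inter>n. B n) = {a}"
  proof
    show "(\<Inter>n. B n) \<subseteq> {a}"
    proof
      fix s assume s: "s \<in> (\<Inter>n. B n)"
      then have "s \<le> a" by (auto simp: B_def)
      moreover have "\<not> s < a"
      proof
        assume "s < a"
        then obtain n where "1 / real (Suc n) < a - s"
          using reals_Archimedean[of "a - s"] by (auto simp: inverse_eq_divide)
        moreover have "s \<in> B n" using s by blast
        ultimately show False by (simp add: B_def)
      qed
      ultimately show "s \<in> {a}" by simp
    qed
  qed (auto simp: B_def)
  moreover have "(\<lambda>n. emeasure ?M (B n)) \<longlonglongrightarrow> ennreal (?G a - l)"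
  proof -
    have "filterlim (\<lambda>n. a - 1 / real (Suc n)) (at_left a) sequentially"
      unfolding filterlim_at
    proof
      have "(\<lambda>n. 1 / real (Suc n)) \<longlonglongrightarrow> 0"
        using LIMSEQ_inverse_real_of_nat by (simp add: inverse_eq_divide)
      from tendsto_diff[OF tendsto_const[of a] this]
      show "((\<lambda>n. a - 1 / real (Suc n)) \<longlongrightarrow> a) sequentially" by simp
    qed simp
    from filterlim_compose[OF l this]
    have "(\<lambda>n. ?G a - ?G (a - 1 / real (Suc n))) \<longlonglongrightarrow> ?G a - l"
      by (intro tendsto_diff tendsto_const)
    then show ?thesis
      by (simp add: B_def emeasure_stieltjes_Ioc[OF F] tendsto_ennrealI)
  qed
  ultimately show ?thesis using LIMSEQ_unique by metis
qed

text \<open>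
  The open interval is exhausted by half-open intervals of increment 0.
\<close>

lemma null_stieltjes_flat:
  assumes F: "stieltjes_integrator T F"
    and flat: "\<And>s. s \<in> {a<..<b} \<Longrightarrow> stieltjes_extension T F s = g"
  shows "{a<..<b} \<in> null_sets (stieltjes_measure T F)"
proof -
  define e where "e n = (b - a) / real (Suc (Suc n))" for n
  have "{a + e n<..b - e n} \<in> null_sets (stieltjes_measure T F)" if "a < b" for n
  proof (cases "a + e n \<le> b - e n")
    case True
    have "e n > 0" using that by (simp add: e_def)
    then show ?thesis
      using True flat[of "a + e n"] flat[of "b - e n"] by (intro null_setsI) (simp_all add: emeasure_stieltjes_Ioc[OF F])
  qed simp
  then have "a < b \<Longrightarrow> (\<Union>n. {a + e n<..b - e n}) \<in> null_sets (stieltjes_measure T F)"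
    by (intro null_sets_UN) auto
  moreover have "{a<..<b} \<subseteq> (\<Union>n. {a + e n<..b - e n})"
  proof
    fix s assume s: "s \<in> {a<..<b}"
    define d where "d = min (s - a) (b - s)"
    have "d > 0" "a < b" using s by (auto simp: d_def)
    then obtain n where n: "1 / real (Suc n) < d / (b - a)"
      using reals_Archimedean[of "d / (b - a)"] by (auto simp: inverse_eq_divide)
    have "e n < (b - a) * (1 / real (Suc n))" using \<open>a < b\<close> by (simp add: e_def field_simps)
    also have "\<dots> < (b - a) * (d / (b - a))" using n \<open>a < b\<close> by (intro mult_strict_left_mono) auto
    also have "\<dots> = d" using \<open>a < b\<close> by simp
    finally have "s \<in> {a + e n<..b - e n}" by (auto simp: d_def)
    then show "s \<in> (\<Union>n. {a + e n<..b - e n})" by blast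
  qed
  ultimately show ?thesis
    by (cases "a < b") (auto intro: null_sets_subset)
qed

lemma stieltjes_extension_left_limit:
  assumes "0 < a" "a \<le> T" "(F \<longlongrightarrow> l) (at_left a)"
  shows "(stieltjes_extension T F \<longlongrightarrow> l) (at_left a)"
proof (rule Lim_transform_eventually[OF assms(3)])
  show "eventually (\<lambda>r. F r = stieltjes_extension T F r) (at_left a)"
    using assms(1,2) by (auto simp: eventually_at_left[OF assms(1)] stieltjes_extension_def intro!: exI[of _ 0])
qed

lemma stieltjes_extension_left_limit_0:
  "(stieltjes_extension T F \<longlongrightarrow> 0) (at_left 0)"
proof (rule tendsto_eventually)
  show "eventually (\<lambda>r. stieltjes_extension T F r = 0) (at_left 0)"
    by (auto simp: eventually_at_filter stieltjes_extension_def intro!: always_eventually)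
qed

text \<open>
  The measure is carried by the cells with nonzero slope and by the points 0 and \<open>T\<close>, since \<open>F\<close> is
  continuous at the inner nodes; on all of these \<open>f\<close> vanishes, up to points of measure 0.
\<close>

lemma stieltjes_integral_eq_0:
  assumes F: "stieltjes_integrator T F" and t: "time_partition T N t"
    and cont: "continuous_on {0..<T} F" and L: "(F \<longlongrightarrow> L) (at_left T)"
    and deriv: "\<forall>n\<in>{1..N}. \<forall>s\<in>{t (n - 1)<..<t n}. (F has_real_derivative r n) (at s)"
    and cells: "\<forall>n\<in>{1..N}. \<forall>s\<in>{t (n - 1)<..<t n}. f s * r n = 0"
    and ends: "f 0 * F 0 = 0" "f T * (F T - L) = 0"
  shows "stieltjes_integral T f F = 0"
proof -
  let ?M = "stieltjes_measure T F"
  have T: "0 < T" using F by (simp add: stieltjes_integrator_def)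
  \<comment> \<open>A null set that contains all points where the integrand does not vanish.\<close>
  define B where "B = (\<Union>n\<in>{n\<in>{1..N}. r n = 0}. {t (n - 1)<..<t n}) \<union>
    (\<Union>s\<in>{s\<in>t ` {0..N}. emeasure ?M {s} = 0}. {s})"
  have "{t (n - 1)<..<t n} \<in> null_sets ?M" if n: "n \<in> {1..N}" "r n = 0" for n
  proof (rule null_stieltjes_flat[OF F])
    fix s assume s: "s \<in> {t (n - 1)<..<t n}"
    define m where "m = (t (n - 1) + t n) / 2"
    have m: "m \<in> {t (n - 1)<..<t n}" using s by (auto simp: m_def)
    have "(F has_real_derivative 0) (at z)" if "z \<in> {t (n - 1)<..<t n}" for z
      using deriv[rule_format, OF n(1) that] n(2) by simp
    then have "F s = F m"
      using time_partition_cell[OF t n(1)] s m by (intro DERIV_isconst3[of "t (n - 1)" "t n" s m F]) auto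
    then show "stieltjes_extension T F s = F m"
      using time_partition_cell[OF t n(1)] s by (auto simp: stieltjes_extension_def min_def)
  qed
  then have null: "B \<in> null_sets ?M"
    unfolding B_def by (intro null_sets.Un null_sets_UN') (auto intro: countable_finite)
  have "s \<in> B" if s: "s \<in> {0..T}" "f s \<noteq> 0" for s
  proof (cases "s \<in> t ` {0..N}")
    case False
    then obtain n where n: "n \<in> {1..N}" "s \<in> {t (n - 1)<..<t n}"
      using open_cell_exists[OF t, of s] s by auto
    then have "r n = 0" using cells s(2) by (metis mult_eq_0_iff)
    then show ?thesis using n unfolding B_def by blast
  next
    case True
    have "emeasure ?M {s} = 0"
    proof -
      consider "s = 0" | "0 < s" "s < T" | "s = T" using s by fastforce
      then show ?thesis
      proof cases
        case 1
        then have "F 0 = 0" using ends(1) s by simp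
        then show ?thesis
          using emeasure_stieltjes_singleton[OF F stieltjes_extension_left_limit_0] 1 T
          by (simp add: stieltjes_extension_def)
      next
        case 2
        have "isCont F s"
          using cont 2 by (auto simp: continuous_on_eq_continuous_at[OF open_greaterThanLessThan]
            intro!: continuous_on_interior[OF cont])
        then have "(F \<longlongrightarrow> F s) (at_left s)"
          by (auto simp: continuous_at intro: tendsto_within_subset)
        from stieltjes_extension_left_limit[OF 2(1) _ this] 2
        have "(stieltjes_extension T F \<longlongrightarrow> F s) (at_left s)" by simp
        from emeasure_stieltjes_singleton[OF F this] 2 show ?thesis
          by (simp add: stieltjes_extension_def min_def)
      next
        case 3
        then have "F T = L" using ends(2) s by simp
        then show ?thesis
          using emeasure_stieltjes_singleton[OF F stieltjes_extension_left_limit[OF T order_refl L]] 3 T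
          by (simp add: stieltjes_extension_def)
      qed
    qed
    then show ?thesis using True unfolding B_def by blast
  qed
  then have "AE s in ?M. indicat_real {0..T} s * f s = 0"
    by (intro AE_I'[OF null]) (auto simp: indicator_def split: if_splits)
  then show ?thesis
    unfolding stieltjes_integral_alt by (rule integral_eq_zero_AE)
qed

lemma stieltjes_integral_nonneg:
  assumes "\<forall>s\<in>{0..T}. 0 \<le> f s"
  shows "0 \<le> stieltjes_integral T f F"
  unfolding stieltjes_integral_alt using assms by (intro integral_nonneg_AE) (auto simp: indicator_def)

text \<open>
  A nonnegative integrable function with integral 0 vanishes almost everywhere, so at every atom, and
  by continuity throughout a cell of nonzero slope.  Continuity and the bound \<open>C\<close> make \<open>f\<close> integrable;
  for a function that is not integrable the integral would be 0 by convention.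
\<close>

lemma stieltjes_integral_zero_imp:
  assumes F: "stieltjes_integrator T F" and t: "time_partition T N t"
    and L: "(F \<longlongrightarrow> L) (at_left T)"
    and deriv: "\<forall>n\<in>{1..N}. \<forall>s\<in>{t (n - 1)<..<t n}. (F has_real_derivative r n) (at s)"
    and f: "continuous_on {0<..T} f" "\<forall>s\<in>{0..T}. 0 \<le> f s" "\<forall>s\<in>{0..T}. f s \<le> C"
    and zero: "stieltjes_integral T f F = 0"
  shows "f 0 * F 0 = 0" "f T * (F T - L) = 0"
    and "\<forall>n\<in>{1..N}. \<forall>s\<in>{t (n - 1)<..<t n}. f s * r n = 0"
proof -
  let ?M = "stieltjes_measure T F"
  have T: "0 < T" using F by (simp add: stieltjes_integrator_def)
  have Fmono: "F a \<le> F b" if "0 \<le> a" "a \<le> b" "b \<le> T" for a b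
    using F that by (auto simp: stieltjes_integrator_def mono_on_def)
  have "(\<lambda>s. indicat_real {0<..T} s *\<^sub>R f s + indicator {0} s *\<^sub>R f 0) \<in> borel_measurable borel"
    by (intro borel_measurable_add borel_measurable_continuous_on_indicator f borel_measurable_scaleR) auto
  also have "(\<lambda>s. indicat_real {0<..T} s *\<^sub>R f s + indicator {0} s *\<^sub>R f 0) = (\<lambda>s. indicat_real {0..T} s * f s)"
    using T by (auto simp: indicator_def fun_eq_iff)
  finally have meas: "(\<lambda>s. indicat_real {0..T} s * f s) \<in> borel_measurable ?M"
    by (simp cong: measurable_cong_sets)
  have fin: "emeasure ?M {-1<..T} < \<infinity>"
    using T by (subst emeasure_stieltjes_Ioc[OF F]) auto
  have "0 \<le> C" using f(2,3) T by (meson atLeastAtMost_iff less_imp_le order_refl order_trans)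
  have "integrable ?M (\<lambda>s. indicat_real {0..T} s * f s)"
    by (rule integrableI_bounded_set[OF _ meas fin, of C])
      (use f T \<open>0 \<le> C\<close> in \<open>auto simp: indicator_def intro!: AE_I2\<close>)
  then have "AE s in ?M. indicat_real {0..T} s * f s = 0"
    using zero f(2) unfolding stieltjes_integral_alt
    by (subst (asm) integral_nonneg_eq_0_iff_AE) (auto simp: indicator_def)
  then obtain B where "{s \<in> space ?M. \<not> (indicat_real {0..T} s * f s = 0)} \<subseteq> B" "emeasure ?M B = 0" "B \<in> sets ?M"
    by (elim AE_E)
  then have B: "B \<in> null_sets ?M" "\<And>s. s \<in> {0..T} \<Longrightarrow> f s \<noteq> 0 \<Longrightarrow> s \<in> B"
    by (auto simp: indicator_def)
  have null: "emeasure ?M S = 0" if "\<And>s. s \<in> S \<Longrightarrow> s \<in> {0..T} \<and> f s \<noteq> 0" "S \<in> sets borel" for S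
    using null_sets_subset[OF B(1), of S] that B(2) by (auto dest: null_setsD1)
  show "f 0 * F 0 = 0"
  proof (rule ccontr)
    assume "f 0 * F 0 \<noteq> 0"
    moreover from this have "emeasure ?M {0} = 0" using T by (intro null) auto
    moreover have "0 \<le> F 0" using F T by (simp add: stieltjes_integrator_def)
    ultimately show False
      using emeasure_stieltjes_singleton[OF F stieltjes_extension_left_limit_0] T
      by (simp add: stieltjes_extension_def)
  qed
  show "f T * (F T - L) = 0"
  proof (rule ccontr)
    assume *: "f T * (F T - L) \<noteq> 0"
    moreover from this have "emeasure ?M {T} = 0" using T by (intro null) auto
    moreover have "L \<le> F T"
    proof (rule tendsto_upperbound[OF L])
      show "eventually (\<lambda>s. F s \<le> F T) (at_left T)"
        using T Fmono by (auto simp: eventually_at_left[OF T] intro!: exI[of _ 0])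
    qed simp
    ultimately show False
      using emeasure_stieltjes_singleton[OF F stieltjes_extension_left_limit[OF T order_refl L]] T
      by (simp add: stieltjes_extension_def)
  qed
  show "\<forall>n\<in>{1..N}. \<forall>s\<in>{t (n - 1)<..<t n}. f s * r n = 0"
  proof (intro ballI, rule ccontr)
    fix n s assume n: "n \<in> {1..N}" and s: "s \<in> {t (n - 1)<..<t n}" and nz: "f s * r n \<noteq> 0"
    note cell = time_partition_cell[OF t n]
    have "isCont f s"
      using s cell by (intro continuous_on_interior[OF f(1)]) auto
    then have "eventually (\<lambda>z. f z \<noteq> 0) (nhds s)"
      using nz by (intro tendsto_imp_eventually_ne[of f "f s"]) (auto simp: isCont_def tendsto_nhds_iff)
    then obtain d where d: "d > 0" "\<And>z. dist z s < d \<Longrightarrow> f z \<noteq> 0"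
      unfolding eventually_nhds_metric by blast
    define e where "e = min (d / 2) (min ((s - t (n - 1)) / 2) ((t n - s) / 2))"
    have e: "e > 0" "e < d" "t (n - 1) < s - e" "s + e < t n"
      using d(1) s unfolding e_def by (auto simp: min_def field_simps)
    have "emeasure ?M {s - e<..s + e} = 0"
      using e cell by (intro null) (auto simp: dist_real_def intro!: d(2))
    moreover have "stieltjes_extension T F (s + e) - stieltjes_extension T F (s - e) = F (s + e) - F (s - e)"
      using e cell by (auto simp: stieltjes_extension_def min_def)
    moreover have "\<exists>z. z > s - e \<and> z < s + e \<and> F (s + e) - F (s - e) = (s + e - (s - e)) * r n"
    proof -
      have "\<exists>z. s - e < z \<and> z < s + e \<and> F (s + e) - F (s - e) = ((s + e) - (s - e)) * (\<lambda>_. r n) z"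
        using e deriv n by (intro MVT2) auto
      then show ?thesis by blast
    qed
    moreover have "F (s - e) \<le> F (s + e)" using e cell by (intro Fmono) auto
    ultimately show False
      using e nz by (simp add: emeasure_stieltjes_Ioc[OF F])
  qed
qed

section \<open>Step controls and impulses for the internal problem\<close>

text \<open>
  The dual is the primal for \<open>- transpose A\<close>, \<open>- c\<close>, \<open>- b\<close> with \<open>x0\<close> and \<open>qN\<close> exchanged.  This symmetry
  lets the bounds for primal controls be used for dual controls too.
\<close>

lemma sclp_dual_feasible_eq:
  "sclp_dual_feasible A c qN T p \<longleftrightarrow> sclp_feasible (- transpose A) (- c) qN T p"
proof -
  have "- qN + s *\<^sub>R c \<le> integral {0..s} (\<lambda>r. transpose A *v p r) \<longleftrightarrow>
    integral {0..s} (\<lambda>r. - transpose A *v p r) \<le> qN + s *\<^sub>R - c" for s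
    using neg_le_iff_le[of "integral {0..s} (\<lambda>r. transpose A *v p r)" "- qN + s *\<^sub>R c"]
    by (simp add: matrix_vector_mult_minus del: transpose_matrix_vector)
  then show ?thesis by (simp add: sclp_dual_feasible_def sclp_feasible_def)
qed

lemma sclp_dual_objective_eq: "sclp_dual_objective b x0 T p = - sclp_objective (- b) x0 T p"
proof -
  have "(- x0 + (T - s) *\<^sub>R - b) \<bullet> p s = - ((x0 + (T - s) *\<^sub>R b) \<bullet> p s)" for s
    by (simp add: inner_diff_left inner_add_left)
  then show ?thesis by (simp add: sclp_dual_objective_def sclp_objective_def)
qed

lemma sclp_dual_optimal_eq:
  "sclp_dual_optimal A b c x0 qN T p \<longleftrightarrow> sclp_optimal (- transpose A) (- c) (- b) qN x0 T p"
  by (simp add: sclp_dual_optimal_def sclp_optimal_def sclp_dual_feasible_eq sclp_dual_objective_eq)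

lemma affine_inner_has_integral:
  fixes \<alpha> c w :: "'a::euclidean_space"
  assumes "a \<le> b"
  shows "((\<lambda>s. (\<alpha> + (T - s) *\<^sub>R c) \<bullet> w) has_integral
    (b - a) * ((\<alpha> + (T - (a + b) / 2) *\<^sub>R c) \<bullet> w)) {a..b}"
proof -
  define H where "H s = s * (\<alpha> \<bullet> w) + (T * s - s\<^sup>2 / 2) * (c \<bullet> w)" for s
  have "((\<lambda>s. (\<alpha> + (T - s) *\<^sub>R c) \<bullet> w) has_integral H b - H a) {a..b}"
  proof (rule fundamental_theorem_of_calculus[OF assms])
    fix s
    have "(H has_real_derivative (\<alpha> \<bullet> w) + (T - s) * (c \<bullet> w)) (at s within {a..b})"
      unfolding H_def by (auto intro!: derivative_eq_intros simp: algebra_simps)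
    then show "(H has_vector_derivative (\<alpha> + (T - s) *\<^sub>R c) \<bullet> w) (at s within {a..b})"
      by (simp add: has_real_derivative_iff_has_vector_derivative inner_add_left)
  qed
  moreover have "H b - H a = (b - a) * ((\<alpha> + (T - (a + b) / 2) *\<^sub>R c) \<bullet> w)"
    by (simp add: H_def inner_add_left power2_eq_square field_simps)
  ultimately show ?thesis by simp
qed

lemma affine_inner_interior_has_integral:
  fixes \<alpha> c w :: "'a::euclidean_space"
  assumes "a \<le> b" "\<And>s. s \<in> {a<..<b} \<Longrightarrow> u s = w"
  shows "((\<lambda>s. (\<alpha> + (T - s) *\<^sub>R c) \<bullet> u s) has_integral
    (b - a) * ((\<alpha> + (T - (a + b) / 2) *\<^sub>R c) \<bullet> w)) {a..b}"
  by (rule has_integral_spike_finite[of "{a, b}", OF _ _ affine_inner_has_integral[OF assms(1)]])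
    (use assms in auto)

lemma sclp_feasibleD:
  assumes "sclp_feasible A b x0 T u"
  shows "u integrable_on {0..T}" "u absolutely_integrable_on {0..T}"
    "\<And>s. s \<in> {0..T} \<Longrightarrow> u integrable_on {0..s}"
    "\<And>s. s \<in> {0..T} \<Longrightarrow> 0 \<le> u s"
    "\<And>s. s \<in> {0..T} \<Longrightarrow> A *v integral {0..s} u \<le> x0 + s *\<^sub>R b"
proof -
  show 1: "u integrable_on {0..T}" using assms by (simp add: sclp_feasible_def)
  show 2: "u integrable_on {0..s}" if "s \<in> {0..T}" for s
    using 1 that by (auto elim: integrable_on_subinterval)
  show 3: "0 \<le> u s" if "s \<in> {0..T}" for s
    using assms that by (simp add: sclp_feasible_def)
  show "u absolutely_integrable_on {0..T}" using 1 3 by (intro nonneg_absolutely_integrable_vec) auto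
  show "A *v integral {0..s} u \<le> x0 + s *\<^sub>R b" if "s \<in> {0..T}" for s
  proof -
    have "integral {0..s} (\<lambda>r. A *v u r) \<le> x0 + s *\<^sub>R b"
      using assms that by (simp add: sclp_feasible_def)
    then show ?thesis by (simp only: integral_matrix_vector_mult[OF 2[OF that]])
  qed
qed

lemma sclp_feasibleI:
  assumes "u integrable_on {0..T}" "\<And>s. s \<in> {0..T} \<Longrightarrow> 0 \<le> u s"
    "\<And>s. s \<in> {0..T} \<Longrightarrow> A *v integral {0..s} u \<le> x0 + s *\<^sub>R b"
  shows "sclp_feasible A b x0 T u"
proof -
  have "u integrable_on {0..s}" if "s \<in> {0..T}" for s
    using assms(1) that by (auto elim: integrable_on_subinterval)
  then show ?thesis using assms by (simp add: sclp_feasible_def integral_matrix_vector_mult)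
qed

text \<open>
  An impulse at time 0 gains nothing over integrable controls.  Released at a constant rate during
  \<open>[0,e]\<close>, it changes the objective by a term of order \<open>e\<close>.  The state remains nonnegative, because on
  \<open>[0,e]\<close> it interpolates between \<open>x0\<close> and the state at time \<open>e\<close>; here \<open>v\<close> has to be constant near 0.
\<close>

lemma sclp_impulse_bound:
  fixes A :: "real ^ 'j ^ 'k"
  assumes x0: "0 \<le> x0" and d: "0 \<le> d"
    and v: "sclp_feasible A b (x0 - A *v d) T v"
    and e0: "0 < e0" "e0 \<le> T" and w: "\<And>s. s \<in> {0<..<e0} \<Longrightarrow> v s = w"
    and V: "\<And>u. sclp_feasible A b x0 T u \<Longrightarrow> sclp_objective c qN T u \<le> V"
  shows "(- qN + T *\<^sub>R c) \<bullet> d + sclp_objective c qN T v \<le> V"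
proof -
  note vD = sclp_feasibleD[OF v]
  have bound: "(- qN + (T - (0 + e) / 2) *\<^sub>R c) \<bullet> d + sclp_objective c qN T v \<le> V" if e: "0 < e" "e < e0" for e
  proof -
    \<comment> \<open>The rate that releases the mass \<open>d\<close> during \<open>[0,e]\<close>.\<close>
    define k where "k s = (if s \<le> e then (1 / e) *\<^sub>R d else 0)" for s :: real
    have k1: "(k has_integral (s / e) *\<^sub>R d) {0..s}" if "0 \<le> s" "s \<le> e" for s
      using constant_interior_has_integral[of 0 s k "(1 / e) *\<^sub>R d"] that by (simp add: k_def)
    have k2: "(k has_integral d) {0..s}" if "e \<le> s" for s
    proof -
      have "(k has_integral (s - e) *\<^sub>R 0) {e..s}"
        using that by (intro constant_interior_has_integral) (auto simp: k_def)
      then show ?thesis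
        using has_integral_combine[of 0 e s k "(e / e) *\<^sub>R d" 0] k1[of e] e that by simp
    qed
    have kT: "k integrable_on {0..T}" using k2[of T] e e0 by (auto simp: integrable_on_def)
    define u where "u s = v s + k s" for s
    have Aw: "e *\<^sub>R (A *v w) \<le> x0 - A *v d + e *\<^sub>R b"
    proof -
      have "(v has_integral (e - 0) *\<^sub>R w) {0..e}"
        using e w by (intro constant_interior_has_integral) auto
      then show ?thesis using vD(5)[of e] e e0 by (simp add: integral_unique matrix_vector_mult_scaleR)
    qed
    have "sclp_feasible A b x0 T u"
    proof (rule sclp_feasibleI)
      show "u integrable_on {0..T}" unfolding u_def by (intro integrable_add vD kT)
      show "0 \<le> u s" if "s \<in> {0..T}" for s
      proof -
        have "0 \<le> k s" using d e by (simp add: k_def scaleR_nonneg_nonneg)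
        then show ?thesis using vD(4)[OF that] by (simp add: u_def)
      qed
      show "A *v integral {0..s} u \<le> x0 + s *\<^sub>R b" if s: "s \<in> {0..T}" for s
      proof (cases "s \<le> e")
        case False
        have "integral {0..s} u = integral {0..s} v + d"
          unfolding u_def using vD(3)[OF s] k2[of s] False
          by (subst integral_add) (auto simp: integral_unique has_integral_integrable)
        then have "A *v integral {0..s} u = A *v integral {0..s} v + A *v d"
          by (simp add: matrix_vector_right_distrib)
        also have "\<dots> \<le> (x0 - A *v d + s *\<^sub>R b) + A *v d" using vD(5)[OF s] by (rule add_right_mono)
        finally show ?thesis by simp
      next
        case True
        have "(v has_integral (s - 0) *\<^sub>R w) {0..s}"
          using s e True w by (intro constant_interior_has_integral) auto
        then have "(u has_integral s *\<^sub>R w + (s / e) *\<^sub>R d) {0..s}"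
          unfolding u_def using k1[of s] s True by (intro has_integral_add) auto
        then have *: "A *v integral {0..s} u = s *\<^sub>R (A *v w) + (s / e) *\<^sub>R (A *v d)"
          by (simp add: integral_unique matrix_vector_mult_scaleR matrix_vector_right_distrib)
        show ?thesis
          unfolding less_eq_vec_def
        proof
          fix i
          have "(A *v integral {0..s} u) $ i = (s / e) * (e * (A *v w) $ i + (A *v d) $ i)"
            using e unfolding * by (simp add: field_simps)
          also have "\<dots> \<le> (s / e) * (x0 $ i + e * b $ i)"
          proof (rule mult_left_mono)
            show "e * (A *v w) $ i + (A *v d) $ i \<le> x0 $ i + e * b $ i"
              using Aw[unfolded less_eq_vec_def, rule_format, of i] by simp
          qed (use s e in simp)
          also have "\<dots> = (s / e) * x0 $ i + s * b $ i" using e by (simp add: field_simps)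
          also have "(s / e) * x0 $ i \<le> 1 * x0 $ i"
            using x0 e True by (intro mult_right_mono) (auto simp: less_eq_vec_def)
          finally show "(A *v integral {0..s} u) $ i \<le> (x0 + s *\<^sub>R b) $ i" by simp
        qed
      qed
    qed
    then have "sclp_objective c qN T u \<le> V" by (rule V)
    moreover have "sclp_objective c qN T u = sclp_objective c qN T v + (- qN + (T - (0 + e) / 2) *\<^sub>R c) \<bullet> d"
    proof -
      have 1: "((\<lambda>s. (- qN + (T - s) *\<^sub>R c) \<bullet> k s) has_integral (e - 0) * ((- qN + (T - (0 + e) / 2) *\<^sub>R c) \<bullet> ((1 / e) *\<^sub>R d))) {0..e}"
        using e by (intro affine_inner_interior_has_integral) (auto simp: k_def)
      have 2: "((\<lambda>s. (- qN + (T - s) *\<^sub>R c) \<bullet> k s) has_integral (T - e) * ((- qN + (T - (e + T) / 2) *\<^sub>R c) \<bullet> 0)) {e..T}"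
        using e e0 by (intro affine_inner_interior_has_integral) (auto simp: k_def)
      have 3: "((\<lambda>s. (- qN + (T - s) *\<^sub>R c) \<bullet> k s) has_integral (- qN + (T - (0 + e) / 2) *\<^sub>R c) \<bullet> d) {0..T}"
        using has_integral_combine[OF _ _ 1 2] e e0 by simp
      have 4: "(\<lambda>s. (- qN + (T - s) *\<^sub>R c) \<bullet> v s) integrable_on {0..T}"
        by (rule continuous_inner_integrable[OF vD(2)]) (intro continuous_intros)
      show ?thesis
        unfolding sclp_objective_def u_def inner_add_right
        using 3 4 by (subst integral_add) (auto simp: integral_unique has_integral_integrable)
    qed
    ultimately show ?thesis by simp
  qed
  show ?thesis
  proof (rule tendsto_upperbound)
    show "((\<lambda>e. (- qN + (T - (0 + e) / 2) *\<^sub>R c) \<bullet> d + sclp_objective c qN T v) \<longlongrightarrow>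
      (- qN + T *\<^sub>R c) \<bullet> d + sclp_objective c qN T v) (at_right 0)"
      by (auto intro!: tendsto_eq_intros)
    show "\<forall>\<^sub>F e in at_right 0. (- qN + (T - (0 + e) / 2) *\<^sub>R c) \<bullet> d + sclp_objective c qN T v \<le> V"
      using e0 bound by (auto simp: eventually_at_right[OF e0(1)] intro!: exI[of _ e0])
  qed simp
qed

text \<open>
  Between two nodes both sides of the state constraint are affine, so it suffices to check the nodes.
\<close>

lemma step_sclp_feasible:
  fixes A :: "real ^ 'j ^ 'k"
  assumes t: "time_partition T N t"
    and u: "steps N t u un"
    and u_pos: "\<And>s. 0 \<le> u s"
    and x0: "0 \<le> x0"
    and nodes: "\<And>n. n \<in> {1..N} \<Longrightarrow> A *v (\<Sum>m = 1..n. (t m - t (m - 1)) *\<^sub>R un m) \<le> x0 + t n *\<^sub>R b"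
  shows "sclp_feasible A b x0 T u"
proof (rule sclp_feasibleI)
  show "u integrable_on {0..T}" by (rule step_integrable[OF t u])
  show "A *v integral {0..s} u \<le> x0 + s *\<^sub>R b" if s: "s \<in> {0..T}" for s
  proof -
    define S where "S n = (\<Sum>m = 1..n. (t m - t (m - 1)) *\<^sub>R un m)" for n
    obtain n where n: "n \<in> {1..N}" "t (n - 1) \<le> s" "s \<le> t n"
      using closed_cell_exists[OF t, of s] s by auto
    define h where "h = t n - t (n - 1)"
    have h: "h > 0" using time_partition_cell(1)[OF t n(1)] by (simp add: h_def)
    define r where "r = (s - t (n - 1)) / h"
    have r: "0 \<le> r" "r \<le> 1" using n h by (auto simp: r_def h_def field_simps)
    have s_eq: "s = t (n - 1) + r * h" using h by (simp add: r_def)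
    have "1 \<le> n" using n by simp
    then have Sn: "S n = S (n - 1) + h *\<^sub>R un n"
      unfolding S_def h_def by (cases n) simp_all
    have "integral {0..s} u = S (n - 1) + (s - t (n - 1)) *\<^sub>R un n"
      using step_has_integral[OF t u n] by (simp add: integral_unique S_def)
    also have "\<dots> = (1 - r) *\<^sub>R S (n - 1) + r *\<^sub>R S n"
      by (simp add: Sn s_eq algebra_simps)
    finally have "A *v integral {0..s} u = (1 - r) *\<^sub>R (A *v S (n - 1)) + r *\<^sub>R (A *v S n)"
      by (simp add: matrix_vector_mult_scaleR matrix_vector_right_distrib)
    moreover have "A *v S (n - 1) \<le> x0 + t (n - 1) *\<^sub>R b"
    proof (cases "n = 1")
      case True
      then show ?thesis using x0 t by (simp add: S_def time_partition_def)
    next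
      case False
      then have "n - 1 \<in> {1..N}" using n(1) by auto
      from nodes[OF this] show ?thesis unfolding S_def .
    qed
    then have "(1 - r) *\<^sub>R (A *v S (n - 1)) \<le> (1 - r) *\<^sub>R (x0 + t (n - 1) *\<^sub>R b)"
      using r by (intro scaleR_left_mono) auto
    moreover have "r *\<^sub>R (A *v S n) \<le> r *\<^sub>R (x0 + t n *\<^sub>R b)"
      using nodes[OF n(1)] r unfolding S_def by (intro scaleR_left_mono) auto
    moreover have "(1 - r) *\<^sub>R (x0 + t (n - 1) *\<^sub>R b) + r *\<^sub>R (x0 + t n *\<^sub>R b) = x0 + s *\<^sub>R b"
      by (simp add: s_eq h_def algebra_simps)
    ultimately show ?thesis by (metis add_mono)
  qed
qed (rule u_pos)

lemma step_sclp_objective: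
  assumes t: "time_partition T N t"
    and u: "steps N t u un"
  shows "sclp_objective c qN T u =
    (\<Sum>n = 1..N. (t n - t (n - 1)) * ((- qN + (T - (t (n - 1) + t n) / 2) *\<^sub>R c) \<bullet> un n))"
proof -
  have "((\<lambda>s. (- qN + (T - s) *\<^sub>R c) \<bullet> u s) has_integral
    (\<Sum>n = 1..N. (t n - t (n - 1)) * ((- qN + (T - (t (n - 1) + t n) / 2) *\<^sub>R c) \<bullet> un n))) {0..t N}"
  proof (rule has_integral_over_cells[OF t _ order_refl])
    fix n assume "n \<in> {1..N}"
    then show "((\<lambda>s. (- qN + (T - s) *\<^sub>R c) \<bullet> u s) has_integral
      (t n - t (n - 1)) * ((- qN + (T - (t (n - 1) + t n) / 2) *\<^sub>R c) \<bullet> un n)) {t (n - 1)..t n}"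
      using u time_partition_cell(1)[OF t, of n] by (intro affine_inner_interior_has_integral) auto
  qed
  then show ?thesis using t by (simp add: sclp_objective_def time_partition_def integral_unique)
qed

text \<open>
  The form in which step controls are used: \<open>d n\<close> is the mass spread evenly over cell \<open>n\<close>, and \<open>d 0\<close>
  is an impulse at time 0.  As the objective rate is affine in time, a mass earns the rate at the
  midpoint of its cell.
\<close>

lemma sclp_increments_bound:
  fixes A :: "real ^ 'j ^ 'k"
  assumes t: "time_partition T N t" and x0: "0 \<le> x0"
    and d: "\<And>n. n \<le> N \<Longrightarrow> 0 \<le> d n"
    and nodes: "\<And>n. n \<le> N \<Longrightarrow> A *v (\<Sum>m = 0..n. d m) \<le> x0 + t n *\<^sub>R b"
    and V: "\<And>u. sclp_feasible A b x0 T u \<Longrightarrow> sclp_objective c qN T u \<le> V"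
  shows "(- qN + T *\<^sub>R c) \<bullet> d 0 +
    (\<Sum>n = 1..N. (- qN + (T - (t (n - 1) + t n) / 2) *\<^sub>R c) \<bullet> d n) \<le> V"
proof -
  define un where "un n = (1 / (t n - t (n - 1))) *\<^sub>R d n" for n
  have un: "(t n - t (n - 1)) *\<^sub>R un n = d n" "0 \<le> un n" if "n \<in> {1..N}" for n
    using time_partition_cell(1)[OF t that] d[of n] that by (auto simp: un_def scaleR_nonneg_nonneg)
  obtain u where u: "steps N t u un"
    "\<forall>s. u s = 0 \<or> (\<exists>n\<in>{1..N}. u s = un n)"
    using step_function_exists[OF t, where un = un] by (elim exE conjE)
  have u_pos: "0 \<le> u s" for s using u(2) un(2) by (metis order_refl)
  have N: "1 \<in> {1..N}" "t 0 = 0" using t by (auto simp: time_partition_def)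
  have feas: "sclp_feasible A b (x0 - A *v d 0) T u"
  proof (rule step_sclp_feasible[OF t u(1) u_pos])
    show "0 \<le> x0 - A *v d 0" using nodes[of 0] N by simp
    fix n assume n: "n \<in> {1..N}"
    have "(\<Sum>m = 1..n. (t m - t (m - 1)) *\<^sub>R un m) = (\<Sum>m = 1..n. d m)"
      using n by (intro sum.cong un(1)) auto
    moreover have "(\<Sum>m = 0..n. d m) = d 0 + (\<Sum>m = 1..n. d m)"
      by (simp add: sum.atLeast_Suc_atMost)
    ultimately show "A *v (\<Sum>m = 1..n. (t m - t (m - 1)) *\<^sub>R un m) \<le> x0 - A *v d 0 + t n *\<^sub>R b"
      using nodes[of n] n by (simp add: matrix_vector_right_distrib algebra_simps)
  qed
  have "(- qN + T *\<^sub>R c) \<bullet> d 0 + sclp_objective c qN T u \<le> V"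
  proof (rule sclp_impulse_bound[OF x0 _ feas _ _ _ V])
    show "0 < t 1" "t 1 \<le> T" using time_partition_cell[OF t N(1)] N(2) by auto
    show "u s = un 1" if "s \<in> {0<..<t 1}" for s using u(1) N that by auto
  qed (use d in auto)
  moreover have "sclp_objective c qN T u = (\<Sum>n = 1..N. (- qN + (T - (t (n - 1) + t n) / 2) *\<^sub>R c) \<bullet> d n)"
    unfolding step_sclp_objective[OF t u(1)]
  proof (rule sum.cong)
    fix n assume "n \<in> {1..N}"
    from un(1)[OF this] show "(t n - t (n - 1)) * ((- qN + (T - (t (n - 1) + t n) / 2) *\<^sub>R c) \<bullet> un n) =
      (- qN + (T - (t (n - 1) + t n) / 2) *\<^sub>R c) \<bullet> d n"
      by (metis inner_scaleR_right)
  qed simp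
  ultimately show ?thesis by simp
qed

section \<open>Strong duality for the internal problem by discretization\<close>

lemma transpose_mult_component: "(transpose A *v y) $ j = (\<Sum>k\<in>UNIV. A $ k $ j * y $ k)"
  by (simp add: matrix_vector_mult_def transpose_def del: transpose_matrix_vector)

text \<open>
  The point \<open>z = 0\<close> satisfies the three constraints, so Hoffman's bound applies.  This will split the
  first mass of the dual path into an impulse and a remainder of order \<open>e\<close>.
\<close>

lemma hoffman_shrink:
  fixes A :: "real ^ 'j ^ 'k"
  shows "\<exists>C\<ge>0. \<forall>y q e. 0 \<le> y \<and> 0 \<le> q \<and> 0 \<le> e \<and> (\<forall>j. - q $ j - e \<le> (transpose A *v y) $ j) \<longrightarrow>
    (\<exists>z. 0 \<le> z \<and> z \<le> y \<and> - q \<le> transpose A *v z \<and> norm (y - z) \<le> C * e)"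
proof -
  define a :: "'k + 'k + 'j \<Rightarrow> real ^ 'k" where
    "a i = (case i of Inl k \<Rightarrow> - axis k 1 | Inr (Inl k) \<Rightarrow> axis k 1 | Inr (Inr j) \<Rightarrow> - (\<chi> k. A $ k $ j))" for i
  define h :: "real ^ 'k \<Rightarrow> real ^ 'j \<Rightarrow> 'k + 'k + 'j \<Rightarrow> real" where
    "h y q i = (case i of Inl k \<Rightarrow> 0 | Inr (Inl k) \<Rightarrow> y $ k | Inr (Inr j) \<Rightarrow> q $ j)" for y q i
  have feas: "(\<forall>i. a i \<bullet> z \<le> h y q i) \<longleftrightarrow> 0 \<le> z \<and> z \<le> y \<and> - q \<le> transpose A *v z" for y q z
  proof -
    have "(\<chi> k. A $ k $ j) \<bullet> z = (transpose A *v z) $ j" for j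
      unfolding transpose_mult_component by (simp add: inner_vec_def)
    then show ?thesis
      by (auto simp: a_def h_def less_eq_vec_def inner_axis' minus_le_iff split_sum_all simp del: transpose_matrix_vector)
  qed
  obtain C where C: "C \<ge> 0" "\<And>h y. \<exists>z. \<forall>i. a i \<bullet> z \<le> h i \<Longrightarrow>
    (\<exists>z. (\<forall>i. a i \<bullet> z \<le> h i) \<and> norm (y - z) \<le> C * (\<Sum>i\<in>UNIV. max 0 (a i \<bullet> y - h i)))"
    using hoffman[of a] by blast
  show ?thesis
  proof (intro exI[of _ "C * real CARD('k + 'k + 'j)"] conjI allI impI)
    fix y q e assume *: "0 \<le> y \<and> 0 \<le> q \<and> 0 \<le> e \<and> (\<forall>j. - q $ j - e \<le> (transpose A *v y) $ j)"
    have "\<exists>z. \<forall>i. a i \<bullet> z \<le> h y q i"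
      unfolding feas using * by (intro exI[of _ 0]) simp
    from C(2)[OF this, of y] obtain z where
      z: "0 \<le> z \<and> z \<le> y \<and> - q \<le> transpose A *v z"
      "norm (y - z) \<le> C * (\<Sum>i\<in>UNIV. max 0 (a i \<bullet> y - h y q i))"
      unfolding feas by blast
    have "max 0 (a i \<bullet> y - h y q i) \<le> e" for i
    proof -
      have "(\<chi> k. A $ k $ j) \<bullet> y = (transpose A *v y) $ j" for j
        unfolding transpose_mult_component by (simp add: inner_vec_def)
      moreover have "- q $ j - e \<le> (transpose A *v y) $ j" for j using * by blast
      ultimately have "- ((\<chi> k. A $ k $ j) \<bullet> y) - q $ j \<le> e" for j
        by (metis diff_le_eq minus_diff_eq minus_diff_minus minus_le_iff diff_minus_eq_add add.commute uminus_add_conv_diff)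
      moreover have "- (y $ k) \<le> e" for k
      proof -
        have "0 \<le> y $ k" using * by (simp add: less_eq_vec_def)
        then show ?thesis using * by linarith
      qed
      ultimately show ?thesis
        using * by (auto simp: a_def h_def inner_axis' split: sum.splits)
    qed
    then have "(\<Sum>i\<in>UNIV. max 0 (a i \<bullet> y - h y q i)) \<le> real CARD('k + 'k + 'j) * e"
      using sum_bounded_above[of UNIV "\<lambda>i. max 0 (a i \<bullet> y - h y q i)" e] by simp
    then have "C * (\<Sum>i\<in>UNIV. max 0 (a i \<bullet> y - h y q i)) \<le> C * (real CARD('k + 'k + 'j) * e)"
      using C(1) by (rule mult_left_mono)
    with z show "\<exists>z. 0 \<le> z \<and> z \<le> y \<and> - q \<le> transpose A *v z \<and> norm (y - z) \<le> C * real CARD('k + 'k + 'j) * e"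
      by (intro exI[of _ z]) (auto simp: mult.assoc simp del: transpose_matrix_vector)
  qed (use C(1) in simp)
qed

text \<open>
  Hoffman's bound at the origin, which violates \<open>r \<le> transpose A *v z\<close> by at most \<open>e\<close> in each
  component.  This will replace the last mass of the dual path by one of order \<open>e\<close>.
\<close>

lemma hoffman_correct:
  fixes A :: "real ^ 'j ^ 'k"
  shows "\<exists>C\<ge>0. \<forall>r y e. 0 \<le> y \<and> r \<le> transpose A *v y \<and> 0 \<le> e \<and> (\<forall>j. r $ j \<le> e) \<longrightarrow>
    (\<exists>z. 0 \<le> z \<and> r \<le> transpose A *v z \<and> norm z \<le> C * e)"
proof -
  define a :: "'k + 'j \<Rightarrow> real ^ 'k" where
    "a i = (case i of Inl k \<Rightarrow> - axis k 1 | Inr j \<Rightarrow> - (\<chi> k. A $ k $ j))" for i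
  define h :: "real ^ 'j \<Rightarrow> 'k + 'j \<Rightarrow> real" where
    "h r i = (case i of Inl k \<Rightarrow> 0 | Inr j \<Rightarrow> - r $ j)" for r i
  have feas: "(\<forall>i. a i \<bullet> z \<le> h r i) \<longleftrightarrow> 0 \<le> z \<and> r \<le> transpose A *v z" for r z
  proof -
    have "(\<chi> k. A $ k $ j) \<bullet> z = (transpose A *v z) $ j" for j
      unfolding transpose_mult_component by (simp add: inner_vec_def)
    then show ?thesis
      by (auto simp: a_def h_def less_eq_vec_def inner_axis' split_sum_all simp del: transpose_matrix_vector)
  qed
  obtain C where C: "C \<ge> 0" "\<And>h y. \<exists>z. \<forall>i. a i \<bullet> z \<le> h i \<Longrightarrow>
    (\<exists>z. (\<forall>i. a i \<bullet> z \<le> h i) \<and> norm (y - z) \<le> C * (\<Sum>i\<in>UNIV. max 0 (a i \<bullet> y - h i)))"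
    using hoffman[of a] by blast
  show ?thesis
  proof (intro exI[of _ "C * real CARD('k + 'j)"] conjI allI impI)
    fix r y e assume *: "0 \<le> y \<and> r \<le> transpose A *v y \<and> 0 \<le> e \<and> (\<forall>j. r $ j \<le> e)"
    have "\<exists>z. \<forall>i. a i \<bullet> z \<le> h r i"
      unfolding feas using * by blast
    from C(2)[OF this, of 0] obtain z where
      z: "0 \<le> z \<and> r \<le> transpose A *v z"
      "norm (0 - z) \<le> C * (\<Sum>i\<in>UNIV. max 0 (a i \<bullet> 0 - h r i))"
      unfolding feas by blast
    have "max 0 (a i \<bullet> 0 - h r i) \<le> e" for i
      using * by (auto simp: h_def split: sum.splits)
    then have "(\<Sum>i\<in>UNIV. max 0 (a i \<bullet> 0 - h r i)) \<le> real CARD('k + 'j) * e"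
      using sum_bounded_above[of UNIV "\<lambda>i. max 0 (a i \<bullet> 0 - h r i)" e] by simp
    then have "C * (\<Sum>i\<in>UNIV. max 0 (a i \<bullet> 0 - h r i)) \<le> C * (real CARD('k + 'j) * e)"
      using C(1) by (rule mult_left_mono)
    with z show "\<exists>z. 0 \<le> z \<and> r \<le> transpose A *v z \<and> norm z \<le> C * real CARD('k + 'j) * e"
      by (intro exI[of _ z]) (auto simp: mult.assoc simp del: transpose_matrix_vector)
  qed (use C(1) in simp)
qed

text \<open>
  Linear programming duality for step controls with an impulse at time 0.  The multiplier \<open>y n\<close> belongs
  to the state constraint at node \<open>n\<close>.  The mass \<open>d m\<close> enters the constraints at the nodes \<open>n \<ge> m\<close>,
  which gives the sums, and its objective coefficient belongs to the midpoint \<open>\<sigma> m\<close> of its cell.  The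
  impulse contributes the inequality for \<open>m = 0\<close>: it shows that the dual path which reaches the last
  midpoint can be continued to the end.
\<close>

lemma sclp_discrete_multipliers:
  fixes A :: "real ^ 'j ^ 'k"
  assumes t: "time_partition T N t" and x0: "0 \<le> x0"
    and u: "sclp_optimal A b c x0 qN T u"
  defines "\<sigma> \<equiv> (\<lambda>m. if m = 0 then 0 else (t (m - 1) + t m) / 2)"
  shows "\<exists>y. (\<forall>n\<le>N. 0 \<le> y n) \<and>
    (\<forall>m\<le>N. - qN + (T - \<sigma> m) *\<^sub>R c \<le> transpose A *v (\<Sum>n = m..N. y n)) \<and>
    (\<Sum>n = 0..N. (x0 + t n *\<^sub>R b) \<bullet> y n) \<le> sclp_objective c qN T u"
proof -
  let ?V = "sclp_objective c qN T u"
  have feas: "sclp_feasible A b x0 T u" and opt: "\<And>v. sclp_feasible A b x0 T v \<Longrightarrow> sclp_objective c qN T v \<le> ?V"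
    using u by (auto simp: sclp_optimal_def)
  \<comment> \<open>State constraint \<open>k\<close> at node \<open>n\<close> has index \<open>Inl (n, k)\<close>; the sign of \<open>d n $ j\<close> has index \<open>Inr (n, j)\<close>.\<close>
  define f :: "nat \<times> 'k + nat \<times> 'j \<Rightarrow> (nat \<Rightarrow> real ^ 'j) \<Rightarrow> real" where
    "f i d = (case i of Inl (n, k) \<Rightarrow> (A *v (\<Sum>m = 0..n. d m)) $ k | Inr (n, j) \<Rightarrow> - d n $ j)" for i d
  define h :: "nat \<times> 'k + nat \<times> 'j \<Rightarrow> real" where
    "h i = (case i of Inl (n, k) \<Rightarrow> (x0 + t n *\<^sub>R b) $ k | Inr _ \<Rightarrow> 0)" for i
  define g where "g d = (\<Sum>m = 0..N. (- qN + (T - \<sigma> m) *\<^sub>R c) \<bullet> d m)" for d :: "nat \<Rightarrow> real ^ 'j"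
  define comb where "comb d s e = (\<lambda>n. d n - s *\<^sub>R e n)" for d e :: "nat \<Rightarrow> real ^ 'j" and s :: real
  define I where "I = ({0..N} \<times> (UNIV :: 'k set)) <+> ({0..N} \<times> (UNIV :: 'j set))"
  have fI: "(\<forall>i\<in>I. f i d \<le> h i) \<longleftrightarrow>
    (\<forall>n\<le>N. A *v (\<Sum>m = 0..n. d m) \<le> x0 + t n *\<^sub>R b) \<and> (\<forall>n\<le>N. 0 \<le> d n)" for d
    unfolding I_def f_def h_def less_eq_vec_def by (simp add: Plus_def ball_Un) auto
  \<comment> \<open>The increments of \<open>u\<close> show that the linear program is feasible.\<close>
  define W where "W n = integral {0..t n} u" for n
  define z where "z n = (if n = 0 then 0 else W n - W (n - 1))" for n
  have "\<exists>l. (\<forall>i\<in>I. 0 \<le> l i) \<and> (\<forall>d. g d = (\<Sum>i\<in>I. l i * f i d)) \<and> (\<Sum>i\<in>I. l i * h i) \<le> ?V"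
  proof (rule lp_duality[where comb = comb])
    show "finite I" by (simp add: I_def)
    show "f i (comb x s y) = f i x - s * f i y" for i x s y
      by (auto simp: f_def comb_def sum_subtractf scaleR_sum_right[symmetric] matrix_vector_mult_diff_distrib
        matrix_vector_mult_scaleR split: sum.splits)
    show "g (comb x s y) = g x - s * g y" for x s y
      by (simp add: g_def comb_def inner_diff_right sum_subtractf sum_distrib_left)
    show "g d \<le> ?V" if d: "\<And>i. i \<in> I \<Longrightarrow> f i d \<le> h i" for d
    proof -
      have d': "\<forall>n\<le>N. A *v (\<Sum>m = 0..n. d m) \<le> x0 + t n *\<^sub>R b" "\<forall>n\<le>N. 0 \<le> d n"
        using d fI[of d] by blast+
      have "(- qN + T *\<^sub>R c) \<bullet> d 0 + (\<Sum>n = 1..N. (- qN + (T - (t (n - 1) + t n) / 2) *\<^sub>R c) \<bullet> d n) \<le> ?V"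
        by (rule sclp_increments_bound[OF t x0 _ _ opt]) (use d' in auto)
      moreover have "g d = (- qN + T *\<^sub>R c) \<bullet> d 0 + (\<Sum>n = 1..N. (- qN + (T - (t (n - 1) + t n) / 2) *\<^sub>R c) \<bullet> d n)"
        unfolding g_def by (subst sum.atLeast_Suc_atMost) (auto simp: \<sigma>_def intro!: sum.cong)
      ultimately show ?thesis by simp
    qed
    have zsum: "(\<Sum>m = 0..n. z m) = W n" for n
    proof (induction n)
      case 0
      show ?case using t by (simp add: z_def W_def time_partition_def)
    qed (simp add: z_def)
    have znn: "0 \<le> z n" if n: "n \<le> N" for n
    proof (cases "n = 0")
      case False
      then have n1: "n \<in> {1..N}" using n by auto
      note cell = time_partition_cell[OF t n1]
      have un: "u integrable_on {0..t n}" using sclp_feasibleD(3)[OF feas, of "t n"] cell by auto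
      then have ui: "u integrable_on {t (n - 1)..t n}" using cell by (auto elim: integrable_on_subinterval)
      have "z n = integral {t (n - 1)..t n} u"
        using Henstock_Kurzweil_Integration.integral_combine[of 0 "t (n - 1)" "t n" u] un cell False by (simp add: z_def W_def algebra_simps)
      moreover have "0 \<le> integral {t (n - 1)..t n} u"
        using sclp_feasibleD(4)[OF feas] cell by (intro integral_nonneg_vec[OF ui]) auto
      ultimately show ?thesis by simp
    qed (simp add: z_def)
    have "\<forall>i\<in>I. f i z \<le> h i"
      unfolding fI zsum using znn sclp_feasibleD(5)[OF feas] time_partition_range[OF t] by (auto simp: W_def)
    then show "f i z \<le> h i" if "i \<in> I" for i using that by blast
  qed
  then obtain l where l: "\<And>i. i \<in> I \<Longrightarrow> 0 \<le> l i" "\<And>d. g d = (\<Sum>i\<in>I. l i * f i d)" "(\<Sum>i\<in>I. l i * h i) \<le> ?V"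
    by blast
  have I_sum: "(\<Sum>i\<in>I. F i) = (\<Sum>n = 0..N. \<Sum>k\<in>UNIV. F (Inl (n, k))) + (\<Sum>n = 0..N. \<Sum>j\<in>UNIV. F (Inr (n, j)))"
    for F :: "_ \<Rightarrow> real"
    unfolding I_def by (subst sum.Plus) (simp_all add: sum.cartesian_product)
  define y :: "nat \<Rightarrow> real ^ 'k" where "y n = (\<chi> k. l (Inl (n, k)))" for n
  have lI: "0 \<le> l (Inl (n, k))" "0 \<le> l (Inr (n, j))" if "n \<le> N" for n k j
    using that by (auto intro!: l(1) simp: I_def)
  show ?thesis
  proof (intro exI[of _ y] conjI allI impI)
    show "0 \<le> y n" if "n \<le> N" for n using lI[OF that] by (simp add: y_def less_eq_vec_def)
    show "(\<Sum>n = 0..N. (x0 + t n *\<^sub>R b) \<bullet> y n) \<le> ?V"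
      using l(3) unfolding I_sum by (simp add: h_def y_def inner_vec_def mult.commute)
    fix m assume m: "m \<le> N"
    show "- qN + (T - \<sigma> m) *\<^sub>R c \<le> transpose A *v (\<Sum>n = m..N. y n)"
      unfolding less_eq_vec_def
    proof
      fix j
      \<comment> \<open>A unit mass of control \<open>j\<close> in cell \<open>m\<close> alone.\<close>
      define d where "d n = (if n = m then axis j 1 else 0 :: real ^ 'j)" for n
      have ds: "(\<Sum>i = 0..n. d i) = (if m \<le> n then axis j 1 else 0)" for n
        by (simp add: d_def)
      have "(- qN + (T - \<sigma> m) *\<^sub>R c) $ j = g d"
      proof -
        have "g d = (\<Sum>i = 0..N. if i = m then (- qN + (T - \<sigma> m) *\<^sub>R c) \<bullet> axis j 1 else 0)"
          unfolding g_def d_def by (intro sum.cong) auto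
        then show ?thesis using m by (simp add: inner_axis)
      qed
      also have "\<dots> \<le> (\<Sum>n = 0..N. \<Sum>k\<in>UNIV. l (Inl (n, k)) * f (Inl (n, k)) d)"
      proof -
        have "(\<Sum>n = 0..N. \<Sum>i\<in>UNIV. l (Inr (n, i)) * f (Inr (n, i)) d) \<le> 0"
          using lI by (intro sum_nonpos mult_nonneg_nonpos) (auto simp: f_def d_def axis_def)
        then show ?thesis unfolding l(2) I_sum by simp
      qed
      also have "\<dots> = (\<Sum>n = 0..N. if m \<le> n then (\<Sum>k\<in>UNIV. A $ k $ j * y n $ k) else 0)"
        by (intro sum.cong) (auto simp: f_def ds y_def matrix_vector_mul_component inner_axis mult.commute)
      also have "\<dots> = (\<Sum>n = m..N. \<Sum>k\<in>UNIV. A $ k $ j * y n $ k)"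
        by (simp add: sum.If_cases) (intro sum.cong, auto)
      also have "\<dots> = (transpose A *v (\<Sum>n = m..N. y n)) $ j"
        unfolding transpose_mult_component by (subst sum.swap) (simp add: sum_distrib_left)
      finally show "(- qN + (T - \<sigma> m) *\<^sub>R c) $ j \<le> (transpose A *v (\<Sum>n = m..N. y n)) $ j" .
    qed
  qed
qed

lemma time_partition_uniform:
  assumes "0 < T" "1 \<le> M"
  shows "time_partition T M (\<lambda>n. real n * (T / real M))"
proof -
  have "real (n - 1) * (T / real M) < real n * (T / real M)" if "n \<in> {1..M}" for n
    using assms that by (intro mult_strict_right_mono) auto
  then show ?thesis using assms by (auto simp: time_partition_def)
qed

text \<open>
  With \<open>Y m\<close> the sum of the multipliers from \<open>m\<close> on, the dual path jumps to \<open>P\<close> at time 0, is linear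
  between the midpoints \<open>s l\<close> of the reversed cells, where it takes the values \<open>Y (M + 1 - l)\<close>, and ends
  in \<open>Y 1 + R\<close> at time \<open>T\<close>.  The mass \<open>y n\<close> with \<open>0 < n < M\<close> is spread evenly around the reversed time
  of node \<open>n\<close>, where its cost equals that in the linear program.  The masses \<open>y M - P\<close> and \<open>R\<close> are
  spread over half cells and miss their cost by terms of order \<open>\<delta>\<close> times their norms, which themselves
  are of order \<open>\<delta>\<close> by Hoffman's bound.
\<close>

lemma sclp_duality_gap_le:
  fixes A :: "real ^ 'j ^ 'k"
  assumes T: "0 < T" and x0: "0 \<le> x0" and qN: "0 \<le> qN"
    and u: "sclp_optimal A b c x0 qN T u" and p: "sclp_dual_optimal A b c x0 qN T p"
  shows "\<exists>K. \<forall>M\<ge>1. sclp_dual_objective b x0 T p \<le> sclp_objective c qN T u + K / real M"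
proof -
  let ?V = "sclp_objective c qN T u" and ?D = "sclp_dual_objective b x0 T p"
  obtain C1 where C1: "C1 \<ge> 0" "\<And>y q e. 0 \<le> y \<Longrightarrow> 0 \<le> q \<Longrightarrow> 0 \<le> e \<Longrightarrow> (\<And>j. - q $ j - e \<le> (transpose A *v y) $ j) \<Longrightarrow>
    (\<exists>z. 0 \<le> z \<and> z \<le> y \<and> - q \<le> transpose A *v z \<and> norm (y - z) \<le> C1 * e)"
    using hoffman_shrink[of A] by blast
  obtain C2 where C2: "C2 \<ge> 0" "\<And>r y e. 0 \<le> y \<Longrightarrow> r \<le> transpose A *v y \<Longrightarrow> 0 \<le> e \<Longrightarrow> (\<And>j. r $ j \<le> e) \<Longrightarrow>
    (\<exists>z. 0 \<le> z \<and> r \<le> transpose A *v z \<and> norm z \<le> C2 * e)"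
    using hoffman_correct[of A] by blast
  define K where "K = norm b * (C1 * norm c) * T\<^sup>2 + (norm x0 + T * norm b) * (C2 * norm c) * T"
  have "?D \<le> ?V + K / real M" if M: "M \<ge> 1" for M
  proof -
    define \<delta> where "\<delta> = T / real M"
    have \<delta>: "0 < \<delta>" "real M * \<delta> = T" "\<delta> \<le> T"
      using T M by (auto simp: \<delta>_def field_simps)
    define t where "t n = real n * \<delta>" for n
    have t: "time_partition T M t"
      using time_partition_uniform[OF T M] by (simp add: t_def[abs_def] \<delta>_def)
    obtain y where y: "\<And>n. n \<le> M \<Longrightarrow> 0 \<le> y n"
      "\<And>m. m \<le> M \<Longrightarrow> - qN + (T - (if m = 0 then 0 else (t (m - 1) + t m) / 2)) *\<^sub>R c \<le> transpose A *v (\<Sum>n = m..M. y n)"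
      "(\<Sum>n = 0..M. (x0 + t n *\<^sub>R b) \<bullet> y n) \<le> ?V"
      using sclp_discrete_multipliers[OF t x0 u] by blast
    define Y where "Y m = (\<Sum>n = m..M. y n)" for m
    have Ym: "- qN + (T - (real m - 1 / 2) * \<delta>) *\<^sub>R c \<le> transpose A *v Y m" if "m \<in> {1..M}" for m
    proof -
      have "(t (m - 1) + t m) / 2 = (real m - 1 / 2) * \<delta>"
        using that by (simp add: t_def field_simps)
      then show ?thesis using y(2)[of m] that by (simp add: Y_def del: transpose_matrix_vector)
    qed
    have Y0: "- qN + T *\<^sub>R c \<le> transpose A *v Y 0"
      using y(2)[of 0] by (simp add: Y_def del: transpose_matrix_vector)
    have Y_step: "Y m = y m + Y (Suc m)" if "m \<le> M" for m
      using that by (simp add: Y_def sum.atLeast_Suc_atMost)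
    \<comment> \<open>The most by which a dual constraint can change over a half cell.\<close>
    define e where "e = (\<delta> / 2) * norm c"
    have e: "0 \<le> e" "(\<delta> / 2) * c $ j \<le> e" "- e \<le> (\<delta> / 2) * c $ j" for j
    proof -
      show "0 \<le> e" using \<delta> by (simp add: e_def)
      have "\<bar>(\<delta> / 2) * c $ j\<bar> \<le> e"
        using \<delta>(1) component_le_norm_cart[of c j] unfolding e_def abs_mult by (intro mult_mono) auto
      then show "(\<delta> / 2) * c $ j \<le> e" "- e \<le> (\<delta> / 2) * c $ j" by (auto simp: abs_le_iff)
    qed
    \<comment> \<open>An impulse at time 0 must satisfy the constraint there; \<open>y M\<close> only satisfies the one at time \<open>\<delta> / 2\<close>.\<close>
    obtain P where P: "0 \<le> P" "P \<le> y M" "- qN \<le> transpose A *v P" "norm (y M - P) \<le> C1 * e"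
    proof -
      have "- qN $ j - e \<le> (transpose A *v y M) $ j" for j
      proof -
        have "Y M = y M" by (simp add: Y_def)
        moreover have "T - (real M - 1 / 2) * \<delta> = \<delta> / 2" using \<delta> by (simp add: algebra_simps)
        moreover have "- qN + (T - (real M - 1 / 2) * \<delta>) *\<^sub>R c \<le> transpose A *v Y M"
          using M by (intro Ym) simp
        ultimately have "- qN + (\<delta> / 2) *\<^sub>R c \<le> transpose A *v y M" by (simp only:)
        then have "(- qN + (\<delta> / 2) *\<^sub>R c) $ j \<le> (transpose A *v y M) $ j" unfolding less_eq_vec_def by blast
        then show ?thesis using e(3)[of j] by (simp del: transpose_matrix_vector)
      qed
      from C1(2)[OF y(1)[OF order_refl] qN e(1) this] that show ?thesis by blast
    qed
    \<comment> \<open>The mass \<open>y 0\<close> would make the constraint at \<open>T\<close> hold, but it may be large; \<open>R\<close> does so and is small.\<close>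
    obtain R where R: "0 \<le> R" "- qN + T *\<^sub>R c - transpose A *v Y 1 \<le> transpose A *v R" "norm R \<le> C2 * e"
    proof -
      have "- qN + T *\<^sub>R c - transpose A *v Y 1 \<le> transpose A *v y 0"
        using Y0 Y_step[of 0] by (simp add: matrix_vector_right_distrib algebra_simps del: transpose_matrix_vector)
      moreover have "(- qN + T *\<^sub>R c - transpose A *v Y 1) $ j \<le> e" for j
      proof -
        have "(- qN + (T - (real 1 - 1 / 2) * \<delta>) *\<^sub>R c) $ j \<le> (transpose A *v Y 1) $ j"
          using Ym[of 1] M unfolding less_eq_vec_def by auto
        then show ?thesis using e(2)[of j] by (simp add: algebra_simps del: transpose_matrix_vector)
      qed
      ultimately show ?thesis using C2(2)[OF y(1)[of 0] _ e(1)] that by blast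
    qed
    \<comment> \<open>Nodes of the dual path: both ends, and the midpoints of the reversed cells.\<close>
    define s where "s l = (if l = 0 then 0 else if l \<le> M then (real l - 1 / 2) * \<delta> else T)" for l :: nat
    have s: "time_partition T (Suc M) s"
    proof -
      have "s (l - 1) < s l" if l: "l \<in> {1..Suc M}" for l
      proof -
        consider "l = 1" | "2 \<le> l" "l \<le> M" | "l = Suc M" using l unfolding atLeastAtMost_iff by linarith
        then show ?thesis
        proof cases
          case 1
          then show ?thesis using \<delta> M by (simp add: s_def)
        next
          case 2
          then have "l - 1 \<le> M" by simp
          with 2 show ?thesis using \<delta> by (simp add: s_def of_nat_diff)
        next
          case 3
          have "(real M - 1 / 2) * \<delta> < real M * \<delta>" using \<delta>(1) by (intro mult_strict_right_mono) auto
          then show ?thesis using 3 \<delta> M by (simp add: s_def)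
        qed
      qed
      then show ?thesis by (auto simp: time_partition_def s_def)
    qed
    define d where "d l = (if l = 0 then P else if l = 1 then y M - P else if l \<le> M then y (M + 1 - l) else R)" for l :: nat
    have cum: "(\<Sum>m = 0..l. d m) = Y (M + 1 - l)" if "1 \<le> l" "l \<le> M" for l
      using that
    proof (induction l)
      case (Suc l)
      show ?case
      proof (cases "l = 0")
        case True
        then show ?thesis by (simp add: d_def Y_def)
      next
        case False
        then have "(\<Sum>m = 0..Suc l. d m) = Y (M + 1 - l) + y (M + 1 - Suc l)"
          using Suc by (simp add: d_def)
        also have "M + 1 - l = Suc (M + 1 - Suc l)" using Suc.prems by simp
        finally show ?thesis using Y_step[of "M + 1 - Suc l"] by (simp add: add.commute)
      qed
    qed simp
    have "(- x0 + T *\<^sub>R - b) \<bullet> d 0 +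
      (\<Sum>n = 1..Suc M. (- x0 + (T - (s (n - 1) + s n) / 2) *\<^sub>R - b) \<bullet> d n) \<le> sclp_objective (- b) x0 T p"
    proof (rule sclp_increments_bound[OF s qN])
      fix n assume n: "n \<le> Suc M"
      show "0 \<le> d n" using y(1) P(1,2) R(1) by (simp add: d_def)
      have "- qN + s n *\<^sub>R c \<le> transpose A *v (\<Sum>m = 0..n. d m)"
      proof -
        consider "n = 0" | "1 \<le> n" "n \<le> M" | "n = Suc M" using n by linarith
        then show ?thesis
        proof cases
          case 1
          then show ?thesis using P(3) by (simp add: s_def d_def)
        next
          case 2
          then have "T - (real (M + 1 - n) - 1 / 2) * \<delta> = s n"
            using \<delta> by (simp add: s_def of_nat_diff algebra_simps)
          moreover have "M + 1 - n \<in> {1..M}" using 2 by auto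
          ultimately show ?thesis using Ym[of "M + 1 - n"] by (simp only: cum[OF 2])
        next
          case 3
          have "(\<Sum>m = 0..Suc M. d m) = Y 1 + R" using cum[of M] M by (simp add: d_def)
          then show ?thesis using 3 R(2)
            by (simp add: s_def matrix_vector_right_distrib algebra_simps del: transpose_matrix_vector)
        qed
      qed
      then show "- transpose A *v (\<Sum>m = 0..n. d m) \<le> qN + s n *\<^sub>R - c"
        using neg_le_iff_le[of "transpose A *v (\<Sum>m = 0..n. d m)" "- qN + s n *\<^sub>R c"]
        by (simp add: matrix_vector_mult_minus del: transpose_matrix_vector)
    qed (use p in \<open>auto simp: sclp_dual_optimal_eq sclp_optimal_def\<close>)
    moreover have "(- x0 + r *\<^sub>R - b) \<bullet> w = - ((x0 + r *\<^sub>R b) \<bullet> w)" for r w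
      by (simp add: inner_diff_left inner_add_left)
    ultimately have D: "?D \<le> (x0 + T *\<^sub>R b) \<bullet> P + (\<Sum>n = 1..Suc M. (x0 + (T - (s (n - 1) + s n) / 2) *\<^sub>R b) \<bullet> d n)"
      by (simp add: sclp_dual_objective_eq sum_negf d_def)
    define F where "F n = (x0 + (T - (s (n - 1) + s n) / 2) *\<^sub>R b) \<bullet> d n" for n
    have F1: "F 1 = (x0 + T *\<^sub>R b) \<bullet> (y M - P) - (\<delta> / 4) * (b \<bullet> (y M - P))"
      using M by (simp add: F_def s_def d_def inner_add_left algebra_simps)
    have FM: "F (Suc M) = x0 \<bullet> R + (\<delta> / 4) * (b \<bullet> R)"
      using M \<delta>(2) by (simp add: F_def s_def d_def inner_add_left field_simps)
    have Fmid: "(\<Sum>n = 2..M. F n) = (\<Sum>n = 1..M - 1. (x0 + t n *\<^sub>R b) \<bullet> y n)"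
    proof (rule sum.reindex_bij_witness[of _ "\<lambda>n. M + 1 - n" "\<lambda>n. M + 1 - n"])
      fix n assume n: "n \<in> {2..M}"
      have "T - (s (n - 1) + s n) / 2 = t (M + 1 - n)"
      proof -
        have "n - 1 \<le> M" using n by auto
        then show ?thesis using n \<delta>(2) by (simp add: s_def t_def of_nat_diff field_simps)
      qed
      then show "(x0 + t (M + 1 - n) *\<^sub>R b) \<bullet> y (M + 1 - n) = F n"
        using n by (simp add: F_def d_def)
    qed (use M in auto)
    have "(\<Sum>n = 1..Suc M. F n) = F 1 + (\<Sum>n = 2..M. F n) + F (Suc M)"
      using M by (simp add: sum.atLeast_Suc_atMost numeral_2_eq_2)
    moreover have "(\<Sum>n = 0..M. (x0 + t n *\<^sub>R b) \<bullet> y n) =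
      x0 \<bullet> y 0 + (\<Sum>n = 1..M - 1. (x0 + t n *\<^sub>R b) \<bullet> y n) + (x0 + T *\<^sub>R b) \<bullet> y M"
    proof -
      obtain M' where M': "M = Suc M'" using M by (cases M) auto
      have "t M = T" using \<delta> by (simp add: t_def)
      then show ?thesis unfolding M' by (simp add: sum.atLeast_Suc_atMost t_def)
    qed
    ultimately have "?D \<le> ?V - x0 \<bullet> y 0 - (\<delta> / 4) * (b \<bullet> (y M - P)) + (x0 \<bullet> R + (\<delta> / 4) * (b \<bullet> R))"
      using D y(3) unfolding F_def[symmetric] F1 FM Fmid by (simp add: inner_diff_right)
    moreover have "0 \<le> x0 \<bullet> y 0"
      using x0 y(1)[of 0] by (auto simp: inner_vec_def less_eq_vec_def intro!: sum_nonneg)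
    moreover have "- (\<delta> / 4) * (b \<bullet> (y M - P)) \<le> T * (norm b * (C1 * e))"
    proof -
      have "- (\<delta> / 4) * (b \<bullet> (y M - P)) \<le> \<bar>(\<delta> / 4) * (b \<bullet> (y M - P))\<bar>" by simp
      also have "\<dots> = (\<delta> / 4) * \<bar>b \<bullet> (y M - P)\<bar>" using \<delta> by (simp add: abs_mult)
      also have "\<dots> \<le> T * (norm b * (C1 * e))"
      proof (rule mult_mono)
        have "\<bar>b \<bullet> (y M - P)\<bar> \<le> norm b * norm (y M - P)" by (rule Cauchy_Schwarz_ineq2)
        also have "\<dots> \<le> norm b * (C1 * e)" using P(4) by (intro mult_left_mono) auto
        finally show "\<bar>b \<bullet> (y M - P)\<bar> \<le> norm b * (C1 * e)" .
      qed (use \<delta> T in auto)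
      finally show ?thesis .
    qed
    moreover have "x0 \<bullet> R + (\<delta> / 4) * (b \<bullet> R) \<le> (norm x0 + T * norm b) * (C2 * e)"
    proof -
      have "x0 \<bullet> R + (\<delta> / 4) * (b \<bullet> R) = (x0 + (\<delta> / 4) *\<^sub>R b) \<bullet> R" by (simp add: inner_add_left)
      also have "\<dots> \<le> norm (x0 + (\<delta> / 4) *\<^sub>R b) * norm R" by (rule norm_cauchy_schwarz)
      also have "\<dots> \<le> (norm x0 + T * norm b) * (C2 * e)"
      proof (rule mult_mono)
        have "norm (x0 + (\<delta> / 4) *\<^sub>R b) \<le> norm x0 + norm ((\<delta> / 4) *\<^sub>R b)" by (rule norm_triangle_ineq)
        also have "norm ((\<delta> / 4) *\<^sub>R b) = (\<delta> / 4) * norm b" using \<delta>(1) by simp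
        also have "(\<delta> / 4) * norm b \<le> T * norm b" using \<delta>(1,3) by (intro mult_right_mono) auto
        finally show "norm (x0 + (\<delta> / 4) *\<^sub>R b) \<le> norm x0 + T * norm b" by simp
      qed (use R(3) T in auto)
      finally show ?thesis .
    qed
    ultimately have le: "?D \<le> ?V + (T * (norm b * (C1 * e)) + (norm x0 + T * norm b) * (C2 * e))" by linarith
    have "e \<le> \<delta> * norm c" unfolding e_def using \<delta>(1) by (intro mult_right_mono) auto
    then have "e \<le> norm c * T / real M" by (simp add: \<delta>_def mult.commute)
    then have "T * (norm b * (C1 * e)) + (norm x0 + T * norm b) * (C2 * e) \<le>
      T * (norm b * (C1 * (norm c * T / real M))) + (norm x0 + T * norm b) * (C2 * (norm c * T / real M))"
      using C1(1) C2(1) T by (intro add_mono mult_left_mono) auto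
    also have "\<dots> = K / real M"
      by (simp add: K_def power2_eq_square add_divide_distrib algebra_simps)
    finally show ?thesis using le by linarith
  qed
  then show ?thesis by blast
qed

theorem sclp_strong_duality:
  fixes A :: "real ^ 'j ^ 'k"
  assumes "0 < T" "0 \<le> x0" "0 \<le> qN"
    and "sclp_optimal A b c x0 qN T u" "sclp_dual_optimal A b c x0 qN T p"
  shows "sclp_dual_objective b x0 T p \<le> sclp_objective c qN T u"
proof -
  let ?V = "sclp_objective c qN T u" and ?D = "sclp_dual_objective b x0 T p"
  obtain K where K: "\<And>M. M \<ge> 1 \<Longrightarrow> ?D \<le> ?V + K / real M"
    using sclp_duality_gap_le[OF assms] by blast
  have "(\<lambda>M. K / real M) \<longlonglongrightarrow> 0" by (rule lim_const_over_n)
  from tendsto_add[OF tendsto_const[of ?V] this]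
  have "(\<lambda>M. ?V + K / real M) \<longlonglongrightarrow> ?V" by simp
  then show ?thesis by (rule LIMSEQ_le_const) (use K in blast)
qed

section \<open>Optimality of the boundary problems\<close>

lemma transpose_minus: "transpose (- A) = - transpose A" for A :: "real ^ 'j ^ 'k"
  by (simp add: transpose_def vec_eq_iff)

lemma mclp_dual_feasible_eq:
  "mclp_dual_feasible A c \<gamma> \<mu> T P q \<longleftrightarrow> mclp_feasible (- transpose A) (- c) (- \<gamma>) (- \<mu>) T P q"
proof -
  have *: "transpose A *v p - r = w \<longleftrightarrow> - transpose A *v p + r = - w" for p r w
  proof -
    have "- transpose A *v p + r = - (transpose A *v p - r)"
      unfolding matrix_vector_mult_minus by simp
    then show ?thesis by (simp only: neg_equal_iff_equal)
  qed
  show ?thesis unfolding mclp_dual_feasible_def mclp_feasible_def * by simp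
qed

lemma boundary_dual_feasible_eq:
  "boundary_dual_feasible A c \<gamma> \<mu> T Pt qt pN p0 qs q0 \<longleftrightarrow>
    boundary_feasible (- transpose A) (- c) (- \<gamma>) (- \<mu>) T Pt qt pN p0 qs q0"
proof -
  have 1: "transpose A *v pN - qs = \<gamma> + qt \<longleftrightarrow> - transpose A *v pN + qs = - \<gamma> - qt"
    unfolding matrix_vector_mult_minus by (auto simp: algebra_simps)
  have 2: "transpose A *v pN + transpose A *v p0 - q0 = \<gamma> + T *\<^sub>R c - transpose A *v Pt + \<mu> \<longleftrightarrow>
     - transpose A *v pN + - transpose A *v p0 + q0 = - \<gamma> + T *\<^sub>R - c - - transpose A *v Pt + - \<mu>"
    unfolding matrix_vector_mult_minus
    using neg_equal_iff_equal[of "transpose A *v pN + transpose A *v p0 - q0" "\<gamma> + T *\<^sub>R c - transpose A *v Pt + \<mu>"]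
    by (simp add: algebra_simps del: transpose_matrix_vector neg_equal_iff_equal)
  show ?thesis unfolding boundary_dual_feasible_def boundary_feasible_def 1 2 ..
qed

lemma boundary_dual_optimal_eq:
  "boundary_dual_optimal A b c \<beta> \<gamma> lam \<mu> T Pt qt pN p0 qs q0 \<longleftrightarrow>
    boundary_optimal (- transpose A) (- c) (- b) (- \<gamma>) (- \<beta>) (- \<mu>) (- lam) T Pt qt pN p0 qs q0"
proof -
  have "boundary_dual_objective b \<beta> lam T rN r0 = - boundary_objective (- b) (- \<beta>) (- lam) T rN r0" for rN r0
    by (simp add: boundary_dual_objective_def boundary_objective_def inner_add_left inner_diff_left)
  then show ?thesis
    by (simp add: boundary_dual_optimal_def boundary_optimal_def boundary_dual_feasible_eq)
qed

lemma inner_nonneg_vec: "0 \<le> x \<Longrightarrow> 0 \<le> y \<Longrightarrow> 0 \<le> x \<bullet> y" for x y :: "real ^ 'n"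
  by (auto simp: inner_vec_def less_eq_vec_def intro!: sum_nonneg)

lemma inner_mono_vec: "x \<le> x' \<Longrightarrow> 0 \<le> y \<Longrightarrow> x \<bullet> y \<le> x' \<bullet> y" for x x' y :: "real ^ 'n"
  using inner_nonneg_vec[of "x' - x" y] by (simp add: inner_diff_left)

lemma inner_eq_0_iff_vec:
  fixes x y :: "real ^ 'n"
  assumes "0 \<le> x" "0 \<le> y"
  shows "x \<bullet> y = 0 \<longleftrightarrow> (\<forall>i. x $ i * y $ i = 0)"
  using assms unfolding inner_vec_def less_eq_vec_def by (subst sum_nonneg_eq_0_iff) auto

lemma inner_transpose: "(transpose A *v p) \<bullet> v = p \<bullet> (A *v v)" for A :: "real ^ 'j ^ 'k"
  by (metis dot_lmul_matrix transpose_matrix_vector)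

text \<open>
  The linear programming dual of Boundary-LP has multipliers \<open>r1\<close>, \<open>r2\<close> with
  \<open>transpose A *v r2 \<ge> \<gamma>\<close> and \<open>transpose A *v (r1 + r2) \<ge> \<gamma> + T *\<^sub>R c + \<mu>\<close>.  The choice \<open>r2 = pN\<close>,
  \<open>r1 = p0 + Pt\<close> is feasible with slacks \<open>qs + qt\<close> and \<open>q0\<close>, and the products assumed to vanish are its
  complementary slackness conditions.
\<close>

lemma boundary_optimal_of_complementary:
  fixes A :: "real ^ 'j ^ 'k"
  assumes f: "boundary_feasible A b \<beta> lam T Ut xt u0 uN xs xN"
    and d: "boundary_dual_feasible A c \<gamma> \<mu> T Pt qt pN p0 qs q0"
    and Pt: "0 \<le> Pt" and qt: "0 \<le> qt"
    and cs: "(qs + qt) \<bullet> uN = 0" "q0 \<bullet> u0 = 0" "xN \<bullet> pN = 0" "xs \<bullet> p0 = 0" "xs \<bullet> Pt = 0"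
  shows "boundary_optimal A b c \<beta> \<gamma> lam \<mu> T Ut xt u0 uN xs xN"
proof -
  have dd: "\<gamma> = transpose A *v pN - (qs + qt)" "\<gamma> + T *\<^sub>R c + \<mu> = transpose A *v (pN + p0 + Pt) - q0"
    using d unfolding boundary_dual_feasible_def matrix_vector_right_distrib by (auto simp: algebra_simps)
  have nn: "0 \<le> pN" "0 \<le> p0" "0 \<le> qs" "0 \<le> q0" using d by (auto simp: boundary_dual_feasible_def)
  define R where "R = pN \<bullet> (\<beta> + T *\<^sub>R b - A *v Ut + lam) + (p0 + Pt) \<bullet> (\<beta> - xt)"
  have obj: "boundary_objective c \<gamma> \<mu> T v0 vN =
      R - (yN \<bullet> pN + ys \<bullet> p0 + ys \<bullet> Pt + q0 \<bullet> v0 + (qs + qt) \<bullet> vN)"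
    if "boundary_feasible A b \<beta> lam T Ut xt v0 vN ys yN" for v0 vN ys yN
  proof -
    have v: "\<beta> - xt = A *v v0 + ys" "\<beta> + T *\<^sub>R b - A *v Ut + lam = A *v v0 + A *v vN + yN"
      using that by (simp_all add: boundary_feasible_def)
    have "boundary_objective c \<gamma> \<mu> T v0 vN = (transpose A *v (pN + p0 + Pt) - q0) \<bullet> v0 + (transpose A *v pN - (qs + qt)) \<bullet> vN"
      unfolding boundary_objective_def dd(2) by (subst dd(1)) (rule refl)
    then show ?thesis
      unfolding R_def v inner_diff_left inner_transpose
      by (simp add: inner_add_left inner_add_right inner_commute algebra_simps)
  qed
  have "boundary_objective c \<gamma> \<mu> T u0 uN = R" using obj[OF f] cs by simp
  moreover have "boundary_objective c \<gamma> \<mu> T v0 vN \<le> R"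
    if v: "boundary_feasible A b \<beta> lam T Ut xt v0 vN ys yN" for v0 vN ys yN
  proof -
    have "0 \<le> v0" "0 \<le> vN" "0 \<le> ys" "0 \<le> yN" using v by (auto simp: boundary_feasible_def)
    then have "0 \<le> yN \<bullet> pN + ys \<bullet> p0 + ys \<bullet> Pt + q0 \<bullet> v0 + (qs + qt) \<bullet> vN"
      using nn Pt qt by (intro add_nonneg_nonneg inner_nonneg_vec) auto
    then show ?thesis using obj[OF v] by simp
  qed
  ultimately show ?thesis using f by (auto simp: boundary_optimal_def)
qed

lemma sclp_state_nonneg: "sclp_feasible A b x0 T u \<Longrightarrow> s \<in> {0..T} \<Longrightarrow> 0 \<le> sclp_state A b x0 u s"
  by (simp add: sclp_feasible_def sclp_state_def)

lemma sclp_dual_state_nonneg: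
  "sclp_dual_feasible A c qN T p \<Longrightarrow> s \<in> {0..T} \<Longrightarrow> 0 \<le> sclp_dual_state A c qN p s"
  unfolding sclp_dual_feasible_eq sclp_dual_state_eq by (rule sclp_state_nonneg)

lemma sclp_gap_parts:
  fixes A :: "real ^ 'j ^ 'k"
  assumes u: "sclp_feasible A b x0 T u" and p: "sclp_dual_feasible A c qN T p"
  shows "0 \<le> integral {0..T} (\<lambda>t. sclp_dual_state A c qN p (T - t) \<bullet> u t)"
    and "0 \<le> integral {0..T} (\<lambda>s. sclp_state A b x0 u (T - s) \<bullet> p s)"
    and "sclp_dual_objective b x0 T p - sclp_objective c qN T u =
      integral {0..T} (\<lambda>t. sclp_dual_state A c qN p (T - t) \<bullet> u t) +
      integral {0..T} (\<lambda>s. sclp_state A b x0 u (T - s) \<bullet> p s)"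
proof -
  have u': "u integrable_on {0..T}" "\<forall>s\<in>{0..T}. 0 \<le> u s" using u by (auto simp: sclp_feasible_def)
  have p': "p integrable_on {0..T}" "\<forall>s\<in>{0..T}. 0 \<le> p s" using p by (auto simp: sclp_dual_feasible_def)
  show "0 \<le> integral {0..T} (\<lambda>t. sclp_dual_state A c qN p (T - t) \<bullet> u t)"
    using u' sclp_dual_state_nonneg[OF p] by (intro integral_nonneg sclp_duality_gap[OF u' p'] inner_nonneg_vec) auto
  show "0 \<le> integral {0..T} (\<lambda>s. sclp_state A b x0 u (T - s) \<bullet> p s)"
    using p' sclp_state_nonneg[OF u] by (intro integral_nonneg sclp_duality_gap[OF u' p'] inner_nonneg_vec) auto
  show "sclp_dual_objective b x0 T p - sclp_objective c qN T u =
      integral {0..T} (\<lambda>t. sclp_dual_state A c qN p (T - t) \<bullet> u t) +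
      integral {0..T} (\<lambda>s. sclp_state A b x0 u (T - s) \<bullet> p s)"
    by (rule sclp_duality_gap(3)[OF u' p'])
qed

lemma sclp_optimal_complementary:
  fixes A :: "real ^ 'j ^ 'k"
  assumes "0 < T" "0 \<le> x0" "0 \<le> qN"
    and u: "sclp_optimal A b c x0 qN T u" and p: "sclp_dual_optimal A b c x0 qN T p"
  shows "integral {0..T} (\<lambda>t. sclp_dual_state A c qN p (T - t) \<bullet> u t) = 0"
    and "integral {0..T} (\<lambda>s. sclp_state A b x0 u (T - s) \<bullet> p s) = 0"
proof -
  have "sclp_feasible A b x0 T u" "sclp_dual_feasible A c qN T p"
    using u p by (auto simp: sclp_optimal_def sclp_dual_optimal_def)
  from sclp_gap_parts[OF this] sclp_strong_duality[OF assms]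
  show "integral {0..T} (\<lambda>t. sclp_dual_state A c qN p (T - t) \<bullet> u t) = 0"
    and "integral {0..T} (\<lambda>s. sclp_state A b x0 u (T - s) \<bullet> p s) = 0"
    by linarith+
qed

lemma sclp_complementary_optimal:
  fixes A :: "real ^ 'j ^ 'k"
  assumes u: "sclp_feasible A b x0 T u" and p: "sclp_dual_feasible A c qN T p"
    and cs: "integral {0..T} (\<lambda>t. sclp_dual_state A c qN p (T - t) \<bullet> u t) = 0"
      "integral {0..T} (\<lambda>s. sclp_state A b x0 u (T - s) \<bullet> p s) = 0"
  shows "sclp_optimal A b c x0 qN T u" and "sclp_dual_optimal A b c x0 qN T p"
proof -
  have eq: "sclp_dual_objective b x0 T p = sclp_objective c qN T u"
    using sclp_gap_parts(3)[OF u p] cs by simp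
  have "sclp_objective c qN T v \<le> sclp_objective c qN T u" if v: "sclp_feasible A b x0 T v" for v
    using sclp_gap_parts[OF v p] eq by linarith
  then show "sclp_optimal A b c x0 qN T u" using u by (simp add: sclp_optimal_def)
  have "sclp_dual_objective b x0 T p \<le> sclp_dual_objective b x0 T r" if r: "sclp_dual_feasible A c qN T r" for r
    using sclp_gap_parts[OF u r] eq by linarith
  then show "sclp_dual_optimal A b c x0 qN T p" using p by (simp add: sclp_dual_optimal_def)
qed

text \<open>
  A nonnegative integrand with integral 0 vanishes where it is continuous, in particular inside the
  cells.
\<close>

lemma complementary_on_cells:
  fixes u y :: "real \<Rightarrow> real ^ 'n"
  assumes t: "time_partition T N t"
    and u: "steps N t u un"
    and nn: "\<forall>s\<in>{0..T}. 0 \<le> u s" "\<forall>s\<in>{0..T}. 0 \<le> y s" and cont: "continuous_on {0..T} y"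
    and zero: "integral {0..T} (\<lambda>s. y (T - s) \<bullet> u s) = 0"
  shows "\<forall>n\<in>{1..N}. \<forall>s\<in>{t (n - 1)<..<t n}. y (T - s) \<bullet> un n = 0"
proof (intro ballI)
  fix n s assume n: "n \<in> {1..N}" and s: "s \<in> {t (n - 1)<..<t n}"
  note cell = time_partition_cell[OF t n]
  define e where "e = min ((s - t (n - 1)) / 2) ((t n - s) / 2)"
  have e: "0 < e" "t (n - 1) < s - e" "s + e < t n"
    using s unfolding e_def by (auto simp: min_def field_simps)
  have ci: "continuous_on {0..T} (\<lambda>s. y (T - s))"
    by (rule continuous_on_compose2[OF cont]) (auto intro!: continuous_intros)
  have ua: "u absolutely_integrable_on {0..T}"
    using step_integrable[OF t u] nn(1) by (rule nonneg_absolutely_integrable_vec)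
  have int: "(\<lambda>s. y (T - s) \<bullet> u s) integrable_on {0..T}"
    by (rule continuous_inner_integrable[OF ua ci])
  have int': "(\<lambda>s. y (T - s) \<bullet> u s) integrable_on {s - e..s + e}"
    by (rule integrable_on_subinterval[OF int]) (use cell e in auto)
  have "integral {s - e..s + e} (\<lambda>s. y (T - s) \<bullet> u s) \<le> integral {0..T} (\<lambda>s. y (T - s) \<bullet> u s)"
    by (rule integral_subset_le[OF _ int' int]) (use cell e nn in \<open>auto intro!: inner_nonneg_vec\<close>)
  moreover have "0 \<le> integral {s - e..s + e} (\<lambda>s. y (T - s) \<bullet> u s)"
    by (rule integral_nonneg[OF int']) (use cell e nn in \<open>auto intro!: inner_nonneg_vec\<close>)
  ultimately have "integral {s - e..s + e} (\<lambda>s. y (T - s) \<bullet> u s) = 0" using zero by linarith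
  moreover have "integral {s - e..s + e} (\<lambda>s. y (T - s) \<bullet> u s) = integral {s - e..s + e} (\<lambda>s. y (T - s) \<bullet> un n)"
    using u n e by (intro integral_cong) auto
  moreover have cont': "continuous_on {s - e..s + e} (\<lambda>s. y (T - s) \<bullet> un n)"
    by (intro continuous_intros continuous_on_subset[OF ci]) (use cell e in auto)
  ultimately have "((\<lambda>s. y (T - s) \<bullet> un n) has_integral 0) {s - e..s + e}"
    using integrable_continuous_real[OF cont'] by (simp add: has_integral_integral)
  moreover have "0 \<le> y (T - r) \<bullet> un n" if "r \<in> {s - e..s + e}" for r
  proof -
    have "u r = un n" using u n that e by auto
    moreover have "0 \<le> u r" "0 \<le> y (T - r)" using nn that cell e by auto
    ultimately show ?thesis using inner_nonneg_vec[of "y (T - r)" "u r"] by simp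
  qed
  ultimately show "y (T - s) \<bullet> un n = 0"
    using has_integral_0_cbox_imp_0[of "s - e" "s + e" "\<lambda>s. y (T - s) \<bullet> un n" s] cont' e by (auto simp: box_real)
qed

lemma has_real_derivative_component:
  assumes "(U has_vector_derivative w) (at s)"
  shows "((\<lambda>s. U s $ k) has_real_derivative w $ k) (at s)"
  using bounded_linear.has_vector_derivative[OF bounded_linear_vec_nth assms, of k]
  by (simp add: has_real_derivative_iff_has_vector_derivative)

lemma integral_mono_upper_vec:
  fixes u :: "real \<Rightarrow> real ^ 'n"
  assumes u: "u integrable_on {0..T}" "\<forall>s\<in>{0..T}. 0 \<le> u s" and rs: "0 \<le> r" "r \<le> s" "s \<le> T"
  shows "integral {0..r} u \<le> integral {0..s} u"
proof -
  have 1: "u integrable_on {0..s}" by (rule integrable_on_subinterval[OF u(1)]) (use rs in auto)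
  have 2: "u integrable_on {r..s}" by (rule integrable_on_subinterval[OF u(1)]) (use rs in auto)
  have "integral {0..s} u = integral {0..r} u + integral {r..s} u"
    using Henstock_Kurzweil_Integration.integral_combine[OF rs(1,2) 1] by simp
  moreover have "0 \<le> integral {r..s} u" by (rule integral_nonneg_vec[OF 2]) (use u rs in auto)
  ultimately show ?thesis by simp
qed

section \<open>Complementary slackness in Stieltjes form\<close>

lemma stieltjes_integrator_component:
  assumes "mclp_feasible A b \<beta> lam T U x" "0 < T"
  shows "stieltjes_integrator T (\<lambda>s. U s $ j)"
proof -
  have "continuous (at_right s) (\<lambda>s. U s $ j)" if "s \<in> {0..<T}" for s
    using assms that unfolding mclp_feasible_def continuous_within by (auto intro: tendsto_vec_nth)
  then show ?thesis
    using assms by (auto simp: mclp_feasible_def stieltjes_integrator_def mono_on_def less_eq_vec_def)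
qed

lemma stieltjes_inner_eq_0:
  assumes F: "mclp_feasible A b \<beta> lam T U x" and T: "0 < T" and t: "time_partition T N t"
    and cont: "continuous_on {0..<T} U" and L: "(U \<longlongrightarrow> U T - uN) (at_left T)"
    and deriv: "slopes N t U un"
    and cells: "\<forall>n\<in>{1..N}. \<forall>s\<in>{t (n - 1)<..<t n}. f s \<bullet> un n = 0"
    and ends: "f 0 \<bullet> U 0 = 0" "f T \<bullet> uN = 0"
    and nn: "\<forall>s\<in>{0..T}. 0 \<le> f s" "\<forall>n\<in>{1..N}. 0 \<le> un n" "0 \<le> uN"
  shows "stieltjes_inner T f U = 0"
proof -
  have U0: "0 \<le> U 0" using F T by (simp add: mclp_feasible_def)
  have "stieltjes_integral T (\<lambda>s. f s $ j) (\<lambda>s. U s $ j) = 0" for j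
  proof (rule stieltjes_integral_eq_0[OF stieltjes_integrator_component[OF F T] t])
    show "continuous_on {0..<T} (\<lambda>s. U s $ j)" using cont by (intro continuous_intros)
    show "((\<lambda>s. U s $ j) \<longlongrightarrow> (U T - uN) $ j) (at_left T)" using L by (rule tendsto_vec_nth)
    show "\<forall>n\<in>{1..N}. \<forall>s\<in>{t (n - 1)<..<t n}. ((\<lambda>s. U s $ j) has_real_derivative un n $ j) (at s)"
      using deriv has_real_derivative_component by blast
    show "\<forall>n\<in>{1..N}. \<forall>s\<in>{t (n - 1)<..<t n}. f s $ j * un n $ j = 0"
    proof (intro ballI)
      fix n s assume n: "n \<in> {1..N}" and s: "s \<in> {t (n - 1)<..<t n}"
      have "0 \<le> f s" using nn(1) s time_partition_cell[OF t n] by auto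
      then show "f s $ j * un n $ j = 0"
        using inner_eq_0_iff_vec[of "f s" "un n"] nn(2) cells n s by blast
    qed
    show "f 0 $ j * U 0 $ j = 0"
      using inner_eq_0_iff_vec[of "f 0" "U 0"] nn(1) U0 ends(1) T by auto
    show "f T $ j * (U T $ j - (U T - uN) $ j) = 0"
      using inner_eq_0_iff_vec[of "f T" uN] nn(1,3) ends(2) T by auto
  qed
  then show ?thesis by (simp add: stieltjes_inner_def)
qed

lemma stieltjes_inner_eq_0D:
  assumes F: "mclp_feasible A b \<beta> lam T U x" and T: "0 < T" and t: "time_partition T N t"
    and L: "(U \<longlongrightarrow> U T - uN) (at_left T)"
    and deriv: "slopes N t U un"
    and f: "continuous_on {0<..T} f" "\<forall>s\<in>{0..T}. 0 \<le> f s" "bounded (f ` {0..T})"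
    and zero: "stieltjes_inner T f U = 0"
  shows "f 0 \<bullet> U 0 = 0" "f T \<bullet> uN = 0"
    and "\<forall>n\<in>{1..N}. \<forall>s\<in>{t (n - 1)<..<t n}. f s \<bullet> un n = 0"
proof -
  obtain C where C: "\<And>s. s \<in> {0..T} \<Longrightarrow> norm (f s) \<le> C"
    using f(3) unfolding bounded_iff by (meson imageI)
  have z: "stieltjes_integral T (\<lambda>s. f s $ j) (\<lambda>s. U s $ j) = 0" for j
    using zero f(2) unfolding stieltjes_inner_def
    by (subst (asm) sum_nonneg_eq_0_iff) (auto intro!: stieltjes_integral_nonneg simp: less_eq_vec_def)
  have *: "f 0 $ j * U 0 $ j = 0" "f T $ j * (U T $ j - (U T - uN) $ j) = 0"
    "\<forall>n\<in>{1..N}. \<forall>s\<in>{t (n - 1)<..<t n}. f s $ j * un n $ j = 0" for j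
  proof -
    have 1: "((\<lambda>s. U s $ j) \<longlongrightarrow> (U T - uN) $ j) (at_left T)" using L by (rule tendsto_vec_nth)
    have 2: "\<forall>n\<in>{1..N}. \<forall>s\<in>{t (n - 1)<..<t n}. ((\<lambda>s. U s $ j) has_real_derivative un n $ j) (at s)"
      using deriv has_real_derivative_component by blast
    have 3: "continuous_on {0<..T} (\<lambda>s. f s $ j)" using f(1) by (intro continuous_intros)
    have 4: "\<forall>s\<in>{0..T}. 0 \<le> f s $ j" using f(2) by (simp add: less_eq_vec_def)
    have 5: "\<forall>s\<in>{0..T}. f s $ j \<le> C"
    proof
      fix s assume "s \<in> {0..T}"
      then show "f s $ j \<le> C" using C[of s] component_le_norm_cart[of "f s" j] by simp
    qed
    note r = stieltjes_integral_zero_imp[OF stieltjes_integrator_component[OF F T] t 1 2 3 4 5 z]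
    show "f 0 $ j * U 0 $ j = 0" by (rule r(1))
    show "f T $ j * (U T $ j - (U T - uN) $ j) = 0" by (rule r(2))
    show "\<forall>n\<in>{1..N}. \<forall>s\<in>{t (n - 1)<..<t n}. f s $ j * un n $ j = 0" by (rule r(3))
  qed
  show "f 0 \<bullet> U 0 = 0" using *(1) unfolding inner_vec_def by (intro sum.neutral) simp
  show "f T \<bullet> uN = 0" using *(2) unfolding inner_vec_def by (intro sum.neutral) simp
  show "\<forall>n\<in>{1..N}. \<forall>s\<in>{t (n - 1)<..<t n}. f s \<bullet> un n = 0"
  proof (intro ballI)
    fix n s assume n: "n \<in> {1..N}" and s: "s \<in> {t (n - 1)<..<t n}"
    have "f s $ j * un n $ j = 0" for j using *(3)[of j] n s by blast
    then show "f s \<bullet> un n = 0" unfolding inner_vec_def by (intro sum.neutral) simp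
  qed
qed

section \<open>Composition\<close>

text \<open>
  The cumulative control with rate \<open>u\<close> and the impulses \<open>u0\<close> at time 0 and \<open>uN\<close> at time \<open>T\<close>.
\<close>

definition composed_control :: "real \<Rightarrow> (real \<Rightarrow> 'a::euclidean_space) \<Rightarrow> 'a \<Rightarrow> 'a \<Rightarrow> real \<Rightarrow> 'a" where
  "composed_control T u u0 uN s =
    (if s < T then u0 + integral {0..s} u else u0 + integral {0..T} u + uN)"

text \<open>
  States of M-CLP follow the internal state before \<open>T\<close> and have a value of their own at \<open>T\<close>.
\<close>

definition terminated :: "real \<Rightarrow> (real \<Rightarrow> 'a) \<Rightarrow> 'a \<Rightarrow> real \<Rightarrow> 'a" where
  "terminated T y yN s = (if s < T then y s else yN)"

lemma continuous_on_terminated: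
  assumes "continuous_on {0..T} y"
  shows "continuous_on {0..<T} (terminated T y yN)"
  by (rule continuous_on_eq[of _ y])
    (auto simp: terminated_def intro: continuous_on_subset[OF assms])

lemma composed_control_terminated:
  "composed_control T u u0 uN = terminated T (\<lambda>s. u0 + integral {0..s} u) (u0 + integral {0..T} u + uN)"
  by (rule ext) (simp add: composed_control_def terminated_def)

lemma continuous_on_integral_path:
  fixes u :: "real \<Rightarrow> 'a::euclidean_space"
  assumes "u integrable_on {0..T}"
  shows "continuous_on {0..T} (\<lambda>s. u0 + integral {0..s} u)"
  by (intro continuous_intros indefinite_integral_continuous_1 assms)

lemma composed_control_left_limit:
  fixes u :: "real \<Rightarrow> 'a::euclidean_space"
  assumes "u integrable_on {0..T}" "0 < T"
  shows "(composed_control T u u0 uN \<longlongrightarrow> composed_control T u u0 uN T - uN) (at_left T)"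
proof -
  have "((\<lambda>s. u0 + integral {0..s} u) \<longlongrightarrow> u0 + integral {0..T} u) (at T within {0..T})"
    using continuous_on_integral_path[OF assms(1)] assms(2) unfolding continuous_on_def by auto
  then have "((\<lambda>s. u0 + integral {0..s} u) \<longlongrightarrow> u0 + integral {0..T} u) (at_left T)"
    using assms(2) by (simp add: at_within_Icc_at_left)
  then have "(composed_control T u u0 uN \<longlongrightarrow> u0 + integral {0..T} u) (at_left T)"
    by (rule Lim_transform_eventually) (auto simp: composed_control_def eventually_at_filter intro!: always_eventually)
  then show ?thesis by (simp add: composed_control_def)
qed

lemma has_vector_derivative_terminated:
  assumes "(y has_vector_derivative w) (at s)" "s < T"
  shows "(terminated T y yN has_vector_derivative w) (at s)"
  by (rule has_vector_derivative_transform_within_open[OF assms(1), of "{..<T}"])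
    (use assms(2) in \<open>auto simp: terminated_def\<close>)

lemma step_path_derivative:
  fixes u :: "real \<Rightarrow> 'a::euclidean_space"
  assumes t: "time_partition T N t"
    and u: "steps N t u un"
    and n: "n \<in> {1..N}" and s: "s \<in> {t (n - 1)<..<t n}"
  shows "((\<lambda>s. u0 + integral {0..s} u) has_vector_derivative un n) (at s)"
proof (rule has_vector_derivative_transform_within_open[of _ _ _ "{t (n - 1)<..<t n}"])
  let ?S = "\<Sum>m = 1..n - 1. (t m - t (m - 1)) *\<^sub>R un m"
  show "((\<lambda>s. u0 + (?S + (s - t (n - 1)) *\<^sub>R un n)) has_vector_derivative un n) (at s)"
    by (auto intro!: derivative_eq_intros)
  show "u0 + (?S + (r - t (n - 1)) *\<^sub>R un n) = u0 + integral {0..r} u" if "r \<in> {t (n - 1)<..<t n}" for r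
    using step_has_integral[OF t u n, of r] that by (simp add: integral_unique)
qed (use s in auto)

lemma composed_control_derivative:
  fixes u :: "real \<Rightarrow> 'a::euclidean_space"
  assumes t: "time_partition T N t"
    and u: "steps N t u un"
  shows "slopes N t (composed_control T u u0 uN) un"
  unfolding composed_control_terminated
proof (intro ballI)
  fix n s assume n: "n \<in> {1..N}" "s \<in> {t (n - 1)<..<t n}"
  show "(terminated T (\<lambda>s. u0 + integral {0..s} u) (u0 + integral {0..T} u + uN) has_vector_derivative un n) (at s)"
    by (rule has_vector_derivative_terminated[OF step_path_derivative[OF t u n]])
      (use time_partition_cell[OF t n(1)] n in auto)
qed

lemma terminated_derivative:
  assumes t: "time_partition T N t"
    and y: "slopes N t y yd"
  shows "\<forall>n\<in>{1..N}. \<forall>s\<in>{t (n - 1)<..<t n}. (terminated T y yN has_vector_derivative yd n) (at s)"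
proof (intro ballI)
  fix n s assume n: "n \<in> {1..N}" "s \<in> {t (n - 1)<..<t n}"
  show "(terminated T y yN has_vector_derivative yd n) (at s)"
    by (rule has_vector_derivative_terminated) (use y n time_partition_cell[OF t n(1)] in auto)
qed

lemma right_continuous_of_continuous_on:
  fixes U :: "real \<Rightarrow> 'a::t2_space"
  assumes "continuous_on {0..<T} U" "s \<in> {0..<T}"
  shows "continuous (at_right s) U"
proof -
  have "(U \<longlongrightarrow> U s) (at s within {0..<T})" using assms by (simp add: continuous_on_def)
  then have "(U \<longlongrightarrow> U s) (at s within {s..(s + T) / 2})" by (rule tendsto_within_subset) (use assms in auto)
  moreover have "s < (s + T) / 2" using assms(2) by simp
  ultimately show ?thesis by (simp add: continuous_within at_within_Icc_at_right)
qed

text \<open>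
  The first boundary constraint is the state equation at time 0, which the internal state continues up
  to \<open>T\<close>; the second one is the state equation at \<open>T\<close>.
\<close>

lemma composed_feasible:
  fixes A :: "real ^ 'j ^ 'k"
  assumes T: "0 < T" and u: "sclp_feasible A b x0 T u"
    and bf: "boundary_feasible A b \<beta> lam T (integral {0..T} u) xt u0 uN xs xN" and x0: "x0 = xs + xt"
  shows "mclp_feasible A b \<beta> lam T (composed_control T u u0 uN) (terminated T (sclp_state A b x0 u) xN)"
proof -
  let ?U = "composed_control T u u0 uN" and ?x = "terminated T (sclp_state A b x0 u) xN"
  have bf': "A *v u0 + xs = \<beta> - xt"
    "A *v u0 + A *v uN + xN = \<beta> + T *\<^sub>R b - A *v integral {0..T} u + lam"
    "0 \<le> u0" "0 \<le> uN" "0 \<le> xs" "0 \<le> xN"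
    using bf by (auto simp: boundary_feasible_def)
  note uD = sclp_feasibleD[OF u]
  have u_pos: "\<forall>s\<in>{0..T}. 0 \<le> u s" using uD(4) by blast
  have mono: "integral {0..r} u \<le> integral {0..s} u" if "0 \<le> r" "r \<le> s" "s \<le> T" for r s
    by (rule integral_mono_upper_vec[OF uD(1) u_pos that])
  have "0 \<le> ?U s" if "s \<in> {0..T}" for s
  proof -
    have "0 \<le> integral {0..min s T} u" using that by (intro integral_nonneg_vec uD) auto
    then show ?thesis using that bf' by (auto simp: composed_control_def add_nonneg_nonneg min_def split: if_splits)
  qed
  moreover have "0 \<le> ?x s" if "s \<in> {0..T}" for s
    using sclp_state_nonneg[OF u] that bf'(6) by (simp add: terminated_def)
  moreover have "mono_on {0..T} ?U"
  proof (rule mono_onI)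
    fix r s assume rs: "r \<in> {0..T}" "s \<in> {0..T}" "r \<le> s"
    show "?U r \<le> ?U s"
    proof (cases "r < T \<and> s = T")
      case True
      have "u0 + integral {0..r} u + 0 \<le> u0 + integral {0..T} u + uN"
        using rs True bf'(4) by (intro add_mono mono) auto
      then show ?thesis using True by (simp add: composed_control_def)
    next
      case False
      then show ?thesis using rs mono[of r s] by (auto simp: composed_control_def)
    qed
  qed
  moreover have "continuous (at_right s) ?U" if "s \<in> {0..<T}" for s
    unfolding composed_control_terminated
    by (rule right_continuous_of_continuous_on[OF continuous_on_terminated[OF continuous_on_integral_path[OF uD(1)]] that])
  moreover have "A *v ?U s + ?x s = \<beta> + s *\<^sub>R b" if "s \<in> {0..<T}" for s
  proof -
    have "integral {0..s} (\<lambda>r. A *v u r) = A *v integral {0..s} u"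
      using that by (intro integral_matrix_vector_mult uD) auto
    moreover have "\<beta> = A *v u0 + x0" using bf'(1) x0 by (simp add: algebra_simps)
    ultimately show ?thesis
      using that by (simp add: composed_control_def terminated_def sclp_state_def matrix_vector_right_distrib)
  qed
  moreover have "A *v ?U T + ?x T = \<beta> + T *\<^sub>R b + lam"
    using bf'(2) by (simp add: composed_control_def terminated_def matrix_vector_right_distrib algebra_simps)
  ultimately show ?thesis by (simp add: mclp_feasible_def)
qed

section \<open>Decomposition\<close>

lemma rate_nonneg:
  fixes U :: "real \<Rightarrow> real ^ 'n"
  assumes U: "mono_on {0..T} U" and ab: "0 \<le> a" "a < b" "b \<le> T"
    and deriv: "\<forall>s\<in>{a<..<b}. (U has_vector_derivative w) (at s)"
  shows "0 \<le> w"
proof -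
  \<comment> \<open>The closed middle third lies inside the open interval of differentiability.\<close>
  define d where "d = (b - a) / 3"
  have d: "d > 0" "a + d < b - d" using ab by (auto simp: d_def field_simps)
  have "((\<lambda>_. w) has_integral U (b - d) - U (a + d)) {a + d..b - d}"
    by (rule fundamental_theorem_of_calculus)
      (use d deriv in \<open>auto intro: has_vector_derivative_at_within\<close>)
  moreover have "((\<lambda>_. w) has_integral ((b - d) - (a + d)) *\<^sub>R w) {a + d..b - d}"
    using has_integral_const_real[of w "a + d" "b - d"] d by simp
  ultimately have eq: "U (b - d) - U (a + d) = ((b - d) - (a + d)) *\<^sub>R w"
    by (rule has_integral_unique)
  have "U (a + d) \<le> U (b - d)" using mono_onD[OF U, of "a + d" "b - d"] d ab by auto
  then have *: "0 \<le> ((b - d) - (a + d)) *\<^sub>R w" unfolding eq[symmetric] by simp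
  define r where "r = (b - d) - (a + d)"
  have "r > 0" using d by (simp add: r_def)
  then show ?thesis using *[folded r_def] by (simp add: less_eq_vec_def zero_le_mult_iff)
qed

text \<open>
  The parameter \<open>xt\<close> of the coupling: the largest amount by which a path with slopes \<open>xd\<close> falls below
  its initial value.
\<close>

definition max_drop :: "nat \<Rightarrow> (nat \<Rightarrow> real) \<Rightarrow> (nat \<Rightarrow> real ^ 'n) \<Rightarrow> real ^ 'n" where
  "max_drop N t xd =
    (\<chi> k. - Min (insert 0 ((\<lambda>n. \<Sum>m = 1..n. (xd m $ k) * (t m - t (m - 1))) ` {1..N})))"

lemma max_drop_nonneg: "0 \<le> max_drop N t xd"
  by (auto simp: max_drop_def less_eq_vec_def intro!: Min_le)

text \<open>
  The dual sums run from \<open>n\<close> to \<open>N\<close>: these are the partial sums from the start in reversed time.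
\<close>

lemma max_drop_reversed:
  fixes t :: "nat \<Rightarrow> real"
  shows "max_drop N (\<lambda>n. T - t (N - n)) (\<lambda>n. qd (N + 1 - n)) =
    (\<chi> k. - Min (insert 0 ((\<lambda>n. \<Sum>m = n..N. (qd m $ k) * (t m - t (m - 1))) ` {1..N})))"
proof -
  have "(\<lambda>n. \<Sum>m = 1..n. (qd (N + 1 - m) $ k) * ((T - t (N - m)) - (T - t (N - (m - 1))))) ` {1..N} =
    (\<lambda>n. \<Sum>m = n..N. (qd m $ k) * (t m - t (m - 1))) ` {1..N}" (is "?F ` _ = ?G ` _") for k
  proof -
    have FG: "?F n = ?G (N + 1 - n)" if n: "n \<in> {1..N}" for n
    proof (rule sum.reindex_bij_witness[of _ "\<lambda>m. N + 1 - m" "\<lambda>m. N + 1 - m"])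
      fix m assume m: "m \<in> {1..n}"
      then have "N - m = N + 1 - m - 1" "N - (m - 1) = N + 1 - m" using n by auto
      then show "qd (N + 1 - m) $ k * (t (N + 1 - m) - t (N + 1 - m - 1)) =
        qd (N + 1 - m) $ k * ((T - t (N - m)) - (T - t (N - (m - 1))))" by simp
    qed (use n in auto)
    have "?F ` {1..N} = ?G ` ((\<lambda>n. N + 1 - n) ` {1..N})"
      unfolding image_image by (intro image_cong FG) auto
    also have "(\<lambda>n. N + 1 - n) ` {1..N} = {1..N}"
    proof (intro equalityI subsetI)
      fix m assume "m \<in> {1..N}"
      then show "m \<in> (\<lambda>n. N + 1 - n) ` {1..N}" by (intro image_eqI[of _ _ "N + 1 - m"]) auto
    qed auto
    finally show ?thesis .
  qed
  then show ?thesis by (simp add: max_drop_def)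
qed

text \<open>
  Before \<open>T\<close> the fundamental theorem of calculus recovers \<open>U\<close> and \<open>x\<close> from the rate \<open>u\<close>; what concerns
  \<open>T\<close> itself, the sign of the internal state and of the final impulse, follows by passing to the limit
  from the left.  The slack \<open>x 0 - xt\<close> is nonnegative as the partial sums added to \<open>x 0\<close> are the
  internal states at the nodes.
\<close>

lemma mclp_decomposition:
  fixes A :: "real ^ 'j ^ 'k"
  assumes T: "0 < T" and t: "time_partition T N t"
    and F: "mclp_feasible A b \<beta> lam T U x"
    and cont: "continuous_on {0..<T} U"
    and Ud: "slopes N t U un"
    and xd: "slopes N t x xd"
  defines "xt \<equiv> max_drop N t xd"
  obtains u where "steps N t u un"
    "sclp_feasible A b (x 0) T u"
    "(U \<longlongrightarrow> U 0 + integral {0..T} u) (at_left T)"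
    "\<forall>s\<in>{0..<T}. x s = sclp_state A b (x 0) u s"
    "slopes N t (sclp_state A b (x 0) u) xd"
    "boundary_feasible A b \<beta> lam T (integral {0..T} u) xt (U 0) (U T - (U 0 + integral {0..T} u)) (x 0 - xt) (x T)"
proof -
  have Fs: "\<forall>s\<in>{0..T}. 0 \<le> U s \<and> 0 \<le> x s" "mono_on {0..T} U"
    "\<forall>s\<in>{0..<T}. A *v U s + x s = \<beta> + s *\<^sub>R b" "A *v U T + x T = \<beta> + T *\<^sub>R b + lam"
    using F by (simp_all add: mclp_feasible_def)
  have un: "0 \<le> un n" if "n \<in> {1..N}" for n
    using rate_nonneg[OF Fs(2), of "t (n - 1)" "t n" "un n"] time_partition_cell[OF t that] Ud that by auto
  obtain u where u: "steps N t u un"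
    "\<forall>s. u s = 0 \<or> (\<exists>n\<in>{1..N}. u s = un n)"
    using step_function_exists[OF t, where un = un] by (elim exE conjE)
  have u_pos: "0 \<le> u s" for s
    using u(2) un by (metis order_refl)
  have int: "u integrable_on {0..T}" by (rule step_integrable[OF t u(1)])
  have Ud': "\<forall>n\<in>{1..N}. \<forall>s\<in>{t (n - 1)<..<t n}. (U has_vector_derivative u s) (at s)"
    using Ud u(1) by simp
  have Us: "U s = U 0 + integral {0..s} u" if "s \<in> {0..<T}" for s
  proof -
    have "continuous_on {0..s} U" by (rule continuous_on_subset[OF cont]) (use that in auto)
    from piecewise_linear_has_integral[OF t this Ud'] that
    have "(u has_integral U s - U 0) {0..s}" by simp
    then show ?thesis by (simp add: integral_unique)
  qed
  have beta: "\<beta> = A *v U 0 + x 0" using Fs(3) T by force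
  have xs: "x s = sclp_state A b (x 0) u s" if "s \<in> {0..<T}" for s
  proof -
    have "u integrable_on {0..s}" by (rule integrable_on_subinterval[OF int]) (use that in auto)
    then have "integral {0..s} (\<lambda>r. A *v u r) = A *v (U s - U 0)"
      using Us[OF that] by (simp add: integral_matrix_vector_mult)
    moreover have "A *v U s + x s = \<beta> + s *\<^sub>R b" using Fs(3) that by blast
    then have "x s = \<beta> + s *\<^sub>R b - A *v U s" by (simp add: algebra_simps)
    ultimately show ?thesis
      unfolding sclp_state_def beta by (simp add: matrix_vector_mult_diff_distrib)
  qed
  let ?y = "sclp_state A b (x 0) u"
  have cy: "continuous_on {0..T} ?y" by (rule continuous_on_sclp_state[OF int])
  have y_pos: "0 \<le> ?y s" if "s \<in> {0..T}" for s
  proof (cases "s < T")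
    case True
    have "0 \<le> x s" using Fs(1) that by blast
    also have "x s = ?y s" using xs[of s] True that by simp
    finally show ?thesis .
  next
    case False
    then have s: "s = T" using that by simp
    have "0 \<le> ?y T $ k" for k
    proof (rule tendsto_lowerbound)
      have "(?y \<longlongrightarrow> ?y T) (at T within {0..T})" using cy T by (simp add: continuous_on_def)
      then show "((\<lambda>s. ?y s $ k) \<longlongrightarrow> ?y T $ k) (at_left T)"
        using T by (intro tendsto_vec_nth) (simp add: at_within_Icc_at_left)
      have "0 \<le> ?y r $ k" if "0 < r" "r < T" for r
      proof -
        have "0 \<le> x r" using Fs(1) that by auto
        also have "x r = ?y r" using xs[of r] that by simp
        finally show ?thesis by (simp add: less_eq_vec_def)
      qed
      then show "eventually (\<lambda>s. 0 \<le> ?y s $ k) (at_left T)"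
        using T by (auto simp: eventually_at_left[OF T] intro!: exI[of _ 0])
    qed simp
    then show ?thesis by (simp add: s less_eq_vec_def)
  qed
  have feas: "sclp_feasible A b (x 0) T u"
    using int u_pos y_pos by (auto simp: sclp_feasible_def sclp_state_def)
  have lim: "(U \<longlongrightarrow> U 0 + integral {0..T} u) (at_left T)"
  proof -
    have "(composed_control T u (U 0) 0 \<longlongrightarrow> U 0 + integral {0..T} u) (at_left T)"
      using composed_control_left_limit[OF int T, of "U 0" 0] by (simp add: composed_control_def)
    moreover have "composed_control T u (U 0) 0 r = U r" if "0 < r" "r < T" for r
      using Us[of r, symmetric] that by (simp add: composed_control_def)
    then have "eventually (\<lambda>r. composed_control T u (U 0) 0 r = U r) (at_left T)"
      using T by (auto simp: eventually_at_left[OF T] intro!: exI[of _ 0])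
    ultimately show ?thesis by (rule Lim_transform_eventually)
  qed
  have uN: "0 \<le> U T - (U 0 + integral {0..T} u)"
    unfolding less_eq_vec_def
  proof
    fix j
    have "(U 0 + integral {0..T} u) $ j \<le> U T $ j"
    proof (rule tendsto_upperbound)
      show "((\<lambda>s. U s $ j) \<longlongrightarrow> (U 0 + integral {0..T} u) $ j) (at_left T)"
        using lim by (rule tendsto_vec_nth)
      have "U r $ j \<le> U T $ j" if "0 < r" "r < T" for r
        using mono_onD[OF Fs(2), of r T] that by (auto simp: less_eq_vec_def)
      then show "eventually (\<lambda>s. U s $ j \<le> U T $ j) (at_left T)"
        using T by (auto simp: eventually_at_left[OF T] intro!: exI[of _ 0])
    qed simp
    then show "(0 :: real ^ 'j) $ j \<le> (U T - (U 0 + integral {0..T} u)) $ j" by simp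
  qed
  have yd: "\<forall>n\<in>{1..N}. \<forall>s\<in>{t (n - 1)<..<t n}. (?y has_vector_derivative xd n) (at s)"
  proof (intro ballI)
    fix n s assume n: "n \<in> {1..N}" and s: "s \<in> {t (n - 1)<..<t n}"
    note cell = time_partition_cell[OF t n]
    show "(?y has_vector_derivative xd n) (at s)"
    proof (rule has_vector_derivative_transform_within_open[of x _ _ "{0<..<T}"])
      show "(x has_vector_derivative xd n) (at s)" using xd n s by blast
      show "x r = ?y r" if "r \<in> {0<..<T}" for r using that by (intro xs) auto
    qed (use s cell in auto)
  qed
  have xt: "0 \<le> x 0 - xt"
    unfolding less_eq_vec_def
  proof
    fix k
    define S where "S n = (\<Sum>m = 1..n. (xd m $ k) * (t m - t (m - 1)))" for n
    have "Min (insert 0 (S ` {1..N})) \<in> insert 0 (S ` {1..N})" by (intro Min_in) auto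
    moreover have "0 \<le> x 0 $ k" using Fs(1) T by (auto simp: less_eq_vec_def)
    moreover have "0 \<le> x 0 $ k + S n" if n: "n \<in> {1..N}" for n
    proof -
      obtain v where v: "steps N t v xd"
        using step_function_exists[OF t, where un = xd] by (elim exE conjE)
      have yv: "\<forall>n\<in>{1..N}. \<forall>s\<in>{t (n - 1)<..<t n}. (?y has_vector_derivative v s) (at s)"
        using yd v by simp
      have tn: "0 \<le> t n" "t n \<le> T" using time_partition_range[OF t, of n] n by auto
      have "continuous_on {0..t n} ?y" by (rule continuous_on_subset[OF cy]) (use tn in auto)
      from has_integral_unique[OF piecewise_linear_has_integral[OF t this yv order_refl tn] step_has_integral_node[OF t v]] n
      have "?y (t n) - ?y 0 = (\<Sum>m = 1..n. (t m - t (m - 1)) *\<^sub>R xd m)" by simp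
      from arg_cong[OF this, of "\<lambda>w. w $ k"]
      have "?y (t n) $ k = x 0 $ k + S n"
        by (simp add: S_def sclp_state_def mult.commute)
      moreover have "0 \<le> ?y (t n) $ k"
        using y_pos[of "t n"] tn unfolding less_eq_vec_def by simp
      ultimately show ?thesis by linarith
    qed
    ultimately have "0 \<le> x 0 $ k + Min (insert 0 (S ` {1..N}))" by (metis add.right_neutral imageE insertE)
    then show "(0 :: real ^ 'k) $ k \<le> (x 0 - xt) $ k"
      by (simp only: xt_def max_drop_def S_def[abs_def] vector_minus_component vec_lambda_beta
        diff_minus_eq_add zero_index)
  qed
  have bf: "boundary_feasible A b \<beta> lam T (integral {0..T} u) xt (U 0) (U T - (U 0 + integral {0..T} u)) (x 0 - xt) (x T)"
    unfolding boundary_feasible_def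
  proof (intro conjI)
    show "A *v U 0 + (x 0 - xt) = \<beta> - xt" by (simp add: beta)
    have "A *v U 0 + A *v (U T - (U 0 + integral {0..T} u)) + x T = A *v U T + x T - A *v integral {0..T} u"
      by (simp add: matrix_vector_mult_diff_distrib matrix_vector_right_distrib)
    then show "A *v U 0 + A *v (U T - (U 0 + integral {0..T} u)) + x T =
        \<beta> + T *\<^sub>R b - A *v integral {0..T} u + lam"
      unfolding Fs(4) by simp
  qed (use Fs(1) T uN xt in auto)
  have "\<forall>s\<in>{0..<T}. x s = ?y s" by (intro ballI xs)
  then show thesis by (rule that[OF u(1) feas lim _ yd bf])
qed

section \<open>Transfer of complementary slackness\<close>

text \<open>
  The state \<open>q\<close> of M-CLP and the internal state \<open>y\<close> differ at most at \<open>T\<close>.  This single point matters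
  for the impulse at 0, where \<open>q T\<close> appears, but not for the integral.
\<close>

lemma complementary_of_stieltjes:
  fixes A :: "real ^ 'j ^ 'k" and U :: "real \<Rightarrow> real ^ 'j"
  assumes T: "0 < T" and t: "time_partition T N t"
    and F: "mclp_feasible A b \<beta> lam T U x"
    and L: "(U \<longlongrightarrow> U T - uN) (at_left T)"
    and deriv: "slopes N t U un"
    and u: "steps N t u un"
    and q: "\<forall>s\<in>{0..T}. 0 \<le> q s" "\<forall>s\<in>{0..<T}. q s = y s" and y: "continuous_on {0..T} y"
    and zero: "stieltjes_inner T (\<lambda>s. q (T - s)) U = 0"
  shows "q T \<bullet> U 0 = 0" "q 0 \<bullet> uN = 0" "integral {0..T} (\<lambda>s. y (T - s) \<bullet> u s) = 0"
proof -
  have cq: "continuous_on {0..<T} q"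
    by (rule continuous_on_eq[of _ y]) (use q(2) in \<open>auto intro: continuous_on_subset[OF y]\<close>)
  have 1: "continuous_on {0<..T} (\<lambda>s. q (T - s))"
    by (rule continuous_on_compose2[OF cq]) (auto intro!: continuous_intros)
  have 2: "\<forall>s\<in>{0..T}. 0 \<le> q (T - s)" using q(1) by auto
  have "bounded (insert (q T) (y ` {0..T}))"
    using compact_imp_bounded[OF compact_continuous_image[OF y compact_Icc]] by simp
  then have 3: "bounded ((\<lambda>s. q (T - s)) ` {0..T})"
  proof (rule bounded_subset)
    show "(\<lambda>s. q (T - s)) ` {0..T} \<subseteq> insert (q T) (y ` {0..T})"
    proof
      fix z assume "z \<in> (\<lambda>s. q (T - s)) ` {0..T}"
      then obtain s where s: "s \<in> {0..T}" "z = q (T - s)" by blast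
      show "z \<in> insert (q T) (y ` {0..T})"
      proof (cases "s = 0")
        case False
        then have "z = y (T - s)" "T - s \<in> {0..T}" using q(2) s by auto
        then show ?thesis by blast
      qed (use s in simp)
    qed
  qed
  note D = stieltjes_inner_eq_0D[OF F T t L deriv 1 2 3 zero]
  show "q T \<bullet> U 0 = 0" "q 0 \<bullet> uN = 0" using D(1,2) by simp_all
  have "((\<lambda>s. y (T - s) \<bullet> u s) has_integral 0) {0..T}"
  proof (rule has_integral_spike_finite[of "t ` {0..N}"])
    show "((\<lambda>_. 0 :: real) has_integral 0) {0..T}" by simp
    fix s assume s: "s \<in> {0..T} - t ` {0..N}"
    obtain n where n: "n \<in> {1..N}" "s \<in> {t (n - 1)<..<t n}"
      using open_cell_exists[OF t s] by blast
    have "0 < s" using n time_partition_cell[OF t n(1)] by auto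
    then have "y (T - s) = q (T - s)" using q(2) s by auto
    then show "y (T - s) \<bullet> u s = 0" using D(3) u n by simp
  qed simp
  then show "integral {0..T} (\<lambda>s. y (T - s) \<bullet> u s) = 0" by (rule integral_unique)
qed

lemma stieltjes_of_complementary:
  fixes A :: "real ^ 'j ^ 'k"
  assumes T: "0 < T" and t: "time_partition T N t"
    and u: "sclp_feasible A b x0 T u"
    and un: "steps N t u un"
    and bf: "boundary_feasible A b \<beta> lam T (integral {0..T} u) xt u0 uN xs xN" and x0: "x0 = xs + xt"
    and y: "continuous_on {0..T} y" "\<forall>s\<in>{0..T}. 0 \<le> y s" and yN: "0 \<le> yN"
    and zero: "integral {0..T} (\<lambda>s. y (T - s) \<bullet> u s) = 0" "yN \<bullet> u0 = 0" "y 0 \<bullet> uN = 0"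
  shows "stieltjes_inner T (\<lambda>s. terminated T y yN (T - s)) (composed_control T u u0 uN) = 0"
proof (rule stieltjes_inner_eq_0[OF composed_feasible[OF T u bf x0] T t])
  note uD = sclp_feasibleD[OF u]
  have u_pos: "\<forall>s\<in>{0..T}. 0 \<le> u s" using uD(4) by blast
  show "continuous_on {0..<T} (composed_control T u u0 uN)"
    unfolding composed_control_terminated by (rule continuous_on_terminated[OF continuous_on_integral_path[OF uD(1)]])
  show "(composed_control T u u0 uN \<longlongrightarrow> composed_control T u u0 uN T - uN) (at_left T)"
    by (rule composed_control_left_limit[OF uD(1) T])
  show "slopes N t (composed_control T u u0 uN) un"
    by (rule composed_control_derivative[OF t un])
  show "\<forall>n\<in>{1..N}. \<forall>s\<in>{t (n - 1)<..<t n}. terminated T y yN (T - s) \<bullet> un n = 0"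
  proof (intro ballI)
    fix n s assume n: "n \<in> {1..N}" "s \<in> {t (n - 1)<..<t n}"
    then have "terminated T y yN (T - s) = y (T - s)"
      using time_partition_cell[OF t n(1)] by (simp add: terminated_def)
    then show "terminated T y yN (T - s) \<bullet> un n = 0"
      using complementary_on_cells[OF t un u_pos y(2,1) zero(1)] n by simp
  qed
  show "\<forall>n\<in>{1..N}. 0 \<le> un n"
  proof
    fix n assume n: "n \<in> {1..N}"
    note cell = time_partition_cell[OF t n]
    define s where "s = (t (n - 1) + t n) / 2"
    have s: "s \<in> {t (n - 1)<..<t n}" using cell by (simp add: s_def)
    then have "u s = un n" using un n by blast
    moreover have "0 \<le> u s" using u_pos s cell by auto
    ultimately show "0 \<le> un n" by simp
  qed
  show "terminated T y yN (T - 0) \<bullet> composed_control T u u0 uN 0 = 0"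
    using zero(2) T by (simp add: terminated_def composed_control_def)
  show "terminated T y yN (T - T) \<bullet> uN = 0" using zero(3) T by (simp add: terminated_def)
  show "\<forall>s\<in>{0..T}. 0 \<le> terminated T y yN (T - s)" using y(2) yN by (simp add: terminated_def)
  show "0 \<le> uN" using bf by (simp add: boundary_feasible_def)
qed

lemma sclp_state_ge:
  assumes t: "time_partition T N t" and u: "u integrable_on {0..T}"
    and deriv: "slopes N t (sclp_state A b x0 u) xd"
    and s: "s \<in> {0..T}"
  shows "x0 - max_drop N t xd \<le> sclp_state A b x0 u s"
  unfolding less_eq_vec_def
proof
  fix k
  have "continuous_on {0..s} (sclp_state A b x0 u)"
    by (rule continuous_on_subset[OF continuous_on_sclp_state[OF u]]) (use s in auto)
  note piecewise_linear_ge_Min[OF t this deriv, of k]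
  then have "sclp_state A b x0 u 0 $ k + Min (insert 0 ((\<lambda>n. \<Sum>m = 1..n. (xd m $ k) * (t m - t (m - 1))) ` {1..N}))
    \<le> sclp_state A b x0 u s $ k" using s by simp
  moreover have "sclp_state A b x0 u 0 = x0" by (simp add: sclp_state_def)
  ultimately show "(x0 - max_drop N t xd) $ k \<le> sclp_state A b x0 u s $ k"
    by (simp only: max_drop_def vector_minus_component vec_lambda_beta diff_minus_eq_add)
qed

text \<open>
  The lower bound \<open>w\<close> of \<open>y\<close> is orthogonal to \<open>p\<close> because \<open>y\<close>, in reversed time, is orthogonal to \<open>p\<close>
  and everything is nonnegative.
\<close>

lemma slack_inner_integral_eq_0:
  fixes y p :: "real \<Rightarrow> real ^ 'n"
  assumes y: "continuous_on {0..T} y" "\<forall>s\<in>{0..T}. w \<le> y s" and w: "0 \<le> w"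
    and p: "p integrable_on {0..T}" "\<forall>s\<in>{0..T}. 0 \<le> p s"
    and zero: "integral {0..T} (\<lambda>s. y (T - s) \<bullet> p s) = 0"
  shows "w \<bullet> integral {0..T} p = 0"
proof -
  have pa: "p absolutely_integrable_on {0..T}" by (rule nonneg_absolutely_integrable_vec[OF p])
  have eq: "integral {0..T} (\<lambda>s. w \<bullet> p s) = w \<bullet> integral {0..T} p"
    using integral_linear[OF p(1) bounded_linear_inner_right[of w]] by (simp add: o_def)
  have "integral {0..T} (\<lambda>s. w \<bullet> p s) \<le> integral {0..T} (\<lambda>s. y (T - s) \<bullet> p s)"
  proof (rule integral_le)
    show "(\<lambda>s. w \<bullet> p s) integrable_on {0..T}"
      by (rule continuous_inner_integrable[OF pa]) (intro continuous_intros)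
    have "continuous_on {0..T} (\<lambda>s. y (T - s))"
      by (rule continuous_on_compose2[OF y(1)]) (auto intro!: continuous_intros)
    then show "(\<lambda>s. y (T - s) \<bullet> p s) integrable_on {0..T}"
      by (rule continuous_inner_integrable[OF pa])
    show "w \<bullet> p s \<le> y (T - s) \<bullet> p s" if "s \<in> {0..T}" for s
      using y(2) p(2) that by (intro inner_mono_vec) auto
  qed
  moreover have "0 \<le> w \<bullet> integral {0..T} p"
    using p by (intro inner_nonneg_vec[OF w] integral_nonneg_vec) auto
  ultimately show ?thesis using eq zero by simp
qed

section \<open>Coupled solutions\<close>

lemma decomposition_of_optimal:
  fixes A :: "real ^ 'j ^ 'k"
  assumes T: "0 < T" and t: "time_partition T N t"
    and opt: "mclp_optimal_pair A b c \<beta> \<gamma> lam \<mu> T U x P q"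
    and form: "mclp_form T N t U x P q un xd pn qd"
  shows "\<exists>x0 qN u p Ut xt u0 uN xs xN Pt qt pN p0 qs q0.
    composed_of A b c T N t U x P q x0 qN u p u0 uN xN pN p0 q0 \<and>
    coupled_solutions A b c \<beta> \<gamma> lam \<mu> T N t x0 qN u p un xd pn qd
      Ut xt u0 uN xs xN Pt qt pN p0 qs q0"
proof -
  let ?A = "- transpose A"
  define t' where "t' = (\<lambda>n. T - t (N - n))"
  define pn' where "pn' = (\<lambda>n. pn (N + 1 - n))"
  define qd' where "qd' = (\<lambda>n. qd (N + 1 - n))"
  have t': "time_partition T N t'"
    unfolding t'_def by (rule time_partition_reverse[OF t])
  have rev: "(\<forall>n\<in>{1..N}. \<forall>s\<in>{T - t n<..<T - t (n - 1)}. Q n s) \<longleftrightarrow>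
    (\<forall>n\<in>{1..N}. \<forall>s\<in>{t' (n - 1)<..<t' n}. Q (N + 1 - n) s)" for Q
    unfolding t'_def by (rule reverse_cells)
  have F: "mclp_feasible A b \<beta> lam T U x" and G: "mclp_feasible ?A (- c) (- \<gamma>) (- \<mu>) T P q"
    and cs: "stieltjes_inner T (\<lambda>s. x (T - s)) P = 0" "stieltjes_inner T (\<lambda>s. q (T - s)) U = 0"
    using opt by (simp_all add: mclp_optimal_pair_def mclp_dual_feasible_eq)
  have cU: "continuous_on {0..<T} U" and cP: "continuous_on {0..<T} P"
    using form by (simp_all add: mclp_form_def)
  have Ud: "slopes N t U un"
    and xd: "slopes N t x xd"
    and Pd0: "\<forall>n\<in>{1..N}. \<forall>s\<in>{T - t n<..<T - t (n - 1)}. (P has_vector_derivative pn n) (at s)"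
    and qd0: "\<forall>n\<in>{1..N}. \<forall>s\<in>{T - t n<..<T - t (n - 1)}. (q has_vector_derivative qd n) (at s)"
    using form unfolding mclp_form_def by blast+
  have Pd: "slopes N t' P pn'"
    using Pd0 unfolding rev pn'_def .
  have qd: "slopes N t' q qd'"
    using qd0 unfolding rev qd'_def .
  obtain u where u: "steps N t u un"
    "sclp_feasible A b (x 0) T u"
    "(U \<longlongrightarrow> U 0 + integral {0..T} u) (at_left T)"
    "\<forall>s\<in>{0..<T}. x s = sclp_state A b (x 0) u s"
    "slopes N t (sclp_state A b (x 0) u) xd"
    "boundary_feasible A b \<beta> lam T (integral {0..T} u) (max_drop N t xd) (U 0)
      (U T - (U 0 + integral {0..T} u)) (x 0 - max_drop N t xd) (x T)"
    by (rule mclp_decomposition[OF T t F cU Ud xd])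
  obtain p where p: "steps N t' p pn'"
    "sclp_feasible ?A (- c) (q 0) T p"
    "(P \<longlongrightarrow> P 0 + integral {0..T} p) (at_left T)"
    "\<forall>s\<in>{0..<T}. q s = sclp_state ?A (- c) (q 0) p s"
    "\<forall>n\<in>{1..N}. \<forall>s\<in>{t' (n - 1)<..<t' n}. (sclp_state ?A (- c) (q 0) p has_vector_derivative qd' n) (at s)"
    "boundary_feasible ?A (- c) (- \<gamma>) (- \<mu>) T (integral {0..T} p) (max_drop N t' qd') (P 0)
      (P T - (P 0 + integral {0..T} p)) (q 0 - max_drop N t' qd') (q T)"
    by (rule mclp_decomposition[OF T t' G cP Pd qd])
  define uN where "uN = U T - (U 0 + integral {0..T} u)"
  define p0 where "p0 = P T - (P 0 + integral {0..T} p)"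
  have limU: "(U \<longlongrightarrow> U T - uN) (at_left T)" using u(3) by (simp add: uN_def)
  have limP: "(P \<longlongrightarrow> P T - p0) (at_left T)" using p(3) by (simp add: p0_def)
  have x_pos: "\<forall>s\<in>{0..T}. 0 \<le> x s" and q_pos: "\<forall>s\<in>{0..T}. 0 \<le> q s"
    using F G by (simp_all add: mclp_feasible_def)
  note csU = complementary_of_stieltjes[OF T t F limU Ud u(1) q_pos p(4)
    continuous_on_sclp_state[OF sclp_feasibleD(1)[OF p(2)]] cs(2)]
  note csP = complementary_of_stieltjes[OF T t' G limP Pd p(1) x_pos u(4)
    continuous_on_sclp_state[OF sclp_feasibleD(1)[OF u(2)]] cs(1)]
  have pf: "sclp_dual_feasible A c (q 0) T p" using p(2) by (simp add: sclp_dual_feasible_eq)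
  note optimal = sclp_complementary_optimal[OF u(2) pf csU(3)[folded sclp_dual_state_eq] csP(3)]
  have pu: "\<forall>n\<in>{1..N}. \<forall>s\<in>{T - t n<..<T - t (n - 1)}. p s = pn n"
    using p(1) unfolding rev pn'_def .
  have qs: "\<forall>n\<in>{1..N}. \<forall>s\<in>{T - t n<..<T - t (n - 1)}. (sclp_dual_state A c (q 0) p has_vector_derivative qd n) (at s)"
    using p(5) unfolding rev qd'_def sclp_dual_state_eq .
  have comp: "composed_of A b c T N t U x P q (x 0) (q 0) u p (U 0) uN (x T) (P 0) p0 (q T)"
    unfolding composed_of_def
  proof (intro conjI refl limU limP)
    show "\<forall>n\<in>{1..N}. \<forall>s\<in>{t (n - 1)<..<t n}. (U has_vector_derivative u s) (at s)"
      using Ud u(1) by simp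
    show "\<forall>n\<in>{1..N}. \<forall>s\<in>{T - t n<..<T - t (n - 1)}. (P has_vector_derivative p s) (at s)"
      using Pd0 pu by simp
    show "\<forall>s\<in>{0<..<T}. x s = sclp_state A b (x 0) u s \<and> q s = sclp_dual_state A c (q 0) p s"
    proof
      fix s assume "s \<in> {0<..<T}"
      then have "s \<in> {0..<T}" by simp
      then show "x s = sclp_state A b (x 0) u s \<and> q s = sclp_dual_state A c (q 0) p s"
        unfolding sclp_dual_state_eq using u(4) p(4) by blast
    qed
  qed
  have "coupled_solutions A b c \<beta> \<gamma> lam \<mu> T N t (x 0) (q 0) u p un xd pn qd
    (integral {0..T} u) (max_drop N t xd) (U 0) uN (x 0 - max_drop N t xd) (x T)
    (integral {0..T} p) (max_drop N t' qd') (P 0) p0 (q 0 - max_drop N t' qd') (q T)"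
    unfolding coupled_solutions_def
  proof (intro conjI)
    show "0 \<le> x 0" "0 \<le> q 0" using x_pos q_pos T by auto
    show "sclp_optimal A b c (x 0) (q 0) T u" "sclp_dual_optimal A b c (x 0) (q 0) T p"
      by (rule optimal)+
    show "sclp_form A b c (x 0) (q 0) T N t u p un xd pn qd"
      unfolding sclp_form_def using u(1,5) pu qs by blast
    show "boundary_feasible A b \<beta> lam T (integral {0..T} u) (max_drop N t xd) (U 0) uN (x 0 - max_drop N t xd) (x T)"
      using u(6) by (simp only: uN_def)
    show "boundary_dual_feasible A c \<gamma> \<mu> T (integral {0..T} p) (max_drop N t' qd') (P 0) p0 (q 0 - max_drop N t' qd') (q T)"
      unfolding boundary_dual_feasible_eq using p(6) by (simp only: p0_def)
    show "coupling T N t (x 0) (q 0) u p xd qd (integral {0..T} u) (max_drop N t xd) (U 0) uN (x 0 - max_drop N t xd) (x T)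
      (integral {0..T} p) (max_drop N t' qd') (P 0) p0 (q 0 - max_drop N t' qd') (q T)"
      unfolding coupling_def
    proof (intro conjI allI)
      show "max_drop N t xd $ k = - Min (insert 0 ((\<lambda>n. \<Sum>m = 1..n. (xd m $ k) * (t m - t (m - 1))) ` {1..N}))" for k
        by (simp only: max_drop_def vec_lambda_beta)
      show "max_drop N t' qd' $ j = - Min (insert 0 ((\<lambda>n. \<Sum>m = n..N. (qd m $ j) * (t m - t (m - 1))) ` {1..N}))" for j
        unfolding t'_def qd'_def max_drop_reversed vec_lambda_beta ..
      show "x 0 \<bullet> p0 = 0" "x T \<bullet> P 0 = 0" "q 0 \<bullet> uN = 0" "q T \<bullet> U 0 = 0"
        by (rule csU csP)+
    qed simp_all
  qed
  with comp show ?thesis by blast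
qed

text \<open>
  Coupled solutions with the dual rewritten as a primal in reversed time.  The last two equations rest
  on strong duality: they are the complementary slackness of the optimal internal solutions.
\<close>

lemma coupled_solutionsD:
  fixes A :: "real ^ 'j ^ 'k"
  assumes T: "0 < T" and t: "time_partition T N t"
    and co: "coupled_solutions A b c \<beta> \<gamma> lam \<mu> T N t x0 qN u p un xd pn qd
      Ut xt u0 uN xs xN Pt qt pN p0 qs q0"
    and t'_def: "t' = (\<lambda>n. T - t (N - n))"
  shows "time_partition T N t'"
    and "sclp_feasible A b x0 T u" "sclp_feasible (- transpose A) (- c) qN T p"
    and "steps N t u un"
    and "\<forall>n\<in>{1..N}. \<forall>s\<in>{t' (n - 1)<..<t' n}. p s = pn (N + 1 - n)"
    and "slopes N t (sclp_state A b x0 u) xd"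
    and "\<forall>n\<in>{1..N}. \<forall>s\<in>{t' (n - 1)<..<t' n}.
      (sclp_state (- transpose A) (- c) qN p has_vector_derivative qd (N + 1 - n)) (at s)"
    and "xt = max_drop N t xd" "qt = max_drop N t' (\<lambda>n. qd (N + 1 - n))"
    and "integral {0..T} (\<lambda>s. sclp_state (- transpose A) (- c) qN p (T - s) \<bullet> u s) = 0"
    and "integral {0..T} (\<lambda>s. sclp_state A b x0 u (T - s) \<bullet> p s) = 0"
proof -
  have co': "0 \<le> x0" "0 \<le> qN" "sclp_optimal A b c x0 qN T u" "sclp_dual_optimal A b c x0 qN T p"
    "sclp_form A b c x0 qN T N t u p un xd pn qd"
    "coupling T N t x0 qN u p xd qd Ut xt u0 uN xs xN Pt qt pN p0 qs q0"
    by ((insert co[unfolded coupled_solutions_def]; elim conjE; assumption)+)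
  have rev: "(\<forall>n\<in>{1..N}. \<forall>s\<in>{T - t n<..<T - t (n - 1)}. Q n s) \<longleftrightarrow>
    (\<forall>n\<in>{1..N}. \<forall>s\<in>{t' (n - 1)<..<t' n}. Q (N + 1 - n) s)" for Q
    unfolding t'_def by (rule reverse_cells)
  show "time_partition T N t'" unfolding t'_def by (rule time_partition_reverse[OF t])
  show "sclp_feasible A b x0 T u" using co'(3) by (simp add: sclp_optimal_def)
  show "sclp_feasible (- transpose A) (- c) qN T p"
    using co'(4) by (simp add: sclp_dual_optimal_def sclp_dual_feasible_eq)
  show "steps N t u un"
    "slopes N t (sclp_state A b x0 u) xd"
    using co'(5) unfolding sclp_form_def by blast+
  have "\<forall>n\<in>{1..N}. \<forall>s\<in>{T - t n<..<T - t (n - 1)}. p s = pn n"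
    using co'(5) unfolding sclp_form_def by blast
  then show "\<forall>n\<in>{1..N}. \<forall>s\<in>{t' (n - 1)<..<t' n}. p s = pn (N + 1 - n)" unfolding rev .
  have "\<forall>n\<in>{1..N}. \<forall>s\<in>{T - t n<..<T - t (n - 1)}. (sclp_dual_state A c qN p has_vector_derivative qd n) (at s)"
    using co'(5) unfolding sclp_form_def by blast
  then show "\<forall>n\<in>{1..N}. \<forall>s\<in>{t' (n - 1)<..<t' n}.
    (sclp_state (- transpose A) (- c) qN p has_vector_derivative qd (N + 1 - n)) (at s)"
    unfolding rev sclp_dual_state_eq .
  have "\<forall>k. xt $ k = - Min (insert 0 ((\<lambda>n. \<Sum>m = 1..n. (xd m $ k) * (t m - t (m - 1))) ` {1..N}))"
    using co'(6) unfolding coupling_def by blast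
  then show "xt = max_drop N t xd" unfolding vec_eq_iff max_drop_def vec_lambda_beta .
  have "\<forall>j. qt $ j = - Min (insert 0 ((\<lambda>n. \<Sum>m = n..N. (qd m $ j) * (t m - t (m - 1))) ` {1..N}))"
    using co'(6) unfolding coupling_def by blast
  then show "qt = max_drop N t' (\<lambda>n. qd (N + 1 - n))"
    unfolding t'_def max_drop_reversed vec_eq_iff vec_lambda_beta .
  show "integral {0..T} (\<lambda>s. sclp_state (- transpose A) (- c) qN p (T - s) \<bullet> u s) = 0"
    "integral {0..T} (\<lambda>s. sclp_state A b x0 u (T - s) \<bullet> p s) = 0"
    using sclp_optimal_complementary[OF T co'(1-4)] unfolding sclp_dual_state_eq .
qed

lemma sclp_state_properties:
  assumes "sclp_feasible A b x0 T u" "0 < T"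
  shows "continuous_on {0..T} (sclp_state A b x0 u)" "\<forall>s\<in>{0..T}. 0 \<le> sclp_state A b x0 u s"
    "sclp_state A b x0 u 0 = x0"
  using assms continuous_on_sclp_state[OF sclp_feasibleD(1)[OF assms(1)]] sclp_state_nonneg[OF assms(1)]
  by (simp_all add: sclp_state_def)

lemma composition_of_coupled:
  fixes A :: "real ^ 'j ^ 'k"
  assumes T: "0 < T" and t: "time_partition T N t"
    and co: "coupled_solutions A b c \<beta> \<gamma> lam \<mu> T N t x0 qN u p un xd pn qd
      Ut xt u0 uN xs xN Pt qt pN p0 qs q0"
  shows "\<exists>U x P q. composed_of A b c T N t U x P q x0 qN u p u0 uN xN pN p0 q0 \<and>
    mclp_optimal_pair A b c \<beta> \<gamma> lam \<mu> T U x P q \<and> mclp_form T N t U x P q un xd pn qd"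
proof -
  let ?A = "- transpose A" and ?x = "sclp_state A b x0 u" and ?q = "sclp_state (- transpose A) (- c) qN p"
  define t' where "t' = (\<lambda>n. T - t (N - n))"
  note D = coupled_solutionsD[OF T t co t'_def]
  have rev: "(\<forall>n\<in>{1..N}. \<forall>s\<in>{T - t n<..<T - t (n - 1)}. Q n s) \<longleftrightarrow>
    (\<forall>n\<in>{1..N}. \<forall>s\<in>{t' (n - 1)<..<t' n}. Q (N + 1 - n) s)" for Q
    unfolding t'_def by (rule reverse_cells)
  have cpl: "x0 = xs + xt" "qN = qs + qt" "Ut = integral {0..T} u" "Pt = integral {0..T} p"
    "x0 \<bullet> p0 = 0" "xN \<bullet> pN = 0" "qN \<bullet> uN = 0" "q0 \<bullet> u0 = 0"
    by ((insert co[unfolded coupled_solutions_def coupling_def]; elim conjE; assumption)+)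
  have bf: "boundary_feasible A b \<beta> lam T (integral {0..T} u) xt u0 uN xs xN"
    and bg: "boundary_feasible ?A (- c) (- \<gamma>) (- \<mu>) T (integral {0..T} p) qt pN p0 qs q0"
    by ((insert co[unfolded coupled_solutions_def cpl(3,4) boundary_dual_feasible_eq]; elim conjE; assumption)+)
  have xN: "0 \<le> xN" "0 \<le> q0" using bf bg by (simp_all add: boundary_feasible_def)
  note X = sclp_state_properties[OF D(2) T] and Q = sclp_state_properties[OF D(3) T]
  define U where "U = composed_control T u u0 uN"
  define x where "x = terminated T ?x xN"
  define P where "P = composed_control T p pN p0"
  define q where "q = terminated T ?q q0"
  have uI: "u integrable_on {0..T}" and pI: "p integrable_on {0..T}"
    using sclp_feasibleD(1)[OF D(2)] sclp_feasibleD(1)[OF D(3)] .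
  have Ud: "slopes N t U un"
    unfolding U_def by (rule composed_control_derivative[OF t D(4)])
  have xd: "slopes N t x xd"
    unfolding x_def by (rule terminated_derivative[OF t D(6)])
  have Pd: "\<forall>n\<in>{1..N}. \<forall>s\<in>{T - t n<..<T - t (n - 1)}. (P has_vector_derivative pn n) (at s)"
    unfolding rev P_def by (rule composed_control_derivative[OF D(1,5)])
  have qd: "\<forall>n\<in>{1..N}. \<forall>s\<in>{T - t n<..<T - t (n - 1)}. (q has_vector_derivative qd n) (at s)"
    unfolding rev q_def by (rule terminated_derivative[OF D(1,7)])
  have pu: "\<forall>n\<in>{1..N}. \<forall>s\<in>{T - t n<..<T - t (n - 1)}. p s = pn n"
    unfolding rev by (rule D(5))
  have "composed_of A b c T N t U x P q x0 qN u p u0 uN xN pN p0 q0"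
    unfolding composed_of_def
  proof (intro conjI)
    show "x 0 = x0" "q 0 = qN" using T X(3) Q(3) by (simp_all add: x_def q_def terminated_def)
    show "U 0 = u0" "P 0 = pN" using T by (simp_all add: U_def P_def composed_control_def)
    show "x T = xN" "q T = q0" by (simp_all add: x_def q_def terminated_def)
    show "(U \<longlongrightarrow> U T - uN) (at_left T)" unfolding U_def by (rule composed_control_left_limit[OF uI T])
    show "(P \<longlongrightarrow> P T - p0) (at_left T)" unfolding P_def by (rule composed_control_left_limit[OF pI T])
    show "\<forall>n\<in>{1..N}. \<forall>s\<in>{t (n - 1)<..<t n}. (U has_vector_derivative u s) (at s)"
      using Ud D(4) by simp
    show "\<forall>n\<in>{1..N}. \<forall>s\<in>{T - t n<..<T - t (n - 1)}. (P has_vector_derivative p s) (at s)"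
      using Pd pu by simp
    show "\<forall>s\<in>{0<..<T}. x s = sclp_state A b x0 u s \<and> q s = sclp_dual_state A c qN p s"
      by (simp add: x_def q_def terminated_def sclp_dual_state_eq)
  qed
  moreover have "mclp_optimal_pair A b c \<beta> \<gamma> lam \<mu> T U x P q"
    unfolding mclp_optimal_pair_def mclp_dual_feasible_eq
  proof (intro conjI)
    show "mclp_feasible A b \<beta> lam T U x"
      unfolding U_def x_def by (rule composed_feasible[OF T D(2) bf cpl(1)])
    show "mclp_feasible ?A (- c) (- \<gamma>) (- \<mu>) T P q"
      unfolding P_def q_def by (rule composed_feasible[OF T D(3) bg cpl(2)])
    show "stieltjes_inner T (\<lambda>s. q (T - s)) U = 0"
      unfolding q_def U_def
      by (rule stieltjes_of_complementary[OF T t D(2,4) bf cpl(1) Q(1,2) xN(2) D(10) cpl(8)])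
        (simp only: Q(3) cpl(7))
    show "stieltjes_inner T (\<lambda>s. x (T - s)) P = 0"
      unfolding x_def P_def
      by (rule stieltjes_of_complementary[OF T D(1,3,5) bg cpl(2) X(1,2) xN(1) D(11) cpl(6)])
        (simp only: X(3) cpl(5))
  qed
  moreover have "mclp_form T N t U x P q un xd pn qd"
    unfolding mclp_form_def
  proof (intro conjI)
    show "continuous_on {0..<T} U" "continuous_on {0..<T} P"
      unfolding U_def P_def composed_control_terminated
      by (rule continuous_on_terminated[OF continuous_on_integral_path] uI pI)+
    show "continuous_on {0..<T} x" "continuous_on {0..<T} q"
      unfolding x_def q_def by (rule continuous_on_terminated X Q)+
  qed (use Ud xd Pd qd in blast)+
  ultimately show ?thesis by blast
qed

text \<open>
  Complementary slackness for \<open>boundary_optimal_of_complementary\<close> comes from the coupling, up to the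
  products \<open>xs \<bullet> Pt\<close> and \<open>qs \<bullet> Ut\<close>.  These vanish because \<open>xs\<close> and \<open>qs\<close> are lower bounds of the internal
  states.
\<close>

lemma coupled_boundary_optimal:
  fixes A :: "real ^ 'j ^ 'k"
  assumes T: "0 < T" and t: "time_partition T N t"
    and co: "coupled_solutions A b c \<beta> \<gamma> lam \<mu> T N t x0 qN u p un xd pn qd
      Ut xt u0 uN xs xN Pt qt pN p0 qs q0"
  shows "boundary_optimal A b c \<beta> \<gamma> lam \<mu> T Ut xt u0 uN xs xN"
    and "boundary_dual_optimal A b c \<beta> \<gamma> lam \<mu> T Pt qt pN p0 qs q0"
proof -
  let ?A = "- transpose A"
  define t' where "t' = (\<lambda>n. T - t (N - n))"
  note D = coupled_solutionsD[OF T t co t'_def]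
  have cpl: "x0 = xs + xt" "qN = qs + qt" "Ut = integral {0..T} u" "Pt = integral {0..T} p"
    "x0 \<bullet> p0 = 0" "xN \<bullet> pN = 0" "qN \<bullet> uN = 0" "q0 \<bullet> u0 = 0"
    by ((insert co[unfolded coupled_solutions_def coupling_def]; elim conjE; assumption)+)
  have bf: "boundary_feasible A b \<beta> lam T Ut xt u0 uN xs xN"
    and bg: "boundary_dual_feasible A c \<gamma> \<mu> T Pt qt pN p0 qs q0"
    by ((insert co[unfolded coupled_solutions_def]; elim conjE; assumption)+)
  have bf': "boundary_dual_feasible ?A (- b) (- \<beta>) (- lam) T Ut xt u0 uN xs xN"
    using bf by (simp add: boundary_dual_feasible_eq transpose_minus)
  have bg': "boundary_feasible ?A (- c) (- \<gamma>) (- \<mu>) T Pt qt pN p0 qs q0"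
    using bg by (simp add: boundary_dual_feasible_eq)
  have nn: "0 \<le> u0" "0 \<le> uN" "0 \<le> xs" "0 \<le> pN" "0 \<le> p0" "0 \<le> qs"
    using bf bg by (simp_all add: boundary_feasible_def boundary_dual_feasible_def)
  note X = sclp_state_properties[OF D(2) T] and Q = sclp_state_properties[OF D(3) T]
  have uI: "u integrable_on {0..T}" "\<forall>s\<in>{0..T}. 0 \<le> u s" and pI: "p integrable_on {0..T}" "\<forall>s\<in>{0..T}. 0 \<le> p s"
    using D(2,3) by (simp_all add: sclp_feasible_def)
  have tn: "0 \<le> xt" "0 \<le> qt" unfolding D(8,9) by (rule max_drop_nonneg)+
  have Un: "0 \<le> Ut" "0 \<le> Pt" unfolding cpl(3,4) by (intro integral_nonneg_vec; use uI pI in blast)+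
  have "xs = x0 - max_drop N t xd" using cpl(1) unfolding D(8)[symmetric] by simp
  then have "\<forall>s\<in>{0..T}. xs \<le> sclp_state A b x0 u s"
    using sclp_state_ge[OF t uI(1) D(6)] by blast
  from slack_inner_integral_eq_0[OF X(1) this nn(3) pI D(11)]
  have xsP: "xs \<bullet> Pt = 0" by (simp only: cpl(4))
  have "qs = qN - max_drop N t' (\<lambda>n. qd (N + 1 - n))" using cpl(2) unfolding D(9)[symmetric] by simp
  then have "\<forall>s\<in>{0..T}. qs \<le> sclp_state ?A (- c) qN p s"
    using sclp_state_ge[OF D(1) pI(1) D(7)] by blast
  from slack_inner_integral_eq_0[OF Q(1) this nn(6) uI D(10)]
  have qsU: "qs \<bullet> Ut = 0" by (simp only: cpl(3))
  have xsp: "xs \<bullet> p0 = 0"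
    using inner_nonneg_vec[OF nn(3,5)] inner_nonneg_vec[OF tn(1) nn(5)] cpl(5)
    unfolding cpl(1) inner_add_left by linarith
  have qsu: "qs \<bullet> uN = 0"
    using inner_nonneg_vec[OF nn(6,2)] inner_nonneg_vec[OF tn(2) nn(2)] cpl(7)
    unfolding cpl(2) inner_add_left by linarith
  show "boundary_optimal A b c \<beta> \<gamma> lam \<mu> T Ut xt u0 uN xs xN"
    by (rule boundary_optimal_of_complementary[OF bf bg Un(2) tn(2) _ cpl(8,6) xsp xsP])
      (use cpl(2,7) in simp)
  show "boundary_dual_optimal A b c \<beta> \<gamma> lam \<mu> T Pt qt pN p0 qs q0"
    unfolding boundary_dual_optimal_eq
    by (rule boundary_optimal_of_complementary[OF bg' bf' Un(1) tn(1) _ cpl(6,8) qsu qsU])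
      (use cpl(1,5) in simp)
qed

section \<open>The decomposition theorem\<close>

theorem theorem4p3:
  fixes A :: "real ^ 'j ^ 'k" and b \<beta> lam :: "real ^ 'k" and c \<gamma> \<mu> :: "real ^ 'j" and T :: real
  assumes "lam \<le> 0" and "0 \<le> \<mu>" and "0 < T"
  shows
    "(\<forall>N t U x P q un xd pn qd.
        time_partition T N t \<and>
        mclp_optimal_pair A b c \<beta> \<gamma> lam \<mu> T U x P q \<and>
        mclp_form T N t U x P q un xd pn qd \<longrightarrow>
        (\<exists>x0 qN u p Ut xt u0 uN xs xN Pt qt pN p0 qs q0.
           composed_of A b c T N t U x P q x0 qN u p u0 uN xN pN p0 q0 \<and>
           coupled_solutions A b c \<beta> \<gamma> lam \<mu> T N t x0 qN u p un xd pn qd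
             Ut xt u0 uN xs xN Pt qt pN p0 qs q0)) \<and>
     (\<forall>N t x0 qN u p un xd pn qd Ut xt u0 uN xs xN Pt qt pN p0 qs q0.
        time_partition T N t \<and>
        coupled_solutions A b c \<beta> \<gamma> lam \<mu> T N t x0 qN u p un xd pn qd
          Ut xt u0 uN xs xN Pt qt pN p0 qs q0 \<longrightarrow>
        (\<exists>U x P q.
           composed_of A b c T N t U x P q x0 qN u p u0 uN xN pN p0 q0 \<and>
           mclp_optimal_pair A b c \<beta> \<gamma> lam \<mu> T U x P q \<and>
           mclp_form T N t U x P q un xd pn qd)) \<and>
     (\<forall>N t x0 qN u p un xd pn qd Ut xt u0 uN xs xN Pt qt pN p0 qs q0.
        time_partition T N t \<and>
        coupled_solutions A b c \<beta> \<gamma> lam \<mu> T N t x0 qN u p un xd pn qd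
          Ut xt u0 uN xs xN Pt qt pN p0 qs q0 \<longrightarrow>
        boundary_optimal A b c \<beta> \<gamma> lam \<mu> T Ut xt u0 uN xs xN \<and>
        boundary_dual_optimal A b c \<beta> \<gamma> lam \<mu> T Pt qt pN p0 qs q0)"
proof (intro conjI allI impI; elim conjE)
  fix N t U x P q un xd pn qd
  assume "time_partition T N t" "mclp_optimal_pair A b c \<beta> \<gamma> lam \<mu> T U x P q"
    "mclp_form T N t U x P q un xd pn qd"
  then show "\<exists>x0 qN u p Ut xt u0 uN xs xN Pt qt pN p0 qs q0.
      composed_of A b c T N t U x P q x0 qN u p u0 uN xN pN p0 q0 \<and>
      coupled_solutions A b c \<beta> \<gamma> lam \<mu> T N t x0 qN u p un xd pn qd
        Ut xt u0 uN xs xN Pt qt pN p0 qs q0"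
    by (rule decomposition_of_optimal[OF assms(3)])
next
  fix N t x0 qN u p un xd pn qd Ut xt u0 uN xs xN Pt qt pN p0 qs q0
  assume *: "time_partition T N t" "coupled_solutions A b c \<beta> \<gamma> lam \<mu> T N t x0 qN u p un xd pn qd
    Ut xt u0 uN xs xN Pt qt pN p0 qs q0"
  then show "\<exists>U x P q.
      composed_of A b c T N t U x P q x0 qN u p u0 uN xN pN p0 q0 \<and>
      mclp_optimal_pair A b c \<beta> \<gamma> lam \<mu> T U x P q \<and>
      mclp_form T N t U x P q un xd pn qd"
    by (rule composition_of_coupled[OF assms(3)])
  show "boundary_optimal A b c \<beta> \<gamma> lam \<mu> T Ut xt u0 uN xs xN"
    "boundary_dual_optimal A b c \<beta> \<gamma> lam \<mu> T Pt qt pN p0 qs q0"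
    by (rule coupled_boundary_optimal[OF assms(3) *])+
qed

end
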